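(* Let $U\in\mathcal C^{1,4}_b(\mathbb R\times\mathcal P_2(\mathbb R))$. Then $U$ is Lasry-Lions monotone if and only if $U$ satisfies the second-order Lasry-Lions monotonicity condition, i.e. $$\mathbb E\Big[(\eta_1,\eta_2)\,\mathfrak D_\mu U(\xi,\mathcal L_\xi,\tilde\xi)\,(\tilde\eta_1,\tilde\eta_2)^\top\Big]\ge 0\qquad\text{for all }\xi,\eta_1,\eta_2\in\mathbb L^2(\mathcal F_T),$$ where $(\tilde\xi,\tilde\eta_1,\tilde\eta_2)$ is an independent copy of $(\xi,\eta_1,\eta_2)$.
   Context: Setting: $T>0$ is fixed; $(\Omega,\mathbb F,\mathbb P)$ is a filtered probability space with a Brownian motion $B$, where $\mathcal F_0$ is rich enough to support every probability measure on $\mathbb R$ and $\mathbb F=\{\mathcal F_t\}_{0\le t\le T}$ is generated by $\mathcal F_0$ and $B$. $\mathcal P_2(\mathbb R)$ is the set of probability measures on $\mathbb R$ with finite second moment, equipped with the 2-Wasserstein distance $W_2$; $\mathbb L^2(\mathcal F_T)$ is the set of square integrable $\mathcal F_T$-measurable real random variables; $\mathcal L_\xi$ is the law of $\xi$. Independent copies live on a product space, and $\mathbb E$ is the expectation there. Lions derivative: for a $W_2$-continuous $U:\mathcal P_2(\mathbb R)\to\mathbb R$, $\partial_\mu U:\mathcal P_2(\mathbb R)\times\mathbb R\to\mathbb R$, $(\mu,\tilde x)\mapsto\partial_\mu U(\mu,\tilde x)$, satisfies $U(\mathcal L_{\xi+\eta})-U(\mathcal L_\xi)=\mathbb E[\partial_\mu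 U(\mathcal L_\xi,\xi)\eta]+o(\|\eta\|_2)$ for all $\xi,\eta\in\mathbb L^2(\mathcal F_T)$. For $U(x,\mu)$ we write $\partial_\mu U(x,\mu,\tilde x)$, and $\partial_{x\mu}U=\partial_x\partial_\mu U$, $\partial_{\tilde x x\mu}U=\partial_{\tilde x}\partial_x\partial_\mu U$, etc. The space $\mathcal C^{1,4}_b(\mathbb R\times\mathcal P_2(\mathbb R))$ consists of the continuous $U:\mathbb R\times\mathcal P_2(\mathbb R)\to\mathbb R$ for which the derivatives $\partial_x^{(k)}U$ ($0\le k\le4$), $\partial_x^{(k)}\partial_\mu U$ ($0\le k\le 3$), $\partial_x^{(k)}\partial_{\tilde x\mu}U$ ($0\le k\le2$) exist and are continuous, and all the involved derivatives (but not necessarily $U$ itself) are uniformly bounded. Matrix: $$\mathfrak D_\mu U(x,\mu,\tilde x):=\begin{pmatrix}\partial_{x\mu}U&\partial_{\tilde x x\mu}U\\ \partial_{xx\mu}U&\partial_{\tilde x xx\mu}U\end{pmatrix}(x,\mu,\tilde x).$$ $U$ is called Lasry-Lions monotone if $\mathbb E[U(\xi_1,\mathcal L_{\xi_1})+U(\xi_2,\mathcal L_{\xi_2})-U(\xi_1,\mathcal L_{\xi_2})-U(\xi_2,\mathcal L_{\xi_1})]\ge0$ for all $\xi_1,\xi_2\in\mathbb L^2(\mathcal F_T)$. For $U\in\mathcal C^{1,4}_b(\mathbb R\times\mathcal P_2(\mathbb R))$ it is known that Lasry-Lions monotonicity is equivalent to the differential form $\mathbb E[\partial_{x\mu}U(\xi,\mathcal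 L_\xi,\tilde\xi)\eta\tilde\eta]\ge0$ for all $\xi,\eta\in\mathbb L^2(\mathcal F_T)$, with $(\tilde\xi,\tilde\eta)$ an independent copy of $(\xi,\eta)$. *)

theory Defs
  imports "HOL-Probability.Probability"
begin

section \<open>The probabilistic setting\<close>

text \<open>
  \<open>B\<close> is a Brownian motion relative to the filtration \<open>F\<close>: in particular its increments after
  time \<open>s\<close> are independent of \<open>F s\<close>, so that \<open>B\<close> is independent of \<open>F 0\<close>. Only the values of
  \<open>F\<close> and \<open>B\<close> at times in \<open>[0, T]\<close> matter.
\<close>

locale rich_brownian_space = prob_space M
  for M :: "'a measure" +
  fixes F :: "real \<Rightarrow> 'a measure" and B :: "real \<Rightarrow> 'a \<Rightarrow> real" and T :: real
  assumes T_pos: "0 < T"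
    and subalgebra_F: "\<And>t. t \<in> {0..T} \<Longrightarrow> subalgebra M (F t)"
    and sets_F: "\<And>t. t \<in> {0..T} \<Longrightarrow>
      sets (F t) = sigma_sets (space M)
        (sets (F 0) \<union> {B s -` A \<inter> space M | s A. s \<in> {0..t} \<and> A \<in> sets borel})"
    and rich_F_0: "\<And>\<nu> :: real measure. real_distribution \<nu> \<Longrightarrow>
      \<exists>X \<in> borel_measurable (F 0). distr M borel X = \<nu>"
    and B_0: "AE \<omega> in M. B 0 \<omega> = 0"
    and B_continuous: "AE \<omega> in M. continuous_on {0..T} (\<lambda>t. B t \<omega>)"
    and B_increment_normal: "\<And>s t. 0 \<le> s \<Longrightarrow> s < t \<Longrightarrow> t \<le> T \<Longrightarrow>
      distributed M lborel (\<lambda>\<omega>. B t \<omega> - B s \<omega>) (normal_density 0 (sqrt (t - s)))"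
    and B_increment_indep: "\<And>s t. 0 \<le> s \<Longrightarrow> s < t \<Longrightarrow> t \<le> T \<Longrightarrow>
      indep_set (sets (F s)) {(\<lambda>\<omega>. B t \<omega> - B s \<omega>) -` A \<inter> space M | A. A \<in> sets borel}"

text \<open>
  Square integrable random variables on \<open>(\<Omega>, G)\<close>, for a sub-\<open>\<sigma>\<close>-algebra \<open>G\<close> of \<open>M\<close>
  (below always \<open>G = F T\<close>). Expectations are taken under \<open>M\<close>.
\<close>

definition L2 :: "'a measure \<Rightarrow> 'a measure \<Rightarrow> ('a \<Rightarrow> real) set" where
  "L2 M G = {\<xi> \<in> borel_measurable G. integrable M (\<lambda>\<omega>. (\<xi> \<omega>)\<^sup>2)}"

definition L2_norm :: "'a measure \<Rightarrow> ('a \<Rightarrow> real) \<Rightarrow> real" where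
  "L2_norm M \<xi> = sqrt (\<integral>\<omega>. (\<xi> \<omega>)\<^sup>2 \<partial>M)"

definition law :: "'a measure \<Rightarrow> ('a \<Rightarrow> real) \<Rightarrow> real measure" where
  "law M \<xi> = distr M borel \<xi>"


section \<open>The Wasserstein space of order two\<close>

definition P2 :: "real measure set" where
  "P2 = {\<mu>. real_distribution \<mu> \<and> integrable \<mu> (\<lambda>x. x\<^sup>2)}"

definition couplings :: "real measure \<Rightarrow> real measure \<Rightarrow> (real \<times> real) measure set" where
  "couplings \<mu> \<nu> = {\<pi>. prob_space \<pi> \<and> sets \<pi> = sets borel
     \<and> distr \<pi> borel fst = \<mu> \<and> distr \<pi> borel snd = \<nu>}"

definition W2 :: "real measure \<Rightarrow> real measure \<Rightarrow> real" where
  "W2 \<mu> \<nu> = sqrt (INF \<pi> \<in> couplings \<mu> \<nu>. \<integral>z. (fst z - snd z)\<^sup>2 \<partial>\<pi>)"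

text \<open>
  Continuity on \<open>'p \<times> P2\<close>, where \<open>P2\<close> carries the distance \<open>W2\<close>; \<open>'p\<close> is \<open>\<real>\<close> or \<open>\<real> \<times> \<real>\<close>.
  Values outside \<open>P2\<close> are irrelevant.
\<close>

definition continuous_P2 :: "('p::metric_space \<Rightarrow> real measure \<Rightarrow> real) \<Rightarrow> bool" where
  "continuous_P2 f \<longleftrightarrow> (\<forall>p. \<forall>\<mu>\<in>P2. \<forall>\<epsilon>>0. \<exists>\<delta>>0. \<forall>q. \<forall>\<nu>\<in>P2.
     dist q p < \<delta> \<and> W2 \<nu> \<mu> < \<delta> \<longrightarrow> \<bar>f q \<nu> - f p \<mu>\<bar> < \<epsilon>)"

definition bounded_P2 :: "('p \<Rightarrow> real measure \<Rightarrow> real) \<Rightarrow> bool" where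
  "bounded_P2 f \<longleftrightarrow> (\<exists>C. \<forall>p. \<forall>\<mu>\<in>P2. \<bar>f p \<mu>\<bar> \<le> C)"


section \<open>Derivatives\<close>

text \<open>
  The expansion determines \<open>V (\<mu>, \<cdot>)\<close> only up to \<open>\<mu>\<close>-null sets; continuity on \<open>P2 \<times> \<real>\<close> singles
  out one version, since measures with full support are dense in \<open>P2\<close>. The integrability
  condition says that \<open>\<eta> \<mapsto> E[V(L\<^sub>\<xi>, \<xi>) \<eta>]\<close> is a bounded linear functional on \<open>L2\<close>, and keeps
  the Bochner integral from taking its default value \<open>0\<close>.
\<close>

definition is_lions_derivative ::
  "'a measure \<Rightarrow> 'a measure \<Rightarrow> (real measure \<Rightarrow> real) \<Rightarrow> (real measure \<times> real \<Rightarrow> real) \<Rightarrow> bool" where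
  "is_lions_derivative M G u V \<longleftrightarrow>
     continuous_P2 (\<lambda>y \<mu>. V (\<mu>, y)) \<and>
     (\<forall>\<mu>\<in>P2. integrable \<mu> (\<lambda>y. (V (\<mu>, y))\<^sup>2)) \<and>
     (\<forall>\<xi>\<in>L2 M G. \<forall>\<epsilon>>0. \<exists>\<delta>>0. \<forall>\<eta>\<in>L2 M G. L2_norm M \<eta> < \<delta> \<longrightarrow>
        \<bar>u (law M (\<lambda>\<omega>. \<xi> \<omega> + \<eta> \<omega>)) - u (law M \<xi>) - (\<integral>\<omega>. V (law M \<xi>, \<xi> \<omega>) * \<eta> \<omega> \<partial>M)\<bar>
          \<le> \<epsilon> * L2_norm M \<eta>)"

definition lions_deriv ::
  "'a measure \<Rightarrow> 'a measure \<Rightarrow> (real measure \<Rightarrow> real) \<Rightarrow> real measure \<times> real \<Rightarrow> real" where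
  "lions_deriv M G u = (SOME V. is_lions_derivative M G u V)"

definition D\<mu> ::
  "'a measure \<Rightarrow> 'a measure \<Rightarrow> (real \<Rightarrow> real measure \<Rightarrow> real) \<Rightarrow> real \<Rightarrow> real measure \<times> real \<Rightarrow> real" where
  "D\<mu> M G U x = lions_deriv M G (U x)"

text \<open>
  Partial derivatives in \<open>x\<close> of \<open>U x \<mu>\<close> and of \<open>f x (\<mu>, y)\<close>, and in \<open>y\<close> (written with a tilde
  over \<open>x\<close> in the literature) of \<open>f x (\<mu>, y)\<close>.
\<close>

definition Dx :: "nat \<Rightarrow> (real \<Rightarrow> 'p \<Rightarrow> real) \<Rightarrow> real \<Rightarrow> 'p \<Rightarrow> real" where
  "Dx k f x p = (deriv ^^ k) (\<lambda>z. f z p) x"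

definition Dx_exists :: "nat \<Rightarrow> (real \<Rightarrow> 'p \<Rightarrow> real) \<Rightarrow> 'p \<Rightarrow> bool" where
  "Dx_exists n f p \<longleftrightarrow> (\<forall>k<n. \<forall>x. (\<lambda>z. Dx k f z p) differentiable (at x))"

definition Dy :: "(real \<Rightarrow> 'm \<times> real \<Rightarrow> real) \<Rightarrow> real \<Rightarrow> 'm \<times> real \<Rightarrow> real" where
  "Dy f x = (\<lambda>(\<mu>, y). deriv (\<lambda>w. f x (\<mu>, w)) y)"

definition C14b :: "'a measure \<Rightarrow> 'a measure \<Rightarrow> (real \<Rightarrow> real measure \<Rightarrow> real) set" where
  "C14b M G = {U.
     (\<forall>\<mu>\<in>P2. Dx_exists 4 U \<mu>) \<and>
     (\<forall>k\<le>4. continuous_P2 (Dx k U)) \<and>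
     (\<forall>k\<in>{1..4}. bounded_P2 (Dx k U)) \<and>
     (\<forall>x. \<exists>V. is_lions_derivative M G (U x) V) \<and>
     (\<forall>\<mu>\<in>P2. \<forall>y. Dx_exists 3 (D\<mu> M G U) (\<mu>, y)) \<and>
     (\<forall>k\<le>3. continuous_P2 (\<lambda>(x, y) \<mu>. Dx k (D\<mu> M G U) x (\<mu>, y)) \<and>
            bounded_P2 (\<lambda>(x, y) \<mu>. Dx k (D\<mu> M G U) x (\<mu>, y))) \<and>
     (\<forall>x. \<forall>\<mu>\<in>P2. \<forall>y. (\<lambda>w. D\<mu> M G U x (\<mu>, w)) differentiable (at y)) \<and>
     (\<forall>\<mu>\<in>P2. \<forall>y. Dx_exists 2 (Dy (D\<mu> M G U)) (\<mu>, y)) \<and>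
     (\<forall>k\<le>2. continuous_P2 (\<lambda>(x, y) \<mu>. Dx k (Dy (D\<mu> M G U)) x (\<mu>, y)) \<and>
            bounded_P2 (\<lambda>(x, y) \<mu>. Dx k (Dy (D\<mu> M G U)) x (\<mu>, y)))}"


section \<open>Monotonicity conditions\<close>

definition lasry_lions_monotone ::
  "'a measure \<Rightarrow> 'a measure \<Rightarrow> (real \<Rightarrow> real measure \<Rightarrow> real) \<Rightarrow> bool" where
  "lasry_lions_monotone M G U \<longleftrightarrow> (\<forall>\<xi>\<^sub>1\<in>L2 M G. \<forall>\<xi>\<^sub>2\<in>L2 M G.
     0 \<le> (\<integral>\<omega>. U (\<xi>\<^sub>1 \<omega>) (law M \<xi>\<^sub>1) + U (\<xi>\<^sub>2 \<omega>) (law M \<xi>\<^sub>2)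
             - U (\<xi>\<^sub>1 \<omega>) (law M \<xi>\<^sub>2) - U (\<xi>\<^sub>2 \<omega>) (law M \<xi>\<^sub>1) \<partial>M))"

definition DD\<mu> ::
  "'a measure \<Rightarrow> 'a measure \<Rightarrow> (real \<Rightarrow> real measure \<Rightarrow> real)
    \<Rightarrow> real \<Rightarrow> real measure \<Rightarrow> real \<Rightarrow> real^2^2" where
  "DD\<mu> M G U x \<mu> y = vector
     [vector [Dx 1 (D\<mu> M G U) x (\<mu>, y), Dy (Dx 1 (D\<mu> M G U)) x (\<mu>, y)],
      vector [Dx 2 (D\<mu> M G U) x (\<mu>, y), Dy (Dx 2 (D\<mu> M G U)) x (\<mu>, y)]]"

text \<open>
  The independent copy of \<open>(\<xi>, \<eta>\<^sub>1, \<eta>\<^sub>2)\<close> is obtained by evaluating in the second coordinate of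
  the product space.
\<close>

definition second_order_lasry_lions_monotone ::
  "'a measure \<Rightarrow> 'a measure \<Rightarrow> (real \<Rightarrow> real measure \<Rightarrow> real) \<Rightarrow> bool" where
  "second_order_lasry_lions_monotone M G U \<longleftrightarrow>
     (\<forall>\<xi>\<in>L2 M G. \<forall>\<eta>\<^sub>1\<in>L2 M G. \<forall>\<eta>\<^sub>2\<in>L2 M G.
        0 \<le> (\<integral>(\<omega>, \<omega>'). (vector [\<eta>\<^sub>1 \<omega>, \<eta>\<^sub>2 \<omega>] :: real^2) \<bullet>
               (DD\<mu> M G U (\<xi> \<omega>) (law M \<xi>) (\<xi> \<omega>') *v vector [\<eta>\<^sub>1 \<omega>', \<eta>\<^sub>2 \<omega>'])
             \<partial>(M \<Otimes>\<^sub>M M)))"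

end

theory Submission
  imports Defs
begin

text \<open>
  Both conditions are equivalent to the differential form
  \<open>E[\<partial>\<^sub>x\<partial>\<^sub>\<mu>U(\<xi>, L\<^sub>\<xi>, \<xi>') \<eta> \<eta>'] \<ge> 0\<close>, where primes denote an independent copy. The mean value theorem
  along \<open>s \<mapsto> \<xi> + s \<eta>\<close> writes the Lasry-Lions expression of \<open>(\<xi> + \<eta>, \<xi>)\<close> as this form at some
  \<open>\<xi> + s \<eta>\<close>, up to a cubic error in \<open>\<eta>\<close>. Applied to \<open>\<epsilon> \<eta>\<close>, this gives the differential form from
  monotonicity. Conversely, if the two laws dominate a multiple of Lebesgue measure on a common
  bounded interval, then the quantile functions along the segment of mixtures between them are Lipschitz in
  the parameter, and the cubic errors of \<open>N\<close> steps add up to \<open>O(1/N)\<close>; general laws are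
  approximated by such laws.

  The second-order condition contains the differential form as \<open>\<eta>\<^sub>2 = 0\<close>. Conversely it is the limit of the
  differential form for random variables that move \<open>\<xi>\<close> by \<open>h\<close> with probability \<open>1/2\<close>, since
  \<open>E[\<phi>(\<xi>) \<eta>\<^sub>1 + \<phi>'(\<xi>) \<eta>\<^sub>2]\<close> is a limit of difference quotients in \<open>\<phi>\<close>.
\<close>

section \<open>Derivatives\<close>

text \<open>The obstacle is the return from the differential form. On the segment
  \<open>\<xi> + s * \<eta>\<close> the Lasry-Lions expression keeps both end points as arguments of
  \<open>U\<close> while only the law moves, so its derivative matches the quadratic form only up to
  a third-order term; and the expressions of short pieces do not add up to that of the whole. Along
  mixtures they do, because all differences of laws are multiples of one signed measure. But a
  mixture step of mass \<open>1/N\<close> may carry that mass over a distance of order one; its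
  error is then of order \<open>1/N^2\<close> instead of \<open>1/N^3\<close>, just too large for
  the sum to vanish. A lower bound on the densities forces short transport, hence the regularised
  laws. The second-order half meets another obstacle: its coin must be independent of the given
  variables, and the original space need not offer one. The differential form is therefore
  transferred to arbitrary probability spaces, by discretisation because richness supplies a single
  real variable of given law.\<close>

lemma Dx_0 [simp]: "Dx 0 f x p = f x p"
  by (simp add: Dx_def)

lemma Dx_exists_DERIV:
  assumes "Dx_exists n f p" "k < n"
  shows "((\<lambda>z. Dx k f z p) has_real_derivative Dx (Suc k) f x p) (at x)"
proof -
  have "(\<lambda>z. Dx k f z p) differentiable (at x)"
    using assms by (auto simp: Dx_exists_def)
  moreover have "Dx (Suc k) f x p = deriv (\<lambda>z. Dx k f z p) x"
    by (simp add: Dx_def)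
  ultimately show ?thesis
    by (simp add: DERIV_deriv_iff_real_differentiable)
qed

text \<open>Recording the intermediate point as \<open>a + t * h\<close> covers either sign of
  \<open>h\<close> and \<open>h = 0\<close> at once, and leaves the limit \<open>h -> 0\<close> to
  \<open>tendsto_shift\<close>.\<close>

lemma DERIV_mvt_exists:
  fixes f :: "real \<Rightarrow> real"
  assumes "\<And>x. (f has_real_derivative f' x) (at x)"
  obtains t where "0 \<le> t" "t \<le> 1" "f (a + h) - f a = h * f' (a + t * h)"
proof (cases h "0::real" rule: linorder_cases)
  case less
  then obtain z where z: "a + h < z" "z < a" "f a - f (a + h) = (a - (a + h)) * f' z"
    using MVT2[of "a + h" a f f'] assms by auto
  with less show ?thesis
    by (intro that[of "(z - a) / h"]) (auto simp: field_simps)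
next
  case equal
  then show ?thesis by (intro that[of 0]) auto
next
  case greater
  then obtain z where z: "a < z" "z < a + h" "f (a + h) - f a = (a + h - a) * f' z"
    using MVT2[of a "a + h" f f'] assms by auto
  with greater show ?thesis
    by (intro that[of "(z - a) / h"]) (auto simp: field_simps)
qed

lemma lipschitz_of_bounded_deriv:
  fixes f :: "real \<Rightarrow> real"
  assumes "\<And>x. (f has_real_derivative f' x) (at x)" "\<And>x. \<bar>f' x\<bar> \<le> C"
  shows "\<bar>f y - f x\<bar> \<le> C * \<bar>y - x\<bar>"
proof -
  obtain t where "f (x + (y - x)) - f x = (y - x) * f' (x + t * (y - x))"
    by (rule DERIV_mvt_exists[OF assms(1)])
  moreover have "\<bar>y - x\<bar> * \<bar>f' (x + t * (y - x))\<bar> \<le> \<bar>y - x\<bar> * C"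
    by (intro mult_left_mono assms) auto
  ultimately show ?thesis
    by (simp add: abs_mult mult.commute)
qed

text \<open>Peano's form of the symmetry of mixed derivatives: \<open>f\<^sub>x\<close> is not assumed to be
  differentiable in \<open>y\<close>.\<close>

lemma mixed_derivative_symmetric:
  fixes f fx fy g :: "real \<Rightarrow> real \<Rightarrow> real"
  assumes fx: "\<And>x y. ((\<lambda>z. f z y) has_real_derivative fx x y) (at x)"
    and fy: "\<And>x y. ((\<lambda>w. f x w) has_real_derivative fy x y) (at y)"
    and fyx: "\<And>x y. ((\<lambda>z. fy z y) has_real_derivative g x y) (at x)"
    and cont: "isCont (\<lambda>(x, y). g x y) (a, b)"
  shows "((\<lambda>w. fx a w) has_real_derivative g a b) (at b)"
  unfolding DERIV_def LIM_eq
proof (intro allI impI)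
  fix e :: real assume "0 < e"
  then obtain d where d: "d > 0"
    "\<And>p. dist p (a, b) < d \<Longrightarrow> dist (case p of (x, y) \<Rightarrow> g x y) (g a b) < e / 2"
    using cont[unfolded continuous_at_eps_delta, rule_format, of "e/2"] by auto
  have dd: "\<bar>g x y - g a b\<bar> < e / 2" if "\<bar>x - a\<bar> < d / 2" "\<bar>y - b\<bar> < d / 2" for x y
  proof -
    have "dist (x, y) (a, b) \<le> \<bar>x - a\<bar> + \<bar>y - b\<bar>"
      using sqrt_sum_squares_le_sum_abs[of "x - a" "y - b"]
      by (auto simp: dist_prod_def dist_real_def)
    also have "\<dots> < d" using that by simp
    finally show ?thesis using d(2)[of "(x, y)"] by (simp add: dist_real_def)
  qed
  have main: "norm ((fx a (b + h) - fx a b) / h - g a b) < e" if "h \<noteq> 0" "\<bar>h\<bar> < d / 2" for h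
  proof -
    \<comment> \<open>The second difference quotient with increments \<open>k\<close> in
      \<open>x\<close> and \<open>h\<close> in \<open>y\<close>, less its expected limit. For fixed
      \<open>h\<close> it tends, as \<open>k -> 0\<close>, to the error of the difference quotient
      of \<open>fx\<close>; for fixed \<open>k\<close> the mean value theorem in \<open>y\<close>
      and then in \<open>x\<close> turns the quotient into a value of \<open>g\<close> near
      \<open>(a, b)\<close>. The margin \<open>e / 2\<close> absorbs the loss of strictness in the
      limit.\<close>
    let ?q = "\<lambda>k. ((f (a + k) (b + h) - f a (b + h)) / k - (f (a + k) b - f a b) / k) / h - g a b"
    have lim: "(?q \<longlongrightarrow> (fx a (b + h) - fx a b) / h - g a b) (at 0)"
      using fx[of "b + h" a] fx[of b a] unfolding DERIV_def
      by (intro tendsto_intros) (use that in auto)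
    have "\<forall>\<^sub>F k in at 0. \<bar>k\<bar> < d / 2 \<and> k \<noteq> (0::real)"
      unfolding eventually_at using d(1) by (intro exI[of _ "d/2"]) (auto simp: dist_real_def)
    then have ev: "\<forall>\<^sub>F k in at 0. \<bar>?q k\<bar> \<le> e / 2"
    proof eventually_elim
      case (elim k)
      have D1: "((\<lambda>w. f (a + k) w - f a w) has_real_derivative fy (a + k) y - fy a y) (at y)" for y
        by (intro DERIV_diff fy)
      obtain t where t: "0 \<le> t" "t \<le> 1"
        "(f (a + k) (b + h) - f a (b + h)) - (f (a + k) b - f a b)
          = h * (fy (a + k) (b + t * h) - fy a (b + t * h))"
        by (rule DERIV_mvt_exists[OF D1, of b h])
      obtain u where u: "0 \<le> u" "u \<le> 1"
        "fy (a + k) (b + t * h) - fy a (b + t * h) = k * g (a + u * k) (b + t * h)"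
        by (rule DERIV_mvt_exists[OF fyx, where a = a and h = k])
      have "?q k = ((f (a + k) (b + h) - f a (b + h)) - (f (a + k) b - f a b)) / (h * k) - g a b"
        using elim that by (simp add: field_simps)
      also have "\<dots> = g (a + u * k) (b + t * h) - g a b"
        unfolding t(3) u(3) using elim that by simp
      finally have eq: "?q k = g (a + u * k) (b + t * h) - g a b" .
      have "\<bar>u * k\<bar> \<le> \<bar>k\<bar>" "\<bar>t * h\<bar> \<le> \<bar>h\<bar>"
        using t u by (auto simp: abs_mult intro!: mult_left_le_one_le)
      then have "\<bar>g (a + u * k) (b + t * h) - g a b\<bar> < e / 2"
        using elim that by (intro dd) auto
      with eq show ?case by simp
    qed
    have "\<bar>(fx a (b + h) - fx a b) / h - g a b\<bar> \<le> e / 2"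
      by (rule tendsto_upperbound[OF tendsto_rabs[OF lim] ev]) simp
    with \<open>0 < e\<close> show ?thesis by simp
  qed
  show "\<exists>s>0. \<forall>x. x \<noteq> 0 \<and> norm (x - 0) < s \<longrightarrow> norm ((fx a (b + x) - fx a b) / x - g a b) < e"
    using d(1) main by (intro exI[of _ "d/2"]) simp
qed

lemma tendsto_shift:
  fixes x :: real
  assumes "h \<longlonglongrightarrow> 0" "\<And>n. 0 \<le> t n" "\<And>n. t n \<le> (1::real)"
  shows "(\<lambda>n. x + t n * h n) \<longlonglongrightarrow> x"
proof -
  have "(\<lambda>n. t n * h n) \<longlonglongrightarrow> 0"
  proof (rule Lim_null_comparison)
    have "norm (t n * h n) \<le> 1 * \<bar>h n\<bar>" for n
      unfolding real_norm_def abs_mult using assms(2,3)[of n] by (intro mult_right_mono) auto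
    then show "\<forall>\<^sub>F n in sequentially. norm (t n * h n) \<le> \<bar>h n\<bar>" by simp
    show "(\<lambda>n. \<bar>h n\<bar>) \<longlonglongrightarrow> 0" using assms(1) by (rule tendsto_rabs_zero)
  qed
  then show ?thesis using tendsto_add[OF tendsto_const[of x]] by fastforce
qed

section \<open>Square integrable random variables and the Wasserstein distance\<close>

text \<open>The joint law of \<open>(X, Y)\<close> is one admissible coupling. Every estimate of
  \<open>W2\<close> in the proof goes through this bound; the infimum is never computed.\<close>

lemma (in prob_space) W2_distr_le:
  assumes [measurable]: "X \<in> borel_measurable M" "Y \<in> borel_measurable M"
  shows "W2 (distr M borel X) (distr M borel Y) \<le> sqrt (\<integral>\<omega>. (X \<omega> - Y \<omega>)\<^sup>2 \<partial>M)"
proof -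
  let ?\<pi> = "distr M (borel :: (real \<times> real) measure) (\<lambda>\<omega>. (X \<omega>, Y \<omega>))"
  have "?\<pi> \<in> couplings (distr M borel X) (distr M borel Y)"
    unfolding couplings_def
    by (auto simp: distr_distr comp_def borel_prod[symmetric] intro!: prob_space_distr)
  moreover have "bdd_below ((\<lambda>\<pi>. \<integral>z. (fst z - snd z)\<^sup>2 \<partial>\<pi>) ` couplings (distr M borel X) (distr M borel Y))"
    by (rule bdd_belowI[of _ 0]) auto
  ultimately have "(INF \<pi> \<in> couplings (distr M borel X) (distr M borel Y). \<integral>z. (fst z - snd z)\<^sup>2 \<partial>\<pi>)
      \<le> (\<integral>z. (fst z - snd z)\<^sup>2 \<partial>?\<pi>)"
    by (intro cINF_lower) auto
  also have "\<dots> = (\<integral>\<omega>. (X \<omega> - Y \<omega>)\<^sup>2 \<partial>M)"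
    by (subst integral_distr) (auto simp: borel_prod[symmetric])
  finally show ?thesis by (simp add: W2_def)
qed

lemma (in prob_space) distr_in_P2:
  assumes [measurable]: "X \<in> borel_measurable M" and "integrable M (\<lambda>\<omega>. (X \<omega>)\<^sup>2)"
  shows "distr M borel X \<in> P2"
  using assms(2) by (auto simp: P2_def integrable_distr_eq)

text \<open>Diagonal coupling. It is what allows joint continuity to be used with a frozen measure,
  since the definition asks for a small \<open>W2\<close> even when the measure does not
  move.\<close>

lemma W2_refl_le:
  assumes "\<mu> \<in> P2" shows "W2 \<mu> \<mu> \<le> 0"
proof -
  interpret real_distribution \<mu> using assms by (simp add: P2_def)
  have "W2 (distr \<mu> borel (\<lambda>x. x)) (distr \<mu> borel (\<lambda>x. x)) \<le> sqrt (\<integral>\<omega>. (\<omega> - \<omega>)\<^sup>2 \<partial>\<mu>)"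
    by (rule W2_distr_le) auto
  moreover have "distr \<mu> borel (\<lambda>x. x) = \<mu>"
    by (rule distr_id2) simp
  ultimately show ?thesis by simp
qed

text \<open>A majorant \<open>w\<close> of the distances suits the bounds by couplings, which do not
  give \<open>W2\<close> itself.\<close>

lemma continuous_P2_tendsto:
  assumes f: "continuous_P2 f" "\<mu> \<in> P2" and \<nu>: "\<And>n. \<nu> n \<in> P2"
    and "q \<longlonglongrightarrow> p" and W: "\<And>n. W2 (\<nu> n) \<mu> \<le> w n" "w \<longlonglongrightarrow> 0"
  shows "(\<lambda>n. f (q n) (\<nu> n)) \<longlonglongrightarrow> f p \<mu>"
proof (rule tendstoI)
  fix e :: real assume "e > 0"
  with f have "\<exists>d>0. \<forall>q. \<forall>\<nu>\<in>P2. dist q p < d \<and> W2 \<nu> \<mu> < d \<longrightarrow> \<bar>f q \<nu> - f p \<mu>\<bar> < e"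
    unfolding continuous_P2_def by blast
  then obtain d where d: "d > 0"
    "\<forall>q. \<forall>\<nu>\<in>P2. dist q p < d \<and> W2 \<nu> \<mu> < d \<longrightarrow> \<bar>f q \<nu> - f p \<mu>\<bar> < e"
    by blast
  have "\<forall>\<^sub>F n in sequentially. dist (q n) p < d"
    using assms(4) d(1) by (rule tendstoD)
  moreover have "\<forall>\<^sub>F n in sequentially. w n < d"
    using W(2) d(1) by (rule order_tendstoD)
  ultimately show "\<forall>\<^sub>F n in sequentially. dist (f (q n) (\<nu> n)) (f p \<mu>) < e"
  proof eventually_elim
    case (elim n)
    then have "W2 (\<nu> n) \<mu> < d" using W(1)[of n] by simp
    with elim d(2) \<nu> show ?case by (simp add: dist_real_def)
  qed
qed

lemma continuous_P2_isCont:
  assumes "continuous_P2 f" "\<mu> \<in> P2"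
  shows "isCont (\<lambda>p. f p \<mu>) p"
  unfolding continuous_at_sequentially comp_def
proof (intro allI impI)
  fix q assume "q \<longlonglongrightarrow> p"
  then show "(\<lambda>n. f (q n) \<mu>) \<longlonglongrightarrow> f p \<mu>"
    by (rule continuous_P2_tendsto[where w = "\<lambda>_. 0", OF assms assms(2)])
      (auto intro: W2_refl_le assms)
qed

lemma continuous_P2_measurable:
  fixes f :: "'p :: metric_space \<Rightarrow> real measure \<Rightarrow> real"
  assumes "continuous_P2 f" "\<mu> \<in> P2"
  shows "(\<lambda>p. f p \<mu>) \<in> borel_measurable borel"
  by (intro borel_measurable_continuous_onI continuous_at_imp_continuous_on ballI
      continuous_P2_isCont assms)

lemma (in prob_space) integrable_of_square:
  fixes X :: "'a \<Rightarrow> real"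
  assumes [measurable]: "X \<in> borel_measurable M" and "integrable M (\<lambda>\<omega>. (X \<omega>)\<^sup>2)"
  shows "integrable M X"
  using square_integrable_imp_integrable[OF assms] .

lemma (in prob_space) integrable_square_bounded:
  fixes X :: "'a \<Rightarrow> real"
  assumes [measurable]: "X \<in> borel_measurable M" and b: "\<And>\<omega>. \<bar>X \<omega>\<bar> \<le> C"
  shows "integrable M (\<lambda>\<omega>. (X \<omega>)\<^sup>2)"
proof (rule integrable_const_bound[where B = "C\<^sup>2"])
  show "AE \<omega> in M. norm ((X \<omega>)\<^sup>2) \<le> C\<^sup>2"
    using power_mono[OF b, of _ 2] by simp
qed simp

lemma (in prob_space) expectation_abs_le_sqrt:
  fixes f :: "'a \<Rightarrow> real"
  assumes [measurable]: "f \<in> borel_measurable M" and f2: "integrable M (\<lambda>\<omega>. (f \<omega>)\<^sup>2)"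
  shows "(\<integral>\<omega>. \<bar>f \<omega>\<bar> \<partial>M) \<le> sqrt (\<integral>\<omega>. (f \<omega>)\<^sup>2 \<partial>M)"
proof -
  have i: "integrable M (\<lambda>\<omega>. \<bar>f \<omega>\<bar>)" using integrable_of_square[OF assms] by simp
  have "0 \<le> variance (\<lambda>\<omega>. \<bar>f \<omega>\<bar>)" by simp
  also have "\<dots> = (\<integral>\<omega>. (f \<omega>)\<^sup>2 \<partial>M) - (\<integral>\<omega>. \<bar>f \<omega>\<bar> \<partial>M)\<^sup>2"
    using i f2 by (subst variance_eq) auto
  finally show ?thesis by (intro real_le_rsqrt) simp
qed

lemma abs_integral_le:
  fixes f g :: "'b \<Rightarrow> real"
  assumes "integrable M f" "integrable M g" "\<And>x. x \<in> space M \<Longrightarrow> \<bar>f x\<bar> \<le> g x"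
  shows "\<bar>\<integral>x. f x \<partial>M\<bar> \<le> (\<integral>x. g x \<partial>M)"
  by (rule order_trans[OF integral_abs_bound integral_mono]) (use assms in auto)

section \<open>Quadratic forms of a kernel\<close>

text \<open>The two coordinates of the product measure play the independent copies. The measure is a
  parameter because the form is moved to spaces enlarged by a coin and to image measures; its value
  depends only on the joint law of \<open>(X, Y)\<close>.\<close>

definition quad :: "'b measure \<Rightarrow> (real \<times> real \<Rightarrow> real) \<Rightarrow> ('b \<Rightarrow> real) \<Rightarrow> ('b \<Rightarrow> real) \<Rightarrow> real" where
  "quad N k X Y = (\<integral>p. k (X (fst p), X (snd p)) * Y (fst p) * Y (snd p) \<partial>(N \<Otimes>\<^sub>M N))"

section \<open>Integrals over two independent copies, and spaces enlarged by a coin\<close>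

context prob_space begin

lemma pair_prob_space_self: "pair_prob_space M M"
  by unfold_locales

lemma
  fixes Y Z :: "'a \<Rightarrow> real"
  assumes Y: "integrable M Y" and Z: "integrable M Z"
  shows integrable_pair_mult: "integrable (M \<Otimes>\<^sub>M M) (\<lambda>p. Y (fst p) * Z (snd p))"
    and integral_pair_mult:
      "(\<integral>p. Y (fst p) * Z (snd p) \<partial>(M \<Otimes>\<^sub>M M)) = (\<integral>\<omega>. Y \<omega> \<partial>M) * (\<integral>\<omega>. Z \<omega> \<partial>M)"
proof -
  interpret P: pair_prob_space M M by (rule pair_prob_space_self)
  note [measurable] = borel_measurable_integrable[OF Y] borel_measurable_integrable[OF Z]
  have "integrable (M \<Otimes>\<^sub>M M) (\<lambda>(x, y). Y x * Z y)"
    by (rule P.Fubini_integrable) (use Y Z in \<open>auto simp: abs_mult\<close>)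
  then show i: "integrable (M \<Otimes>\<^sub>M M) (\<lambda>p. Y (fst p) * Z (snd p))"
    by (simp add: case_prod_beta')
  show "(\<integral>p. Y (fst p) * Z (snd p) \<partial>(M \<Otimes>\<^sub>M M)) = (\<integral>\<omega>. Y \<omega> \<partial>M) * (\<integral>\<omega>. Z \<omega> \<partial>M)"
    using P.integral_fst'[OF i] by simp
qed

text \<open>A bounded kernel is dominated by \<open>C\<close> times a product of functions of
  separate coordinates, and over independent coordinates such a product is integrable as soon as
  both factors are.\<close>

lemma integrable_pair_kernel:
  fixes Y Z :: "'a \<Rightarrow> real"
  assumes Y: "integrable M Y" and Z: "integrable M Z"
    and k: "k \<in> borel_measurable (M \<Otimes>\<^sub>M M)"
      "\<And>p. p \<in> space (M \<Otimes>\<^sub>M M) \<Longrightarrow> \<bar>k p\<bar> \<le> C"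
  shows "integrable (M \<Otimes>\<^sub>M M) (\<lambda>p. k p * Y (fst p) * Z (snd p))"
proof (rule Bochner_Integration.integrable_bound)
  note [measurable] = k(1) borel_measurable_integrable[OF Y] borel_measurable_integrable[OF Z]
  show "integrable (M \<Otimes>\<^sub>M M) (\<lambda>p. C * (Y (fst p) * Z (snd p)))"
    by (intro integrable_mult_right integrable_pair_mult Y Z)
  show "(\<lambda>p. k p * Y (fst p) * Z (snd p)) \<in> borel_measurable (M \<Otimes>\<^sub>M M)"
    by measurable
  show "AE p in M \<Otimes>\<^sub>M M. norm (k p * Y (fst p) * Z (snd p)) \<le> norm (C * (Y (fst p) * Z (snd p)))"
  proof (rule AE_I2)
    fix p assume p: "p \<in> space (M \<Otimes>\<^sub>M M)"
    have "\<bar>k p\<bar> * (\<bar>Y (fst p)\<bar> * \<bar>Z (snd p)\<bar>) \<le> \<bar>C\<bar> * (\<bar>Y (fst p)\<bar> * \<bar>Z (snd p)\<bar>)"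
      using k(2)[OF p] by (intro mult_right_mono) auto
    then show "norm (k p * Y (fst p) * Z (snd p)) \<le> norm (C * (Y (fst p) * Z (snd p)))"
      by (simp add: abs_mult mult.assoc)
  qed
qed

lemma integral_pair_kernel_tendsto:
  fixes Y Z :: "nat \<Rightarrow> 'a \<Rightarrow> real" and k :: "nat \<Rightarrow> 'a \<times> 'a \<Rightarrow> real"
  assumes k: "\<And>n. k n \<in> borel_measurable (M \<Otimes>\<^sub>M M)" "k' \<in> borel_measurable (M \<Otimes>\<^sub>M M)"
      "\<And>n p. p \<in> space (M \<Otimes>\<^sub>M M) \<Longrightarrow> \<bar>k n p\<bar> \<le> C"
      "\<And>p. p \<in> space (M \<Otimes>\<^sub>M M) \<Longrightarrow> (\<lambda>n. k n p) \<longlonglongrightarrow> k' p"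
    and Y: "\<And>n. Y n \<in> borel_measurable M" "Y' \<in> borel_measurable M"
      "\<And>n \<omega>. \<omega> \<in> space M \<Longrightarrow> \<bar>Y n \<omega>\<bar> \<le> G \<omega>" "integrable M G"
      "\<And>\<omega>. \<omega> \<in> space M \<Longrightarrow> (\<lambda>n. Y n \<omega>) \<longlonglongrightarrow> Y' \<omega>"
    and Z: "\<And>n. Z n \<in> borel_measurable M" "Z' \<in> borel_measurable M"
      "\<And>n \<omega>. \<omega> \<in> space M \<Longrightarrow> \<bar>Z n \<omega>\<bar> \<le> H \<omega>" "integrable M H"
      "\<And>\<omega>. \<omega> \<in> space M \<Longrightarrow> (\<lambda>n. Z n \<omega>) \<longlonglongrightarrow> Z' \<omega>"
  shows "(\<lambda>n. \<integral>p. k n p * Y n (fst p) * Z n (snd p) \<partial>(M \<Otimes>\<^sub>M M))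
    \<longlonglongrightarrow> (\<integral>p. k' p * Y' (fst p) * Z' (snd p) \<partial>(M \<Otimes>\<^sub>M M))"
proof (rule integral_dominated_convergence)
  note [measurable] = k(1,2) Y(1,2) Z(1,2)
  show "(\<lambda>p. k' p * Y' (fst p) * Z' (snd p)) \<in> borel_measurable (M \<Otimes>\<^sub>M M)"
    "\<And>n. (\<lambda>p. k n p * Y n (fst p) * Z n (snd p)) \<in> borel_measurable (M \<Otimes>\<^sub>M M)"
    by measurable
  show "integrable (M \<Otimes>\<^sub>M M) (\<lambda>p. C * (G (fst p) * H (snd p)))"
    by (intro integrable_mult_right integrable_pair_mult Y Z)
  show "AE p in M \<Otimes>\<^sub>M M. (\<lambda>n. k n p * Y n (fst p) * Z n (snd p)) \<longlonglongrightarrow> k' p * Y' (fst p) * Z' (snd p)"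
    by (intro AE_I2 tendsto_mult k Y Z) (auto simp: space_pair_measure)
  show "AE p in M \<Otimes>\<^sub>M M. norm (k n p * Y n (fst p) * Z n (snd p)) \<le> C * (G (fst p) * H (snd p))" for n
  proof (rule AE_I2)
    fix p assume p: "p \<in> space (M \<Otimes>\<^sub>M M)"
    then have s: "fst p \<in> space M" "snd p \<in> space M" by (auto simp: space_pair_measure)
    have "\<bar>k n p\<bar> * (\<bar>Y n (fst p)\<bar> * \<bar>Z n (snd p)\<bar>) \<le> C * (G (fst p) * H (snd p))"
      using k(3)[OF p, of n] Y(3)[OF s(1), of n] Z(3)[OF s(2), of n]
      by (intro mult_mono mult_nonneg_nonneg) (auto intro: order_trans[OF abs_ge_zero])
    then show "norm (k n p * Y n (fst p) * Z n (snd p)) \<le> C * (G (fst p) * H (snd p))"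
      by (simp add: abs_mult mult.assoc)
  qed
qed

text \<open>When both variables are functions of one random variable \<open>c\<close>, the form sees
  only the law of \<open>c\<close>; two spaces on which \<open>c\<close> has the same law give the
  same value.\<close>

lemma quad_comp:
  assumes c [measurable]: "c \<in> borel_measurable M"
    and [measurable]: "f \<in> borel_measurable borel" "g \<in> borel_measurable borel"
      "k \<in> borel_measurable borel"
  shows "quad M k (\<lambda>\<omega>. f (c \<omega>)) (\<lambda>\<omega>. g (c \<omega>)) = quad (distr M borel c) k f g"
proof -
  interpret D: prob_space "distr M borel c" by (rule prob_space_distr) fact
  have [measurable]: "k \<in> borel_measurable (borel \<Otimes>\<^sub>M borel)"
    using assms(4) by (simp add: borel_prod)
  have "distr M borel c \<Otimes>\<^sub>M distr M borel c
      = distr (M \<Otimes>\<^sub>M M) (borel \<Otimes>\<^sub>M borel) (\<lambda>(x, y). (c x, c y))"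
    by (intro pair_measure_distr c D.sigma_finite_measure_axioms)
  moreover have "(\<integral>p. k (f (fst p), f (snd p)) * g (fst p) * g (snd p)
        \<partial>distr (M \<Otimes>\<^sub>M M) (borel \<Otimes>\<^sub>M borel) (\<lambda>(x, y). (c x, c y)))
      = (\<integral>p. k (f (c (fst p)), f (c (snd p))) * g (c (fst p)) * g (c (snd p)) \<partial>(M \<Otimes>\<^sub>M M))"
    by (subst integral_distr) (measurable, simp add: case_prod_beta')
  ultimately show ?thesis
    unfolding quad_def by simp
qed

text \<open>For \<open>s\<close> in the unit interval this adjoins to \<open>M\<close> a toss that
  is independent of everything on \<open>M\<close> and shows \<open>True\<close> with probability
  \<open>s\<close>.\<close>

abbreviation coin :: "real \<Rightarrow> ('a \<times> bool) measure" where
  "coin s \<equiv> M \<Otimes>\<^sub>M measure_pmf (bernoulli_pmf s)"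

lemma pair_prob_space_coin: "pair_prob_space M (measure_pmf (bernoulli_pmf s))"
  unfolding pair_prob_space_def pair_sigma_finite_def
  by (simp add: prob_space_axioms sigma_finite_measure_axioms measure_pmf.prob_space_axioms
    measure_pmf.sigma_finite_measure_axioms)

lemma prob_space_coin: "prob_space (coin s)"
  by (intro prob_space_pair prob_space_axioms measure_pmf.prob_space_axioms)

lemma measurable_coin:
  fixes f :: "'a \<times> bool \<Rightarrow> 'c"
  assumes [measurable]: "(\<lambda>\<omega>. f (\<omega>, True)) \<in> measurable M L" "(\<lambda>\<omega>. f (\<omega>, False)) \<in> measurable M L"
  shows "f \<in> measurable (coin s) L"
proof -
  have "(\<lambda>p. if snd p then f (fst p, True) else f (fst p, False)) \<in> measurable (coin s) L"
    by measurable
  moreover have "(\<lambda>p. if snd p then f (fst p, True) else f (fst p, False)) = f"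
    by (auto simp: fun_eq_iff)
  ultimately show ?thesis by simp
qed

lemma
  fixes f :: "'a \<times> bool \<Rightarrow> real"
  assumes s: "0 \<le> s" "s \<le> 1"
    and f: "integrable M (\<lambda>\<omega>. f (\<omega>, True))" "integrable M (\<lambda>\<omega>. f (\<omega>, False))"
  shows integrable_coin: "integrable (coin s) f"
    and integral_coin: "(\<integral>p. f p \<partial>coin s)
      = s * (\<integral>\<omega>. f (\<omega>, True) \<partial>M) + (1 - s) * (\<integral>\<omega>. f (\<omega>, False) \<partial>M)"
proof -
  interpret P: pair_prob_space M "measure_pmf (bernoulli_pmf s)" by (rule pair_prob_space_coin)
  have fin: "integrable (measure_pmf (bernoulli_pmf s)) g" for g :: "bool \<Rightarrow> real"
    by (rule integrable_measure_pmf_finite) simp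
  have *: "f \<in> borel_measurable (coin s)"
    by (intro measurable_coin borel_measurable_integrable f)
  show i: "integrable (coin s) f"
    by (rule P.Fubini_integrable) (use * fin f s in auto)
  show "(\<integral>p. f p \<partial>coin s) = s * (\<integral>\<omega>. f (\<omega>, True) \<partial>M) + (1 - s) * (\<integral>\<omega>. f (\<omega>, False) \<partial>M)"
    using P.integral_fst'[OF i] s f by (simp add: mult.commute)
qed

end

section \<open>Functionals of class \<open>C\<^sup>1\<^sup>,\<^sup>4\<close>\<close>

locale smooth_functional = rich_brownian_space M F B T
  for M :: "'a measure" and F :: "real \<Rightarrow> 'a measure" and B :: "real \<Rightarrow> 'a \<Rightarrow> real" and T :: real +
  fixes U :: "real \<Rightarrow> real measure \<Rightarrow> real"
  assumes U_C14b: "U \<in> C14b M (F T)"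
begin

abbreviation "L2T \<equiv> L2 M (F T)"
abbreviation "V \<equiv> D\<mu> M (F T) U"

lemmas C14b_conj = U_C14b[unfolded C14b_def mem_Collect_eq]

lemmas C14bD =
  C14b_conj[THEN conjunct1]
  C14b_conj[THEN conjunct2, THEN conjunct1]
  C14b_conj[THEN conjunct2, THEN conjunct2, THEN conjunct1]
  C14b_conj[THEN conjunct2, THEN conjunct2, THEN conjunct2, THEN conjunct1]
  C14b_conj[THEN conjunct2, THEN conjunct2, THEN conjunct2, THEN conjunct2, THEN conjunct1]
  C14b_conj[THEN conjunct2, THEN conjunct2, THEN conjunct2, THEN conjunct2, THEN conjunct2, THEN conjunct1]
  C14b_conj[THEN conjunct2, THEN conjunct2, THEN conjunct2, THEN conjunct2, THEN conjunct2, THEN conjunct2, THEN conjunct1]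
  C14b_conj[THEN conjunct2, THEN conjunct2, THEN conjunct2, THEN conjunct2, THEN conjunct2, THEN conjunct2, THEN conjunct2, THEN conjunct1]
  C14b_conj[THEN conjunct2, THEN conjunct2, THEN conjunct2, THEN conjunct2, THEN conjunct2, THEN conjunct2, THEN conjunct2, THEN conjunct2]

lemma subalgebra_FT: "subalgebra M (F T)"
  using T_pos by (intro subalgebra_F) simp

lemma measurable_F0_FT: "X \<in> borel_measurable (F 0) \<Longrightarrow> X \<in> borel_measurable (F T)"
proof -
  have "sets (F 0) \<subseteq> sets (F T)"
    using sets_F[of T] T_pos by auto
  moreover have "space (F 0) = space (F T)"
    using subalgebra_F[of 0] subalgebra_F[of T] T_pos by (auto simp: subalgebra_def)
  ultimately have "subalgebra (F T) (F 0)" by (auto simp: subalgebra_def)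
  then show "X \<in> borel_measurable (F 0) \<Longrightarrow> X \<in> borel_measurable (F T)"
    by (rule measurable_from_subalg)
qed

lemma L2T_measurable [measurable_dest]: "\<xi> \<in> L2T \<Longrightarrow> \<xi> \<in> borel_measurable M"
  using measurable_from_subalg[OF subalgebra_FT] by (auto simp: L2_def)

lemma L2T_integrable_square: "\<xi> \<in> L2T \<Longrightarrow> integrable M (\<lambda>\<omega>. (\<xi> \<omega>)\<^sup>2)"
  by (auto simp: L2_def)

lemma L2T_integrable: "\<xi> \<in> L2T \<Longrightarrow> integrable M \<xi>"
  by (rule integrable_of_square[OF L2T_measurable L2T_integrable_square])

lemma law_in_P2: "\<xi> \<in> L2T \<Longrightarrow> law M \<xi> \<in> P2"
  unfolding law_def by (intro distr_in_P2 L2T_measurable L2T_integrable_square)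

lemma L2T_scale: "\<xi> \<in> L2T \<Longrightarrow> (\<lambda>\<omega>. c * \<xi> \<omega>) \<in> L2T"
  by (auto simp: L2_def power_mult_distrib)

lemma L2T_add:
  assumes "\<xi> \<in> L2T" "\<eta> \<in> L2T" shows "(\<lambda>\<omega>. \<xi> \<omega> + \<eta> \<omega>) \<in> L2T"
proof -
  have "integrable M (\<lambda>\<omega>. (\<xi> \<omega> + \<eta> \<omega>)\<^sup>2)"
  proof (rule Bochner_Integration.integrable_bound)
    show "integrable M (\<lambda>\<omega>. 2 * (\<xi> \<omega>)\<^sup>2 + 2 * (\<eta> \<omega>)\<^sup>2)"
      using assms by (auto simp: L2_def)
    show "(\<lambda>\<omega>. (\<xi> \<omega> + \<eta> \<omega>)\<^sup>2) \<in> borel_measurable M"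
      using assms[THEN L2T_measurable] by measurable
    have "(x + y)\<^sup>2 \<le> 2 * x\<^sup>2 + 2 * y\<^sup>2" for x y :: real
      using zero_le_power2[of "x - y"] by (simp add: power2_eq_square algebra_simps)
    then show "AE \<omega> in M. norm ((\<xi> \<omega> + \<eta> \<omega>)\<^sup>2) \<le> norm (2 * (\<xi> \<omega>)\<^sup>2 + 2 * (\<eta> \<omega>)\<^sup>2)"
      by auto
  qed
  with assms show ?thesis by (auto simp: L2_def)
qed

lemma L2T_line: "\<xi> \<in> L2T \<Longrightarrow> \<eta> \<in> L2T \<Longrightarrow> (\<lambda>\<omega>. \<xi> \<omega> + s * \<eta> \<omega>) \<in> L2T"
  by (intro L2T_add L2T_scale)

text \<open>\<open>lions_deriv\<close> selects by \<open>SOME\<close>. The existence clause of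
  \<open>C14b\<close> makes the selected version a genuine Lions derivative, and the regularity
  clauses speak of that same version.\<close>

lemma V_lions: "is_lions_derivative M (F T) (U x) (V x)"
  unfolding D\<mu>_def lions_deriv_def
  by (rule someI_ex[where P = "is_lions_derivative M (F T) (U x)"])
    (rule C14bD(4)[rule_format])

lemma U_deriv:
  "\<mu> \<in> P2 \<Longrightarrow> k < 4 \<Longrightarrow> ((\<lambda>z. Dx k U z \<mu>) has_real_derivative Dx (Suc k) U x \<mu>) (at x)"
  by (rule Dx_exists_DERIV[OF C14bD(1)[rule_format]])

lemma V_deriv:
  "\<mu> \<in> P2 \<Longrightarrow> k < 3 \<Longrightarrow> ((\<lambda>z. Dx k V z (\<mu>, y)) has_real_derivative Dx (Suc k) V x (\<mu>, y)) (at x)"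
  by (rule Dx_exists_DERIV[OF C14bD(5)[rule_format]])

lemma DyV_deriv:
  "\<mu> \<in> P2 \<Longrightarrow> k < 2 \<Longrightarrow>
    ((\<lambda>z. Dx k (Dy V) z (\<mu>, y)) has_real_derivative Dx (Suc k) (Dy V) x (\<mu>, y)) (at x)"
  by (rule Dx_exists_DERIV[OF C14bD(8)[rule_format]])

lemma U_continuous: "k \<le> 4 \<Longrightarrow> continuous_P2 (Dx k U)"
  and V_continuous: "k \<le> 3 \<Longrightarrow> continuous_P2 (\<lambda>(x, y) \<mu>. Dx k V x (\<mu>, y))"
  and DyV_continuous: "k \<le> 2 \<Longrightarrow> continuous_P2 (\<lambda>(x, y) \<mu>. Dx k (Dy V) x (\<mu>, y))"
  by (rule C14bD(2)[rule_format] C14bD(6,9)[rule_format, THEN conjunct1]; assumption)+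

lemma DyV_has_deriv:
  assumes "\<mu> \<in> P2"
  shows "((\<lambda>w. Dx 0 V x (\<mu>, w)) has_real_derivative Dx 0 (Dy V) x (\<mu>, y)) (at y)"
  using C14bD(7) assms by (simp add: Dy_def DERIV_deriv_iff_real_differentiable)

text \<open>The class provides a separate bound for each derivative. One constant for the whole
  locale lets the error terms of different lemmas be compared.\<close>

definition bound_const :: real where
  "bound_const = (SOME C. \<forall>\<mu>\<in>P2. \<forall>x y. \<bar>Dx 1 U x \<mu>\<bar> \<le> C \<and>
    (\<forall>k\<le>2. \<bar>Dx k V x (\<mu>, y)\<bar> \<le> C \<and> \<bar>Dx k (Dy V) x (\<mu>, y)\<bar> \<le> C))"

lemma bounded:
  assumes "\<mu> \<in> P2"
  shows "\<bar>Dx 1 U x \<mu>\<bar> \<le> bound_const"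
    and "k \<le> 2 \<Longrightarrow> \<bar>Dx k V x (\<mu>, y)\<bar> \<le> bound_const"
    and "k \<le> 2 \<Longrightarrow> \<bar>Dx k (Dy V) x (\<mu>, y)\<bar> \<le> bound_const"
proof -
  have "\<exists>C. \<forall>\<mu>\<in>P2. \<forall>x y. \<bar>Dx 1 U x \<mu>\<bar> \<le> C \<and>
    (\<forall>k\<le>2. \<bar>Dx k V x (\<mu>, y)\<bar> \<le> C \<and> \<bar>Dx k (Dy V) x (\<mu>, y)\<bar> \<le> C)"
  proof -
    obtain C0 where C0: "\<And>x \<mu>. \<mu> \<in> P2 \<Longrightarrow> \<bar>Dx 1 U x \<mu>\<bar> \<le> C0"
      using C14bD(3) unfolding bounded_P2_def by (metis atLeastAtMost_iff le_refl one_le_numeral)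
    have "\<exists>C. \<forall>x y. \<forall>\<mu>\<in>P2. \<bar>Dx k V x (\<mu>, y)\<bar> \<le> C" if "k \<le> 3" for k
      using C14bD(6) that by (simp add: bounded_P2_def split_paired_All)
    then obtain C1 where C1: "\<And>k x y \<mu>. k \<le> 3 \<Longrightarrow> \<mu> \<in> P2 \<Longrightarrow> \<bar>Dx k V x (\<mu>, y)\<bar> \<le> C1 k"
      by metis
    have "\<exists>C. \<forall>x y. \<forall>\<mu>\<in>P2. \<bar>Dx k (Dy V) x (\<mu>, y)\<bar> \<le> C" if "k \<le> 2" for k
      using C14bD(9) that by (simp add: bounded_P2_def split_paired_All)
    then obtain C2 where C2: "\<And>k x y \<mu>. k \<le> 2 \<Longrightarrow> \<mu> \<in> P2 \<Longrightarrow> \<bar>Dx k (Dy V) x (\<mu>, y)\<bar> \<le> C2 k"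
      by metis
    define C where "C = Max ({C0} \<union> C1 ` {..2} \<union> C2 ` {..2})"
    have C: "C0 \<le> C" "k \<le> 2 \<Longrightarrow> C1 k \<le> C" "k \<le> 2 \<Longrightarrow> C2 k \<le> C" for k
      unfolding C_def by (intro Max_ge; simp)+
    show ?thesis
    proof (intro exI[of _ C] ballI allI impI conjI)
      fix \<mu> x y and k :: nat assume \<mu>: "\<mu> \<in> P2"
      show "\<bar>Dx 1 U x \<mu>\<bar> \<le> C" using C0[OF \<mu>] C(1) by (rule order_trans)
      assume k: "k \<le> 2"
      then have "k \<le> 3" by simp
      from C1[OF this \<mu>] C(2)[OF k] show "\<bar>Dx k V x (\<mu>, y)\<bar> \<le> C" by (rule order_trans)
      from C2[OF k \<mu>] C(3)[OF k] show "\<bar>Dx k (Dy V) x (\<mu>, y)\<bar> \<le> C" by (rule order_trans)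
    qed
  qed
  then have *: "\<forall>\<mu>\<in>P2. \<forall>x y. \<bar>Dx 1 U x \<mu>\<bar> \<le> bound_const \<and>
    (\<forall>k\<le>2. \<bar>Dx k V x (\<mu>, y)\<bar> \<le> bound_const \<and> \<bar>Dx k (Dy V) x (\<mu>, y)\<bar> \<le> bound_const)"
    unfolding bound_const_def by (rule someI_ex)
  show "\<bar>Dx 1 U x \<mu>\<bar> \<le> bound_const"
    and "k \<le> 2 \<Longrightarrow> \<bar>Dx k V x (\<mu>, y)\<bar> \<le> bound_const"
    and "k \<le> 2 \<Longrightarrow> \<bar>Dx k (Dy V) x (\<mu>, y)\<bar> \<le> bound_const"
    using *[rule_format, OF assms] by simp_all
qed

lemma bound_const_nonneg: "0 \<le> bound_const"
proof -
  \<comment> \<open>The bound says something only if \<open>P2\<close> is inhabited; the law of a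
    constant is a witness.\<close>
  have "(\<lambda>_. 0) \<in> L2T" by (simp add: L2_def)
  from bounded(1)[OF law_in_P2[OF this], of 0] show ?thesis by linarith
qed

text \<open>The class controls \<open>Dx k (Dy V)\<close>, whereas the matrix contains
  \<open>Dy (Dx k V)\<close>, whose existence is part of the claim. Each induction step exchanges
  one more derivative in \<open>x\<close> with the one in \<open>y\<close>, by Peano's form of
  symmetry applied to \<open>Dx k V\<close>.\<close>

lemma Dy_Dx_V:
  assumes "\<mu> \<in> P2" "k \<le> 2"
  shows "((\<lambda>w. Dx k V x (\<mu>, w)) has_real_derivative Dx k (Dy V) x (\<mu>, y)) (at y)"
  using assms(2)
proof (induction k arbitrary: x y)
  case 0
  then show ?case using DyV_has_deriv assms by simp
next
  case (Suc k)
  show ?case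
  proof (rule mixed_derivative_symmetric[where f = "\<lambda>x y. Dx k V x (\<mu>, y)"
        and fy = "\<lambda>x y. Dx k (Dy V) x (\<mu>, y)" and fx = "\<lambda>x y. Dx (Suc k) V x (\<mu>, y)"])
    show "isCont (\<lambda>(x, y). Dx (Suc k) (Dy V) x (\<mu>, y)) (x, y)"
      using continuous_P2_isCont[OF DyV_continuous[OF Suc.prems] assms(1)]
      by (simp add: case_prod_beta')
    show "((\<lambda>z. Dx k V z (\<mu>, y)) has_real_derivative Dx (Suc k) V x (\<mu>, y)) (at x)" for x y
      using assms Suc.prems by (intro V_deriv) auto
    show "((\<lambda>w. Dx k V x (\<mu>, w)) has_real_derivative Dx k (Dy V) x (\<mu>, y)) (at y)" for x y
      using Suc.prems by (intro Suc.IH) auto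
    show "((\<lambda>z. Dx k (Dy V) z (\<mu>, y)) has_real_derivative Dx (Suc k) (Dy V) x (\<mu>, y)) (at x)" for x y
      using assms Suc.prems by (intro DyV_deriv) auto
  qed
qed

lemma Dy_Dx_V_eq:
  assumes "\<mu> \<in> P2" "k \<le> 2"
  shows "Dy (Dx k V) x (\<mu>, y) = Dx k (Dy V) x (\<mu>, y)"
proof -
  have "Dy (Dx k V) x (\<mu>, y) = deriv (\<lambda>w. Dx k V x (\<mu>, w)) y" by (simp add: Dy_def)
  then show ?thesis using DERIV_imp_deriv[OF Dy_Dx_V[OF assms]] by simp
qed

lemma U_lipschitz:
  assumes "\<mu> \<in> P2"
  shows "\<bar>U x \<mu> - U y \<mu>\<bar> \<le> bound_const * \<bar>x - y\<bar>"
proof (rule lipschitz_of_bounded_deriv)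
  show "((\<lambda>x. U x \<mu>) has_real_derivative Dx 1 U x \<mu>) (at x)" for x
    using U_deriv[OF assms, of 0 x] by simp
qed (rule bounded(1)[OF assms])

lemma U_measurable:
  assumes "\<mu> \<in> P2" shows "(\<lambda>x. U x \<mu>) \<in> borel_measurable borel"
  using continuous_P2_measurable[OF U_continuous[of 0] assms] by simp

lemma V_measurable:
  assumes "k \<le> 3" "\<mu> \<in> P2"
  shows "(\<lambda>p. Dx k V (fst p) (\<mu>, snd p)) \<in> borel_measurable borel"
  using continuous_P2_measurable[OF V_continuous[OF assms(1)] assms(2)] by (simp add: case_prod_beta')

lemma V_measurable_comp:
  assumes "k \<le> 3" "\<mu> \<in> P2" and [measurable]: "X \<in> borel_measurable N" "Y \<in> borel_measurable N"
  shows "(\<lambda>\<omega>. Dx k V (X \<omega>) (\<mu>, Y \<omega>)) \<in> borel_measurable N"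
proof -
  note [measurable] = V_measurable[OF assms(1,2)]
  have "(\<lambda>\<omega>. (\<lambda>p. Dx k V (fst p) (\<mu>, snd p)) (X \<omega>, Y \<omega>)) \<in> borel_measurable N"
    by measurable
  then show ?thesis by simp
qed

lemma DyV_measurable_comp:
  assumes "k \<le> 2" "\<mu> \<in> P2" and [measurable]: "X \<in> borel_measurable N" "Y \<in> borel_measurable N"
  shows "(\<lambda>\<omega>. Dx k (Dy V) (X \<omega>) (\<mu>, Y \<omega>)) \<in> borel_measurable N"
proof -
  have [measurable]: "(\<lambda>p. Dx k (Dy V) (fst p) (\<mu>, snd p)) \<in> borel_measurable borel"
    using continuous_P2_measurable[OF DyV_continuous[OF assms(1)] assms(2)] by (simp add: case_prod_beta')
  have "(\<lambda>\<omega>. (\<lambda>p. Dx k (Dy V) (fst p) (\<mu>, snd p)) (X \<omega>, Y \<omega>)) \<in> borel_measurable N"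
    by measurable
  then show ?thesis by simp
qed

text \<open>Only the derivatives of \<open>U\<close> are bounded, so integrability comes from linear
  growth in \<open>x\<close>, with a constant term that depends on the measure.\<close>

lemma U_integrable:
  assumes N: "prob_space N" and X: "integrable N X" and \<mu>: "\<mu> \<in> P2"
  shows "integrable N (\<lambda>\<omega>. U (X \<omega>) \<mu>)"
proof (rule Bochner_Integration.integrable_bound)
  interpret N: prob_space N by fact
  note [measurable] = U_measurable[OF \<mu>] borel_measurable_integrable[OF X]
  show "integrable N (\<lambda>\<omega>. \<bar>U 0 \<mu>\<bar> + bound_const * \<bar>X \<omega>\<bar>)" using X by simp
  show "(\<lambda>\<omega>. U (X \<omega>) \<mu>) \<in> borel_measurable N" by measurable
  have "\<bar>U x \<mu>\<bar> \<le> \<bar>U 0 \<mu>\<bar> + bound_const * \<bar>x\<bar>" for x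
    using U_lipschitz[OF \<mu>, of x 0] by simp
  then show "AE \<omega> in N. norm (U (X \<omega>) \<mu>) \<le> norm (\<bar>U 0 \<mu>\<bar> + bound_const * \<bar>X \<omega>\<bar>)"
    using bound_const_nonneg by auto
qed

text \<open>The Lions expansion at \<open>\<xi> + s * \<eta>\<close> is restricted to increments
  \<open>h * \<eta>\<close>, whose norm is \<open>|h|\<close> times that of \<open>\<eta>\<close>,
  so that its remainder becomes \<open>o(h)\<close>.\<close>

lemma U_line_deriv:
  assumes \<xi>: "\<xi> \<in> L2T" and \<eta>: "\<eta> \<in> L2T"
  shows "((\<lambda>s. U x (law M (\<lambda>\<omega>. \<xi> \<omega> + s * \<eta> \<omega>))) has_real_derivative
    (\<integral>\<omega>. V x (law M (\<lambda>\<omega>. \<xi> \<omega> + s * \<eta> \<omega>), \<xi> \<omega> + s * \<eta> \<omega>) * \<eta> \<omega> \<partial>M)) (at s)"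
    (is "(?u has_real_derivative ?d) _")
  unfolding DERIV_def LIM_eq
proof (intro allI impI)
  fix e :: real assume e: "0 < e"
  define r where "r = L2_norm M \<eta>"
  have r: "0 \<le> r" by (simp add: r_def L2_norm_def)
  let ?\<xi> = "\<lambda>\<omega>. \<xi> \<omega> + s * \<eta> \<omega>"
  have \<xi>s: "?\<xi> \<in> L2T" by (intro L2T_line \<xi> \<eta>)
  \<comment> \<open>The \<open>+ 1\<close> covers the case \<open>r = 0\<close>; the factor 2 makes
    the final inequality strict.\<close>
  have "0 < e / (2 * (r + 1))" using e r by simp
  then obtain d where d: "d > 0" "\<And>\<zeta>. \<zeta> \<in> L2T \<Longrightarrow> L2_norm M \<zeta> < d \<Longrightarrow>
     \<bar>U x (law M (\<lambda>\<omega>. ?\<xi> \<omega> + \<zeta> \<omega>)) - U x (law M ?\<xi>) - (\<integral>\<omega>. V x (law M ?\<xi>, ?\<xi> \<omega>) * \<zeta> \<omega> \<partial>M)\<bar>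
          \<le> e / (2 * (r + 1)) * L2_norm M \<zeta>"
    using V_lions[of x] \<xi>s unfolding is_lions_derivative_def by meson
  have main: "norm ((?u (s + h) - ?u s) / h - ?d) < e" if h: "h \<noteq> 0" "\<bar>h\<bar> < d / (r + 1)" for h
  proof -
    have n: "L2_norm M (\<lambda>\<omega>. h * \<eta> \<omega>) = \<bar>h\<bar> * r"
      by (simp add: L2_norm_def r_def power_mult_distrib real_sqrt_mult)
    have "\<bar>h\<bar> * r \<le> \<bar>h\<bar> * (r + 1)" by (intro mult_left_mono) auto
    also have "\<dots> < d" using h r by (simp add: field_simps)
    finally have "L2_norm M (\<lambda>\<omega>. h * \<eta> \<omega>) < d" by (simp add: n)
    from d(2)[OF L2T_scale[OF \<eta>] this]
    have "\<bar>?u (s + h) - ?u s - h * ?d\<bar> \<le> e / (2 * (r + 1)) * (\<bar>h\<bar> * r)"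
      unfolding n by (simp add: algebra_simps)
    also have "\<dots> = \<bar>h\<bar> * (e / 2 * (r / (r + 1)))"
      using r by (simp add: field_simps)
    also have "\<dots> \<le> \<bar>h\<bar> * (e / 2 * 1)"
      using r e by (intro mult_left_mono) auto
    also have "\<dots> < \<bar>h\<bar> * e" using e h by simp
    finally have "\<bar>?u (s + h) - ?u s - h * ?d\<bar> / \<bar>h\<bar> < e"
      using h by (simp add: field_simps)
    moreover have "(?u (s + h) - ?u s) / h - ?d = (?u (s + h) - ?u s - h * ?d) / h"
      using h by (simp add: field_simps)
    ultimately show ?thesis by (simp add: abs_divide)
  qed
  show "\<exists>q>0. \<forall>h. h \<noteq> 0 \<and> norm (h - 0) < q \<longrightarrow> norm ((?u (s + h) - ?u s) / h - ?d) < e"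
  proof (intro exI[of _ "d / (r + 1)"] conjI allI impI)
    show "0 < d / (r + 1)" using d(1) r by simp
    show "norm ((?u (s + h) - ?u s) / h - ?d) < e" if "h \<noteq> 0 \<and> norm (h - 0) < d / (r + 1)" for h
      using main[of h] that by simp
  qed
qed

end

section \<open>The differential form of monotonicity\<close>

context smooth_functional
begin

text \<open>The pairing of \<open>U(., \<mu>) - U(., \<nu>)\<close> with the signed measure
  \<open>\<mu> - \<nu>\<close>. The Lasry-Lions expression sees only the two marginal laws, so each
  pair of laws may be realised by whichever coupling is convenient.\<close>

definition ll_gap :: "real measure \<Rightarrow> real measure \<Rightarrow> real" where
  "ll_gap \<mu> \<nu> = (\<integral>x. U x \<mu> - U x \<nu> \<partial>\<mu>) - (\<integral>x. U x \<mu> - U x \<nu> \<partial>\<nu>)"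

definition ker :: "real measure \<Rightarrow> real \<times> real \<Rightarrow> real" where
  "ker \<mu> p = Dx 1 V (fst p) (\<mu>, snd p)"

definition diff_monotone :: bool where
  "diff_monotone \<longleftrightarrow> (\<forall>\<xi>\<in>L2T. \<forall>\<eta>\<in>L2T. 0 \<le> quad M (ker (law M \<xi>)) \<xi> \<eta>)"

lemma ker_measurable: "\<mu> \<in> P2 \<Longrightarrow> ker \<mu> \<in> borel_measurable borel"
  using V_measurable[of 1 \<mu>] unfolding ker_def[abs_def] by simp

lemma ll_gap_distr:
  assumes N: "prob_space N"
    and X: "integrable N X" "distr N borel X \<in> P2" and Y: "integrable N Y" "distr N borel Y \<in> P2"
  shows "(\<integral>\<omega>. U (X \<omega>) (distr N borel X) + U (Y \<omega>) (distr N borel Y)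
        - U (X \<omega>) (distr N borel Y) - U (Y \<omega>) (distr N borel X) \<partial>N)
      = ll_gap (distr N borel X) (distr N borel Y)"
proof -
  let ?\<mu> = "distr N borel X" and ?\<nu> = "distr N borel Y"
  note [measurable] = U_measurable[OF X(2)] U_measurable[OF Y(2)]
    borel_measurable_integrable[OF X(1)] borel_measurable_integrable[OF Y(1)]
  note i = U_integrable[OF N X(1) X(2)] U_integrable[OF N X(1) Y(2)]
    U_integrable[OF N Y(1) X(2)] U_integrable[OF N Y(1) Y(2)]
  have "ll_gap ?\<mu> ?\<nu> = (\<integral>\<omega>. U (X \<omega>) ?\<mu> - U (X \<omega>) ?\<nu> \<partial>N) - (\<integral>\<omega>. U (Y \<omega>) ?\<mu> - U (Y \<omega>) ?\<nu> \<partial>N)"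
    unfolding ll_gap_def by (subst (1 2) integral_distr) auto
  then show ?thesis using i by simp
qed

lemma lasry_lions_monotone_iff:
  "lasry_lions_monotone M (F T) U \<longleftrightarrow> (\<forall>\<xi>\<in>L2T. \<forall>\<zeta>\<in>L2T. 0 \<le> ll_gap (law M \<xi>) (law M \<zeta>))"
proof -
  have "(\<integral>\<omega>. U (\<xi> \<omega>) (law M \<xi>) + U (\<zeta> \<omega>) (law M \<zeta>)
             - U (\<xi> \<omega>) (law M \<zeta>) - U (\<zeta> \<omega>) (law M \<xi>) \<partial>M) = ll_gap (law M \<xi>) (law M \<zeta>)"
    if "\<xi> \<in> L2T" "\<zeta> \<in> L2T" for \<xi> \<zeta>
    using that law_in_P2 unfolding law_def
    by (intro ll_gap_distr prob_space_axioms L2T_integrable) auto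
  then show ?thesis unfolding lasry_lions_monotone_def by simp
qed

text \<open>The mean value point and the prescribed point \<open>x + z * h\<close> are at most
  \<open>|h|\<close> apart, and the bound on the second derivative in \<open>x\<close> turns this
  into an error of order \<open>h^2\<close>. The freedom in \<open>z\<close> matters because another
  application of the mean value theorem will dictate it.\<close>

lemma V_taylor:
  assumes "\<mu> \<in> P2" "0 \<le> z" "z \<le> 1"
  shows "\<bar>V (x + h) (\<mu>, y) - V x (\<mu>, y) - Dx 1 V (x + z * h) (\<mu>, y) * h\<bar> \<le> bound_const * h\<^sup>2"
proof -
  have D: "((\<lambda>x. V x (\<mu>, y)) has_real_derivative Dx 1 V x (\<mu>, y)) (at x)" for x
    using V_deriv[OF assms(1), of 0 y x] by simp
  obtain t where t: "0 \<le> t" "t \<le> 1" "V (x + h) (\<mu>, y) - V x (\<mu>, y) = h * Dx 1 V (x + t * h) (\<mu>, y)"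
    by (rule DERIV_mvt_exists[OF D])
  have "\<bar>Dx 1 V (x + t * h) (\<mu>, y) - Dx 1 V (x + z * h) (\<mu>, y)\<bar>
      \<le> bound_const * \<bar>(x + t * h) - (x + z * h)\<bar>"
    by (rule lipschitz_of_bounded_deriv[OF V_deriv[OF assms(1)] bounded(2)[OF assms(1)]]) auto
  also have "\<dots> = bound_const * (\<bar>t - z\<bar> * \<bar>h\<bar>)"
    by (simp add: abs_mult[symmetric] algebra_simps)
  also have "\<dots> \<le> bound_const * (1 * \<bar>h\<bar>)"
    using t assms by (intro mult_left_mono mult_right_mono bound_const_nonneg) auto
  finally have "\<bar>h\<bar> * \<bar>Dx 1 V (x + t * h) (\<mu>, y) - Dx 1 V (x + z * h) (\<mu>, y)\<bar>
      \<le> \<bar>h\<bar> * (bound_const * \<bar>h\<bar>)"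
    by (intro mult_left_mono) auto
  then show ?thesis
    unfolding t(3) abs_mult[symmetric] by (simp add: algebra_simps power2_eq_square)
qed

text \<open>The same \<open>s\<close> must occur in the law and in the arguments of the kernel,
  since only then does \<open>diff_monotone\<close> apply. The mean value theorem chooses
  \<open>s\<close> for the law; \<open>V_taylor\<close> then allows the kernel to be evaluated at
  that \<open>s\<close>. Its error is quadratic in the increment of the first copy and carries the
  factor \<open>|\<eta>|\<close> of the second copy, so that the expectation of the error
  factorises.\<close>

lemma ll_gap_expansion:
  assumes \<xi>: "\<xi> \<in> L2T" and \<eta>: "\<eta> \<in> L2T"
  obtains s where "0 < s" "s < 1"
    "\<bar>ll_gap (law M (\<lambda>\<omega>. \<xi> \<omega> + \<eta> \<omega>)) (law M \<xi>)
        - quad M (ker (law M (\<lambda>\<omega>. \<xi> \<omega> + s * \<eta> \<omega>))) (\<lambda>\<omega>. \<xi> \<omega> + s * \<eta> \<omega>) \<eta>\<bar>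
      \<le> bound_const * (\<integral>\<omega>. (\<eta> \<omega>)\<^sup>2 \<partial>M) * (\<integral>\<omega>. \<bar>\<eta> \<omega>\<bar> \<partial>M)"
proof -
  let ?b = bound_const
  let ?\<xi> = "\<lambda>s \<omega>. \<xi> \<omega> + s * \<eta> \<omega>"
  define L where "L s = law M (?\<xi> s)" for s
  define d where "d x s = (\<integral>\<omega>. V x (L s, ?\<xi> s \<omega>) * \<eta> \<omega> \<partial>M)" for x s
  interpret P: pair_prob_space M M by (rule pair_prob_space_self)
  have \<xi>s: "?\<xi> s \<in> L2T" for s by (intro L2T_line \<xi> \<eta>)
  have L: "L s \<in> P2" for s unfolding L_def by (rule law_in_P2[OF \<xi>s])
  note [measurable] = L2T_measurable[OF \<xi>s] L2T_measurable[OF \<eta>] L2T_measurable[OF \<xi>]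
  have Vb: "\<bar>V x (L s, y)\<bar> \<le> ?b" for x s y
    using bounded(2)[OF L, of 0] by simp
  have Vm [measurable]: "(\<lambda>p. V (fst p) (L s, snd p)) \<in> borel_measurable borel" for s
    using V_measurable[OF _ L, of 0] by simp
  have Vm' [measurable]: "(\<lambda>\<omega>. V (X \<omega>) (L s, Y \<omega>)) \<in> borel_measurable N"
    if "X \<in> borel_measurable N" "Y \<in> borel_measurable N" for X Y and s and N :: "'z measure"
    using V_measurable_comp[OF _ L that, of 0] by simp
  have \<eta>i: "integrable M \<eta>" by (rule L2T_integrable[OF \<eta>])
  have du: "((\<lambda>s. U x (L s)) has_real_derivative d x s) (at s)" for x s
    unfolding L_def d_def by (rule U_line_deriv[OF \<xi> \<eta>])
  have db: "\<bar>d x s\<bar> \<le> ?b * (\<integral>\<omega>. \<bar>\<eta> \<omega>\<bar> \<partial>M)" for x s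
  proof -
    have "\<bar>d x s\<bar> \<le> (\<integral>\<omega>. ?b * \<bar>\<eta> \<omega>\<bar> \<partial>M)"
      unfolding d_def
    proof (rule abs_integral_le)
      show "integrable M (\<lambda>\<omega>. V x (L s, ?\<xi> s \<omega>) * \<eta> \<omega>)"
      proof (rule Bochner_Integration.integrable_bound)
        show "integrable M (\<lambda>\<omega>. ?b * \<bar>\<eta> \<omega>\<bar>)" using \<eta>i by simp
        show "(\<lambda>\<omega>. V x (L s, ?\<xi> s \<omega>) * \<eta> \<omega>) \<in> borel_measurable M" by measurable
        show "AE \<omega> in M. norm (V x (L s, ?\<xi> s \<omega>) * \<eta> \<omega>) \<le> norm (?b * \<bar>\<eta> \<omega>\<bar>)"
          using Vb bound_const_nonneg by (auto simp: abs_mult intro!: mult_right_mono)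
      qed
      show "integrable M (\<lambda>\<omega>. ?b * \<bar>\<eta> \<omega>\<bar>)" using \<eta>i by simp
      show "\<bar>V x (L s, ?\<xi> s \<omega>) * \<eta> \<omega>\<bar> \<le> ?b * \<bar>\<eta> \<omega>\<bar>" for \<omega>
        using Vb by (auto simp: abs_mult intro!: mult_right_mono)
    qed
    then show ?thesis by simp
  qed
  have Ulip: "\<bar>U x (L t) - U x (L s)\<bar> \<le> ?b * (\<integral>\<omega>. \<bar>\<eta> \<omega>\<bar> \<partial>M) * \<bar>t - s\<bar>" for x s t
    by (rule lipschitz_of_bounded_deriv[OF du db])
  have dm [measurable]: "(\<lambda>x. d x s) \<in> borel_measurable borel" for s
    unfolding d_def by measurable
  \<comment> \<open>Differentiation under the expectation: along sequences the difference quotients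
    are dominated by the Lipschitz constant from \<open>Ulip\<close>, uniformly in the argument of
    \<open>U\<close>.\<close>
  have D: "((\<lambda>s. \<integral>\<omega>. U (X \<omega>) (L s) \<partial>M) has_real_derivative (\<integral>\<omega>. d (X \<omega>) s \<partial>M)) (at s)"
    if X: "X \<in> L2T" for X s
    unfolding DERIV_def LIMSEQ_SEQ_conv[symmetric]
  proof (intro allI impI)
    fix S :: "nat \<Rightarrow> real" assume "(\<forall>n. S n \<noteq> 0) \<and> S \<longlonglongrightarrow> 0"
    then have S: "\<And>n. S n \<noteq> 0" "S \<longlonglongrightarrow> 0" by auto
    note [measurable] = L2T_measurable[OF X] U_measurable[OF L]
    note i = U_integrable[OF prob_space_axioms L2T_integrable[OF X] L]
    have "(\<lambda>n. \<integral>\<omega>. (U (X \<omega>) (L (s + S n)) - U (X \<omega>) (L s)) / S n \<partial>M) \<longlonglongrightarrow> (\<integral>\<omega>. d (X \<omega>) s \<partial>M)"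
    proof (rule integral_dominated_convergence)
      show "integrable M (\<lambda>\<omega>. ?b * (\<integral>\<omega>. \<bar>\<eta> \<omega>\<bar> \<partial>M))" by simp
      show "(\<lambda>\<omega>. d (X \<omega>) s) \<in> borel_measurable M" by measurable
      show "(\<lambda>\<omega>. (U (X \<omega>) (L (s + S n)) - U (X \<omega>) (L s)) / S n) \<in> borel_measurable M" for n
        by measurable
      show "AE \<omega> in M. (\<lambda>n. (U (X \<omega>) (L (s + S n)) - U (X \<omega>) (L s)) / S n) \<longlonglongrightarrow> d (X \<omega>) s"
        using du[unfolded DERIV_def LIMSEQ_SEQ_conv[symmetric]] S by simp
      show "AE \<omega> in M. norm ((U (X \<omega>) (L (s + S n)) - U (X \<omega>) (L s)) / S n)
          \<le> ?b * (\<integral>\<omega>. \<bar>\<eta> \<omega>\<bar> \<partial>M)" for n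
        using Ulip[of _ "s + S n" s] S(1)[of n] by (simp add: abs_divide divide_le_eq)
    qed
    also have "(\<lambda>n. \<integral>\<omega>. (U (X \<omega>) (L (s + S n)) - U (X \<omega>) (L s)) / S n \<partial>M)
        = (\<lambda>n. ((\<integral>\<omega>. U (X \<omega>) (L (s + S n)) \<partial>M) - (\<integral>\<omega>. U (X \<omega>) (L s) \<partial>M)) / S n)"
      using i by simp
    finally show "(\<lambda>n. ((\<integral>\<omega>. U (X \<omega>) (L (s + S n)) \<partial>M) - (\<integral>\<omega>. U (X \<omega>) (L s) \<partial>M)) / S n)
      \<longlonglongrightarrow> (\<integral>\<omega>. d (X \<omega>) s \<partial>M)" .
  qed
  \<comment> \<open>The end points stay fixed as arguments of \<open>U\<close> and only the law
    moves, so the gap becomes the increment of one real function on \<open>[0, 1]\<close>.\<close>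
  define \<Phi> where "\<Phi> s = (\<integral>\<omega>. U (?\<xi> 1 \<omega>) (L s) \<partial>M) - (\<integral>\<omega>. U (?\<xi> 0 \<omega>) (L s) \<partial>M)" for s
  have D\<Phi>: "(\<Phi> has_real_derivative (\<integral>\<omega>. d (?\<xi> 1 \<omega>) s \<partial>M) - (\<integral>\<omega>. d (?\<xi> 0 \<omega>) s \<partial>M)) (at s)" for s
    unfolding \<Phi>_def by (intro DERIV_diff D \<xi>s)
  obtain s where s: "0 < s" "s < 1"
    "\<Phi> 1 - \<Phi> 0 = (1 - 0) * ((\<integral>\<omega>. d (?\<xi> 1 \<omega>) s \<partial>M) - (\<integral>\<omega>. d (?\<xi> 0 \<omega>) s \<partial>M))"
    using MVT2[of 0 1 \<Phi>, OF _ D\<Phi>] by auto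
  have gap: "ll_gap (law M (\<lambda>\<omega>. \<xi> \<omega> + \<eta> \<omega>)) (law M \<xi>) = \<Phi> 1 - \<Phi> 0"
  proof -
    have "law M (\<lambda>\<omega>. \<xi> \<omega> + \<eta> \<omega>) = L 1" "law M \<xi> = L 0" by (simp_all add: L_def)
    moreover have "ll_gap (L 1) (L 0) = (\<integral>\<omega>. U (?\<xi> 1 \<omega>) (L 1) - U (?\<xi> 1 \<omega>) (L 0) \<partial>M)
        - (\<integral>\<omega>. U (?\<xi> 0 \<omega>) (L 1) - U (?\<xi> 0 \<omega>) (L 0) \<partial>M)"
    proof -
      have "(\<integral>x. U x (L 1) - U x (L 0) \<partial>L s) = (\<integral>\<omega>. U (?\<xi> s \<omega>) (L 1) - U (?\<xi> s \<omega>) (L 0) \<partial>M)" for s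
        unfolding L_def[of s] law_def using U_measurable[OF L]
        by (intro integral_distr) auto
      then show ?thesis unfolding ll_gap_def by simp
    qed
    moreover have "integrable M (\<lambda>\<omega>. U (\<xi> \<omega> + \<eta> \<omega>) (L t))" "integrable M (\<lambda>\<omega>. U (\<xi> \<omega>) (L t))" for t
      using U_integrable[OF prob_space_axioms L2T_integrable[OF \<xi>s[of 1]] L]
        U_integrable[OF prob_space_axioms L2T_integrable[OF \<xi>s[of 0]] L] by simp_all
    ultimately show ?thesis unfolding \<Phi>_def by simp
  qed
  \<comment> \<open>The factor \<open>1\<close> fills the slot that
    \<open>integrable_pair_kernel\<close> reserves for the first coordinate.\<close>
  have fub: "integrable (M \<Otimes>\<^sub>M M) (\<lambda>p. V (X (fst p)) (L s, ?\<xi> s (snd p)) * 1 * \<eta> (snd p))"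
      "(\<integral>\<omega>. d (X \<omega>) s \<partial>M) = (\<integral>p. V (X (fst p)) (L s, ?\<xi> s (snd p)) * 1 * \<eta> (snd p) \<partial>(M \<Otimes>\<^sub>M M))"
    if X: "X \<in> L2T" for X
  proof -
    note [measurable] = L2T_measurable[OF X]
    show i: "integrable (M \<Otimes>\<^sub>M M) (\<lambda>p. V (X (fst p)) (L s, ?\<xi> s (snd p)) * 1 * \<eta> (snd p))"
      using Vb by (intro integrable_pair_kernel[where Y = "\<lambda>_. 1"] \<eta>i) auto
    show "(\<integral>\<omega>. d (X \<omega>) s \<partial>M) = (\<integral>p. V (X (fst p)) (L s, ?\<xi> s (snd p)) * 1 * \<eta> (snd p) \<partial>(M \<Otimes>\<^sub>M M))"
      using P.integral_fst'[OF i] by (simp add: d_def)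
  qed
  have kerm: "(\<lambda>p. ker (L s) (?\<xi> s (fst p), ?\<xi> s (snd p))) \<in> borel_measurable (M \<Otimes>\<^sub>M M)"
    unfolding ker_def fst_conv snd_conv by (rule V_measurable_comp[OF _ L]) auto
  have iq: "integrable (M \<Otimes>\<^sub>M M)
      (\<lambda>p. ker (L s) (?\<xi> s (fst p), ?\<xi> s (snd p)) * \<eta> (fst p) * \<eta> (snd p))"
    using bounded(2)[OF L, of 1] by (intro integrable_pair_kernel \<eta>i kerm) (auto simp: ker_def)
  let ?R = "\<lambda>p. V (?\<xi> 1 (fst p)) (L s, ?\<xi> s (snd p)) * 1 * \<eta> (snd p)
      - V (?\<xi> 0 (fst p)) (L s, ?\<xi> s (snd p)) * 1 * \<eta> (snd p)
      - ker (L s) (?\<xi> s (fst p), ?\<xi> s (snd p)) * \<eta> (fst p) * \<eta> (snd p)"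
  have R1: "\<Phi> 1 - \<Phi> 0 - quad M (ker (L s)) (?\<xi> s) \<eta> = (\<integral>p. ?R p \<partial>(M \<Otimes>\<^sub>M M))"
    unfolding s(3) quad_def fub(2)[OF \<xi>s] using fub(1)[OF \<xi>s[of 1]] fub(1)[OF \<xi>s[of 0]] iq
    by simp
  have R2: "\<bar>\<integral>p. ?R p \<partial>(M \<Otimes>\<^sub>M M)\<bar> \<le> (\<integral>p. ?b * ((\<eta> (fst p))\<^sup>2 * \<bar>\<eta> (snd p)\<bar>) \<partial>(M \<Otimes>\<^sub>M M))"
  proof (rule abs_integral_le)
    show "integrable (M \<Otimes>\<^sub>M M) ?R"
      by (intro Bochner_Integration.integrable_diff fub(1)[OF \<xi>s] iq)
    show "integrable (M \<Otimes>\<^sub>M M) (\<lambda>p. ?b * ((\<eta> (fst p))\<^sup>2 * \<bar>\<eta> (snd p)\<bar>))"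
      using L2T_integrable_square[OF \<eta>] \<eta>i
      by (intro integrable_mult_right integrable_pair_mult) auto
    fix p
    have R0: "?R p = (V (\<xi> (fst p) + \<eta> (fst p)) (L s, ?\<xi> s (snd p)) - V (\<xi> (fst p)) (L s, ?\<xi> s (snd p))
        - Dx 1 V (\<xi> (fst p) + s * \<eta> (fst p)) (L s, ?\<xi> s (snd p)) * \<eta> (fst p)) * \<eta> (snd p)"
      by (simp add: ker_def algebra_simps)
    have "\<bar>?R p\<bar> \<le> (?b * (\<eta> (fst p))\<^sup>2) * \<bar>\<eta> (snd p)\<bar>"
      unfolding R0 abs_mult
      using s by (intro mult_right_mono V_taylor[OF L]) auto
    then show "\<bar>?R p\<bar> \<le> ?b * ((\<eta> (fst p))\<^sup>2 * \<bar>\<eta> (snd p)\<bar>)" by simp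
  qed
  have R3: "(\<integral>p. ?b * ((\<eta> (fst p))\<^sup>2 * \<bar>\<eta> (snd p)\<bar>) \<partial>(M \<Otimes>\<^sub>M M))
      = ?b * (\<integral>\<omega>. (\<eta> \<omega>)\<^sup>2 \<partial>M) * (\<integral>\<omega>. \<bar>\<eta> \<omega>\<bar> \<partial>M)"
    unfolding integral_mult_right_zero mult.assoc
    by (subst integral_pair_mult[OF L2T_integrable_square[OF \<eta>] integrable_abs[OF \<eta>i]]) (rule refl)
  have R: "\<bar>\<Phi> 1 - \<Phi> 0 - quad M (ker (L s)) (?\<xi> s) \<eta>\<bar>
      \<le> ?b * (\<integral>\<omega>. (\<eta> \<omega>)\<^sup>2 \<partial>M) * (\<integral>\<omega>. \<bar>\<eta> \<omega>\<bar> \<partial>M)"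
    unfolding R1 R3[symmetric] by (rule R2)
  show ?thesis
    by (rule that[OF s(1,2)]) (use R in \<open>simp only: gap L_def\<close>)
qed

end

lemma quad_scale: "quad N k X (\<lambda>\<omega>. c * Y \<omega>) = c\<^sup>2 * quad N k X Y"
proof -
  have "(\<lambda>p. k (X (fst p), X (snd p)) * (c * Y (fst p)) * (c * Y (snd p)))
      = (\<lambda>p. c\<^sup>2 * (k (X (fst p), X (snd p)) * Y (fst p) * Y (snd p)))"
    by (simp add: fun_eq_iff power2_eq_square algebra_simps)
  then show ?thesis unfolding quad_def by (simp only: integral_mult_right_zero)
qed

section \<open>Limits of the quadratic form and its transfer to other probability spaces\<close>

context smooth_functional
begin

lemma V_tendsto:
  assumes "k \<le> 3" "\<mu> \<in> P2" "\<And>n. \<nu> n \<in> P2" "x \<longlonglongrightarrow> x'" "y \<longlonglongrightarrow> y'"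
    "\<And>n. W2 (\<nu> n) \<mu> \<le> w n" "w \<longlonglongrightarrow> 0"
  shows "(\<lambda>n. Dx k V (x n) (\<nu> n, y n)) \<longlonglongrightarrow> Dx k V x' (\<mu>, y')"
  using continuous_P2_tendsto[OF V_continuous[OF assms(1)] assms(2,3)
      tendsto_Pair[OF assms(4,5)] assms(6,7)] by simp

lemma DyV_tendsto:
  assumes "k \<le> 2" "\<mu> \<in> P2" "\<And>n. \<nu> n \<in> P2" "x \<longlonglongrightarrow> x'" "y \<longlonglongrightarrow> y'"
    "\<And>n. W2 (\<nu> n) \<mu> \<le> w n" "w \<longlonglongrightarrow> 0"
  shows "(\<lambda>n. Dx k (Dy V) (x n) (\<nu> n, y n)) \<longlonglongrightarrow> Dx k (Dy V) x' (\<mu>, y')"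
  using continuous_P2_tendsto[OF DyV_continuous[OF assms(1)] assms(2,3)
      tendsto_Pair[OF assms(4,5)] assms(6,7)] by simp

text \<open>Three arguments of the kernel move. Pointwise convergence of \<open>X n\<close> takes
  care of the two real ones; mean-square convergence takes care of the law, since
  \<open>(X n, X')\<close> is a coupling.\<close>

lemma quad_ker_tendsto:
  assumes N: "prob_space N"
    and X: "\<And>n. X n \<in> borel_measurable N" "\<And>n. integrable N (\<lambda>\<omega>. (X n \<omega>)\<^sup>2)"
    and X': "X' \<in> borel_measurable N" "integrable N (\<lambda>\<omega>. (X' \<omega>)\<^sup>2)"
    and lim: "\<And>\<omega>. \<omega> \<in> space N \<Longrightarrow> (\<lambda>n. X n \<omega>) \<longlonglongrightarrow> X' \<omega>"
      "(\<lambda>n. \<integral>\<omega>. (X n \<omega> - X' \<omega>)\<^sup>2 \<partial>N) \<longlonglongrightarrow> 0"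
    and Y: "\<And>n. Y n \<in> borel_measurable N" "Y' \<in> borel_measurable N"
      "\<And>n \<omega>. \<omega> \<in> space N \<Longrightarrow> \<bar>Y n \<omega>\<bar> \<le> G \<omega>" "integrable N G"
      "\<And>\<omega>. \<omega> \<in> space N \<Longrightarrow> (\<lambda>n. Y n \<omega>) \<longlonglongrightarrow> Y' \<omega>"
  shows "(\<lambda>n. quad N (ker (distr N borel (X n))) (X n) (Y n))
    \<longlonglongrightarrow> quad N (ker (distr N borel X')) X' Y'"
proof -
  interpret N: prob_space N by fact
  have P: "distr N borel (X n) \<in> P2" for n by (intro N.distr_in_P2 X)
  have P': "distr N borel X' \<in> P2" by (intro N.distr_in_P2 X')
  note [measurable] = X(1) X'(1)
  show ?thesis
    unfolding quad_def
  proof (rule N.integral_pair_kernel_tendsto[OF _ _ _ _ Y Y])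
    show "(\<lambda>p. ker (distr N borel (X n)) (X n (fst p), X n (snd p))) \<in> borel_measurable (N \<Otimes>\<^sub>M N)" for n
      unfolding ker_def fst_conv snd_conv by (rule V_measurable_comp[OF _ P]) auto
    show "(\<lambda>p. ker (distr N borel X') (X' (fst p), X' (snd p))) \<in> borel_measurable (N \<Otimes>\<^sub>M N)"
      unfolding ker_def fst_conv snd_conv by (rule V_measurable_comp[OF _ P']) auto
    show "\<bar>ker (distr N borel (X n)) (X n (fst p), X n (snd p))\<bar> \<le> bound_const" for n p
      unfolding ker_def by (rule bounded(2)[OF P]) simp
    show "(\<lambda>n. ker (distr N borel (X n)) (X n (fst p), X n (snd p)))
        \<longlonglongrightarrow> ker (distr N borel X') (X' (fst p), X' (snd p))" if "p \<in> space (N \<Otimes>\<^sub>M N)" for p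
      unfolding ker_def fst_conv snd_conv
    proof (rule V_tendsto[OF _ P' P])
      show "W2 (distr N borel (X n)) (distr N borel X') \<le> sqrt (\<integral>\<omega>. (X n \<omega> - X' \<omega>)\<^sup>2 \<partial>N)" for n
        by (rule N.W2_distr_le[OF X(1) X'(1)])
      show "(\<lambda>n. sqrt (\<integral>\<omega>. (X n \<omega> - X' \<omega>)\<^sup>2 \<partial>N)) \<longlonglongrightarrow> 0"
        using tendsto_real_sqrt[OF lim(2)] by simp
    qed (use that in \<open>auto simp: space_pair_measure intro!: lim(1)\<close>)
  qed
qed

text \<open>The form is quadratic in the increment and the error cubic, so for the increment
  \<open>\<epsilon> * \<eta>\<close> division by \<open>\<epsilon>^2\<close> leaves an error of
  order \<open>\<epsilon>\<close>. The form is then still taken at an intermediate point, which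
  tends to \<open>\<xi>\<close>; \<open>quad_ker_tendsto\<close> passes to the limit.\<close>

lemma diff_monotone_if_ll_monotone:
  assumes ll: "lasry_lions_monotone M (F T) U"
  shows diff_monotone
  unfolding diff_monotone_def
proof (intro ballI)
  fix \<xi> \<eta> assume \<xi>: "\<xi> \<in> L2T" and \<eta>: "\<eta> \<in> L2T"
  let ?R = "bound_const * (\<integral>\<omega>. (\<eta> \<omega>)\<^sup>2 \<partial>M) * (\<integral>\<omega>. \<bar>\<eta> \<omega>\<bar> \<partial>M)"
  define \<epsilon> where "\<epsilon> n = 1 / real (Suc n)" for n
  have \<epsilon>: "0 < \<epsilon> n" for n by (simp add: \<epsilon>_def)
  have \<epsilon>0: "\<epsilon> \<longlonglongrightarrow> 0" unfolding \<epsilon>_def[abs_def] by (rule LIMSEQ_Suc[OF lim_1_over_n])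
  have ex: "\<exists>s. 0 < s \<and> s < 1 \<and>
      - (\<epsilon> n * ?R) \<le> quad M (ker (law M (\<lambda>\<omega>. \<xi> \<omega> + s * \<epsilon> n * \<eta> \<omega>))) (\<lambda>\<omega>. \<xi> \<omega> + s * \<epsilon> n * \<eta> \<omega>) \<eta>" for n
  proof -
    obtain s where s: "0 < s" "s < 1"
      "\<bar>ll_gap (law M (\<lambda>\<omega>. \<xi> \<omega> + \<epsilon> n * \<eta> \<omega>)) (law M \<xi>)
        - quad M (ker (law M (\<lambda>\<omega>. \<xi> \<omega> + s * (\<epsilon> n * \<eta> \<omega>)))) (\<lambda>\<omega>. \<xi> \<omega> + s * (\<epsilon> n * \<eta> \<omega>)) (\<lambda>\<omega>. \<epsilon> n * \<eta> \<omega>)\<bar>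
      \<le> bound_const * (\<integral>\<omega>. (\<epsilon> n * \<eta> \<omega>)\<^sup>2 \<partial>M) * (\<integral>\<omega>. \<bar>\<epsilon> n * \<eta> \<omega>\<bar> \<partial>M)"
      by (rule ll_gap_expansion[OF \<xi> L2T_scale[OF \<eta>]])
    let ?q = "quad M (ker (law M (\<lambda>\<omega>. \<xi> \<omega> + s * (\<epsilon> n * \<eta> \<omega>)))) (\<lambda>\<omega>. \<xi> \<omega> + s * (\<epsilon> n * \<eta> \<omega>)) \<eta>"
    have "0 \<le> ll_gap (law M (\<lambda>\<omega>. \<xi> \<omega> + \<epsilon> n * \<eta> \<omega>)) (law M \<xi>)"
      using ll[unfolded lasry_lions_monotone_iff] \<xi> L2T_line[OF \<xi> \<eta>] by blast
    moreover have "bound_const * (\<integral>\<omega>. (\<epsilon> n * \<eta> \<omega>)\<^sup>2 \<partial>M) * (\<integral>\<omega>. \<bar>\<epsilon> n * \<eta> \<omega>\<bar> \<partial>M) = (\<epsilon> n)\<^sup>2 * (\<epsilon> n * ?R)"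
      using \<epsilon>[of n] by (simp add: power_mult_distrib abs_mult)
    ultimately have "(\<epsilon> n)\<^sup>2 * (- (\<epsilon> n * ?R)) \<le> (\<epsilon> n)\<^sup>2 * ?q"
      using s(3) unfolding quad_scale by linarith
    then have "- (\<epsilon> n * ?R) \<le> ?q"
      using \<epsilon>[of n] by (subst (asm) mult_le_cancel_left_pos) auto
    with s show ?thesis by (intro exI[of _ s]) (simp add: mult.assoc)
  qed
  define s where "s n = (SOME s. 0 < s \<and> s < 1 \<and>
      - (\<epsilon> n * ?R) \<le> quad M (ker (law M (\<lambda>\<omega>. \<xi> \<omega> + s * \<epsilon> n * \<eta> \<omega>))) (\<lambda>\<omega>. \<xi> \<omega> + s * \<epsilon> n * \<eta> \<omega>) \<eta>)" for n
  note s_props = someI_ex[OF ex, folded s_def]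
  have s: "0 < s n" "s n < 1" for n
    using s_props[of n] by simp_all
  have q: "- (\<epsilon> n * ?R) \<le> quad M (ker (law M (\<lambda>\<omega>. \<xi> \<omega> + s n * \<epsilon> n * \<eta> \<omega>))) (\<lambda>\<omega>. \<xi> \<omega> + s n * \<epsilon> n * \<eta> \<omega>) \<eta>" for n
    using s_props[of n] by (elim conjE)
  have t0: "(\<lambda>n. s n * \<epsilon> n) \<longlonglongrightarrow> 0"
  proof (rule tendsto_rabs_zero_cancel, rule tendsto_sandwich[OF _ _ tendsto_const \<epsilon>0])
    have "\<bar>s n * \<epsilon> n\<bar> \<le> 1 * \<epsilon> n" for n
      using s[of n] \<epsilon>[of n] by (simp add: abs_mult)
    then show "\<forall>\<^sub>F n in sequentially. \<bar>s n * \<epsilon> n\<bar> \<le> \<epsilon> n" by simp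
  qed simp
  have "(\<lambda>n. quad M (ker (distr M borel (\<lambda>\<omega>. \<xi> \<omega> + s n * \<epsilon> n * \<eta> \<omega>))) (\<lambda>\<omega>. \<xi> \<omega> + s n * \<epsilon> n * \<eta> \<omega>) \<eta>)
      \<longlonglongrightarrow> quad M (ker (distr M borel \<xi>)) \<xi> \<eta>"
  proof (rule quad_ker_tendsto[OF prob_space_axioms])
    show "(\<lambda>\<omega>. \<xi> \<omega> + s n * \<epsilon> n * \<eta> \<omega>) \<in> borel_measurable M" for n
      by (rule L2T_measurable[OF L2T_line[OF \<xi> \<eta>]])
    show "integrable M (\<lambda>\<omega>. (\<xi> \<omega> + s n * \<epsilon> n * \<eta> \<omega>)\<^sup>2)" for n
      by (rule L2T_integrable_square[OF L2T_line[OF \<xi> \<eta>]])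
    show "(\<lambda>n. \<xi> \<omega> + s n * \<epsilon> n * \<eta> \<omega>) \<longlonglongrightarrow> \<xi> \<omega>" for \<omega>
      using tendsto_add[OF tendsto_const[of "\<xi> \<omega>"] tendsto_mult[OF t0 tendsto_const[of "\<eta> \<omega>"]]] by simp
    show "(\<lambda>n. \<integral>\<omega>. (\<xi> \<omega> + s n * \<epsilon> n * \<eta> \<omega> - \<xi> \<omega>)\<^sup>2 \<partial>M) \<longlonglongrightarrow> 0"
      using tendsto_mult[OF tendsto_power[OF t0, of 2] tendsto_const[of "\<integral>\<omega>. (\<eta> \<omega>)\<^sup>2 \<partial>M"]]
      by (simp add: power_mult_distrib)
    show "integrable M (\<lambda>\<omega>. \<bar>\<eta> \<omega>\<bar>)" using L2T_integrable[OF \<eta>] by simp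
  qed (use \<xi> \<eta> in \<open>auto intro: L2T_measurable L2T_integrable_square\<close>)
  moreover have "(\<lambda>n. - (\<epsilon> n * ?R)) \<longlonglongrightarrow> 0"
    using tendsto_minus[OF tendsto_mult[OF \<epsilon>0 tendsto_const[of ?R]]] by simp
  ultimately show "0 \<le> quad M (ker (law M \<xi>)) \<xi> \<eta>"
    using q unfolding law_def by (intro LIMSEQ_le) auto
qed

text \<open>Richness supplies one variable of prescribed law, while a pair is wanted. Countably many
  values allow both components to be read off one real \<open>code\<close>, and
  \<open>quad_comp\<close> carries the form over.\<close>

lemma discrete_pair_realized:
  fixes X Y :: "'b \<Rightarrow> real"
  assumes N: "prob_space N"
    and [measurable]: "I \<in> measurable N (count_space UNIV)" "J \<in> measurable N (count_space UNIV)"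
    and XY: "X = (\<lambda>\<omega>. real_of_int (I \<omega>) / c)" "Y = (\<lambda>\<omega>. real_of_int (J \<omega>) / c)"
    and sq: "integrable N (\<lambda>\<omega>. (X \<omega>)\<^sup>2)" "integrable N (\<lambda>\<omega>. (Y \<omega>)\<^sup>2)"
  obtains \<xi> \<eta> where "\<xi> \<in> L2T" "\<eta> \<in> L2T" "law M \<xi> = distr N borel X"
    "\<And>k. k \<in> borel_measurable borel \<Longrightarrow> quad M k \<xi> \<eta> = quad N k X Y"
proof -
  interpret N: prob_space N by fact
  define code where "code \<omega> = real (to_nat (I \<omega>, J \<omega>))" for \<omega>
  \<comment> \<open>\<open>floor\<close> makes the decoder total and measurable, and it recovers the
    pair exactly on the range of \<open>code\<close>.\<close>
  define f where "f z = real_of_int (fst (from_nat (nat \<lfloor>z\<rfloor>) :: int \<times> int)) / c" for z :: real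
  define g where "g z = real_of_int (snd (from_nat (nat \<lfloor>z\<rfloor>) :: int \<times> int)) / c" for z :: real
  have XYc: "X = (\<lambda>\<omega>. f (code \<omega>))" "Y = (\<lambda>\<omega>. g (code \<omega>))"
    by (auto simp: XY code_def f_def g_def)
  have c [measurable]: "code \<in> borel_measurable N"
    unfolding code_def[abs_def]
  proof (rule measurable_compose_countable[of "\<lambda>i \<omega>. real (to_nat (i, J \<omega>))"])
    show "(\<lambda>\<omega>. real (to_nat (i, J \<omega>))) \<in> borel_measurable N" for i
      by (rule measurable_compose[of J N "count_space UNIV"]) auto
  qed simp
  have fl: "(\<lambda>z::real. nat \<lfloor>z\<rfloor>) \<in> measurable borel (count_space UNIV)" by measurable
  have f [measurable]: "f \<in> borel_measurable borel" and g [measurable]: "g \<in> borel_measurable borel"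
    unfolding f_def[abs_def] g_def[abs_def] by (rule measurable_compose[OF fl]; simp)+
  obtain Z where Z: "Z \<in> borel_measurable (F 0)" "distr M borel Z = distr N borel code"
    using rich_F_0[of "distr N borel code"] N.real_distribution_distr[OF c] by auto
  have ZT: "Z \<in> borel_measurable (F T)" by (rule measurable_F0_FT[OF Z(1)])
  have ZM [measurable]: "Z \<in> borel_measurable M" by (rule measurable_from_subalg[OF subalgebra_FT ZT])
  have sq': "integrable M (\<lambda>\<omega>. (h (Z \<omega>))\<^sup>2)"
    if "integrable N (\<lambda>\<omega>. (h (code \<omega>))\<^sup>2)" and h [measurable]: "h \<in> borel_measurable borel" for h :: "real \<Rightarrow> real"
  proof -
    have h2: "(\<lambda>z. (h z)\<^sup>2) \<in> borel_measurable borel" by measurable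
    have "integrable (distr N borel code) (\<lambda>z. (h z)\<^sup>2)"
      using that(1) integrable_distr_eq[OF c h2] by simp
    then show ?thesis
      unfolding Z(2)[symmetric] using integrable_distr_eq[OF ZM h2] by simp
  qed
  show ?thesis
  proof (rule that)
    show "(\<lambda>\<omega>. f (Z \<omega>)) \<in> L2T" "(\<lambda>\<omega>. g (Z \<omega>)) \<in> L2T"
      using sq sq'[OF _ f] sq'[OF _ g] measurable_compose[OF ZT f] measurable_compose[OF ZT g]
      unfolding L2_def XYc by auto
    have "distr M borel (\<lambda>\<omega>. f (Z \<omega>)) = distr (distr M borel Z) borel f"
      by (subst distr_distr) (auto simp: comp_def)
    also have "\<dots> = distr N borel X"
      unfolding Z(2) by (subst distr_distr) (auto simp: comp_def XYc)
    finally show "law M (\<lambda>\<omega>. f (Z \<omega>)) = distr N borel X" unfolding law_def .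
    show "quad M k (\<lambda>\<omega>. f (Z \<omega>)) (\<lambda>\<omega>. g (Z \<omega>)) = quad N k X Y" if "k \<in> borel_measurable borel" for k
      unfolding XYc quad_comp[OF ZM f g that] N.quad_comp[OF c f g that] Z(2) ..
  qed
qed

text \<open>The differential condition only involves the joint law of \<open>(\<xi>, \<eta>)\<close>. A discrete law is
  encoded into a single real random variable, which \<open>F 0\<close> supports.\<close>

lemma diff_monotone_prob_space:
  assumes dm: diff_monotone and N: "prob_space N"
    and X [measurable]: "X \<in> borel_measurable N" and X2: "integrable N (\<lambda>\<omega>. (X \<omega>)\<^sup>2)"
    and Y [measurable]: "Y \<in> borel_measurable N" and Y2: "integrable N (\<lambda>\<omega>. (Y \<omega>)\<^sup>2)"
  shows "0 \<le> quad N (ker (distr N borel X)) X Y"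
proof -
  interpret N: prob_space N by fact
  \<comment> \<open>Rounding down to the grid of mesh \<open>1 / (n + 1)\<close>. The uniform error
    gives both the pointwise and the mean-square limit that \<open>quad_ker_tendsto\<close> asks
    for.\<close>
  define r where "r n x = real_of_int \<lfloor>real (Suc n) * x\<rfloor> / real (Suc n)" for n x
  have r: "\<bar>r n x - x\<bar> \<le> 1 / real (Suc n)" for n x
  proof -
    have "\<bar>real (Suc n) * (r n x - x)\<bar> \<le> 1"
      unfolding r_def right_diff_distrib by simp linarith
    then have "\<bar>r n x - x\<bar> * real (Suc n) \<le> 1"
      by (simp only: abs_mult abs_of_nat mult.commute)
    then show ?thesis by (simp only: pos_le_divide_eq of_nat_0_less_iff zero_less_Suc)
  qed
  have r1: "\<bar>r n x\<bar> \<le> \<bar>x\<bar> + 1" for n x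
  proof -
    have "1 / real (Suc n) \<le> 1" by simp
    then show ?thesis using r[of n x] by linarith
  qed
  have inv0: "(\<lambda>n. 1 / real (Suc n)) \<longlonglongrightarrow> 0" by (rule LIMSEQ_Suc[OF lim_1_over_n])
  have rlim: "(\<lambda>n. r n x) \<longlonglongrightarrow> x" for x
    by (rule LIM_zero_cancel, rule tendsto_rabs_zero_cancel,
        rule tendsto_sandwich[OF _ _ tendsto_const inv0]) (use r in auto)
  have rm [measurable]: "r n \<in> borel_measurable borel" for n
    unfolding r_def[abs_def] by measurable
  have r2: "integrable N (\<lambda>\<omega>. (r n (Z \<omega>))\<^sup>2)"
    if [measurable]: "Z \<in> borel_measurable N" and Z: "integrable N (\<lambda>\<omega>. (Z \<omega>)\<^sup>2)" for Z n
  proof (rule Bochner_Integration.integrable_bound)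
    show "integrable N (\<lambda>\<omega>. 2 * (Z \<omega>)\<^sup>2 + 2)" using Z by simp
    show "(\<lambda>\<omega>. (r n (Z \<omega>))\<^sup>2) \<in> borel_measurable N" by measurable
    have "(r n x)\<^sup>2 \<le> 2 * x\<^sup>2 + 2" for x
    proof -
      have "(r n x)\<^sup>2 \<le> (\<bar>x\<bar> + 1)\<^sup>2" using power_mono[OF r1[of n x], of 2] by simp
      also have "\<dots> \<le> 2 * x\<^sup>2 + 2"
        using zero_le_power2[of "\<bar>x\<bar> - 1"] by (simp add: power2_eq_square algebra_simps)
      finally show ?thesis .
    qed
    then show "AE \<omega> in N. norm ((r n (Z \<omega>))\<^sup>2) \<le> norm (2 * (Z \<omega>)\<^sup>2 + 2)" by auto
  qed
  have "0 \<le> quad N (ker (distr N borel (\<lambda>\<omega>. r n (X \<omega>)))) (\<lambda>\<omega>. r n (X \<omega>)) (\<lambda>\<omega>. r n (Y \<omega>))" for n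
  proof -
    obtain \<xi> \<eta> where *: "\<xi> \<in> L2T" "\<eta> \<in> L2T" "law M \<xi> = distr N borel (\<lambda>\<omega>. r n (X \<omega>))"
      "\<And>k. k \<in> borel_measurable borel \<Longrightarrow> quad M k \<xi> \<eta> = quad N k (\<lambda>\<omega>. r n (X \<omega>)) (\<lambda>\<omega>. r n (Y \<omega>))"
    proof (rule discrete_pair_realized[OF N])
      show "(\<lambda>\<omega>. \<lfloor>real (Suc n) * X \<omega>\<rfloor>) \<in> measurable N (count_space UNIV)"
        "(\<lambda>\<omega>. \<lfloor>real (Suc n) * Y \<omega>\<rfloor>) \<in> measurable N (count_space UNIV)"
        by measurable
    qed (use r2[OF X X2] r2[OF Y Y2] in \<open>auto simp: r_def\<close>)
    have "0 \<le> quad M (ker (law M \<xi>)) \<xi> \<eta>"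
      using dm *(1,2) by (simp add: diff_monotone_def)
    also have "\<dots> = quad N (ker (law M \<xi>)) (\<lambda>\<omega>. r n (X \<omega>)) (\<lambda>\<omega>. r n (Y \<omega>))"
      by (rule *(4)[OF ker_measurable[OF law_in_P2[OF *(1)]]])
    finally show ?thesis unfolding *(3) .
  qed
  moreover have "(\<lambda>n. quad N (ker (distr N borel (\<lambda>\<omega>. r n (X \<omega>)))) (\<lambda>\<omega>. r n (X \<omega>)) (\<lambda>\<omega>. r n (Y \<omega>)))
      \<longlonglongrightarrow> quad N (ker (distr N borel X)) X Y"
  proof (rule quad_ker_tendsto[OF N])
    show "(\<lambda>n. \<integral>\<omega>. (r n (X \<omega>) - X \<omega>)\<^sup>2 \<partial>N) \<longlonglongrightarrow> 0"
    proof (rule tendsto_sandwich[OF _ _ tendsto_const])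
      have b: "(r n x - x)\<^sup>2 \<le> (1 / real (Suc n))\<^sup>2" for n x
        using power_mono[OF r[of n x], of 2] by simp
      have "(\<integral>\<omega>. (r n (X \<omega>) - X \<omega>)\<^sup>2 \<partial>N) \<le> (\<integral>\<omega>. (1 / real (Suc n))\<^sup>2 \<partial>N)" for n
        by (rule integral_mono') (use b in auto)
      then show "\<forall>\<^sub>F n in sequentially. (\<integral>\<omega>. (r n (X \<omega>) - X \<omega>)\<^sup>2 \<partial>N) \<le> (1 / real (Suc n))\<^sup>2"
        by (simp add: N.prob_space)
      show "(\<lambda>n. (1 / real (Suc n))\<^sup>2) \<longlonglongrightarrow> 0"
        using tendsto_power[OF inv0, of 2] by simp
    qed simp
    show "integrable N (\<lambda>\<omega>. \<bar>Y \<omega>\<bar> + 1)"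
      using N.integrable_of_square[OF Y Y2] by simp
  qed (use r2[OF X X2] X2 in \<open>auto intro: r1 rlim\<close>)
  ultimately show ?thesis by (intro LIMSEQ_le_const) auto
qed

end

section \<open>The second-order condition\<close>

lemma inner_matrix_vector_2:
  "(vector [a, b] :: real^2) \<bullet> ((vector [vector [p, q], vector [r, s]] :: real^2^2) *v vector [c, d])
    = a * (p * c + q * d) + b * (r * c + s * d)"
  by (simp add: inner_vec_def matrix_vector_mult_def sum_2 vector_2)

section \<open>The quadratic form for variables that depend on a fair coin\<close>

context prob_space
begin

lemma distr_coin_fst:
  assumes [measurable]: "X \<in> borel_measurable M"
  shows "distr (coin s) borel (\<lambda>p. X (fst p)) = distr M borel X"
proof -
  have "distr (coin s) M fst = M"
    by (rule prob_space.distr_pair_fst[OF measure_pmf.prob_space_axioms])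
  then have "distr M borel X = distr (distr (coin s) M fst) borel X" by simp
  also have "\<dots> = distr (coin s) borel (\<lambda>p. X (fst p))"
    by (subst distr_distr) (auto simp: comp_def)
  finally show ?thesis ..
qed

text \<open>Two independent fair tosses have four outcomes of probability 1/4, which the factor 2 in
  each of the two weights cancels.\<close>

lemma quad_coin_half:
  assumes k [measurable]: "k \<in> borel_measurable borel" and kb: "\<And>p. \<bar>k p\<bar> \<le> C"
    and [measurable]: "X \<in> borel_measurable M" "X' \<in> borel_measurable M"
    and a: "integrable M a" and a': "integrable M a'"
  shows "quad (coin (1/2)) k (\<lambda>p. if snd p then X' (fst p) else X (fst p))
      (\<lambda>p. if snd p then 2 * a' (fst p) else 2 * a (fst p))
    = (\<integral>p. k (X' (fst p), X' (snd p)) * a' (fst p) * a' (snd p)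
        + k (X' (fst p), X (snd p)) * a' (fst p) * a (snd p)
        + k (X (fst p), X' (snd p)) * a (fst p) * a' (snd p)
        + k (X (fst p), X (snd p)) * a (fst p) * a (snd p) \<partial>(M \<Otimes>\<^sub>M M))"
proof -
  let ?N = "coin (1/2)"
  let ?Z = "\<lambda>p. if snd p then X' (fst p) else X (fst p)"
  let ?Y = "\<lambda>p. if snd p then 2 * a' (fst p) else 2 * a (fst p)"
  interpret N: prob_space ?N by (rule prob_space_coin)
  interpret PN: pair_prob_space ?N ?N by (rule N.pair_prob_space_self)
  interpret P: pair_prob_space M M by (rule pair_prob_space_self)
  note [measurable] = borel_measurable_integrable[OF a] borel_measurable_integrable[OF a']
  have [measurable]: "k \<in> borel_measurable (borel \<Otimes>\<^sub>M borel)"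
    using k by (simp add: borel_prod)
  have Zm [measurable]: "?Z \<in> borel_measurable ?N" by (rule measurable_coin) auto
  have Y: "integrable ?N ?Y" by (rule integrable_coin) (use a a' in auto)
  have one: "integrable M (\<lambda>\<omega>. k (f \<omega>, g \<omega>) * b \<omega>)"
    if [measurable]: "f \<in> borel_measurable M" "g \<in> borel_measurable M" and b: "integrable M b" for f g b
  proof (rule Bochner_Integration.integrable_bound)
    note [measurable] = borel_measurable_integrable[OF b]
    show "integrable M (\<lambda>\<omega>. C * \<bar>b \<omega>\<bar>)" using b by simp
    show "(\<lambda>\<omega>. k (f \<omega>, g \<omega>) * b \<omega>) \<in> borel_measurable M" by measurable
    have "norm (k (f \<omega>, g \<omega>) * b \<omega>) \<le> norm (C * \<bar>b \<omega>\<bar>)" for \<omega>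
    proof -
      have "\<bar>k (f \<omega>, g \<omega>)\<bar> * \<bar>b \<omega>\<bar> \<le> \<bar>C\<bar> * \<bar>b \<omega>\<bar>"
        using kb[of "(f \<omega>, g \<omega>)"] by (intro mult_right_mono) auto
      then show ?thesis by (simp add: abs_mult)
    qed
    then show "AE \<omega> in M. norm (k (f \<omega>, g \<omega>) * b \<omega>) \<le> norm (C * \<bar>b \<omega>\<bar>)" by simp
  qed
  \<comment> \<open>The contribution of the second copy, with both outcomes of its toss summed, when
    the first argument of the kernel is \<open>x\<close>. Fubini on the coin spaces leads to
    \<open>J\<close>, and Fubini on \<open>M\<close> leads back to integrals over two
    copies.\<close>
  define J where "J x = (\<integral>\<omega>. k (x, X' \<omega>) * a' \<omega> + k (x, X \<omega>) * a \<omega> \<partial>M)" for x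
  have Jm [measurable]: "J \<in> borel_measurable borel"
    unfolding J_def[abs_def] by measurable
  have half: "(\<integral>q. f q \<partial>?N) = (\<integral>\<omega>. g' \<omega> \<partial>M) + (\<integral>\<omega>. g \<omega> \<partial>M)"
    if "integrable M g" "integrable M g'"
      and f: "\<And>\<omega>. f (\<omega>, True) = 2 * g' \<omega>" "\<And>\<omega>. f (\<omega>, False) = 2 * g \<omega>"
    for f :: "'a \<times> bool \<Rightarrow> real" and g g'
    using integral_coin[of "1/2" f] that(1,2) unfolding f by simp
  have inner: "(\<integral>q. k (x, ?Z q) * y * ?Y q \<partial>?N) = J x * y" for x y
  proof -
    have "(\<integral>q. k (x, ?Z q) * y * ?Y q \<partial>?N)
      = (\<integral>\<omega>. y * (k (x, X' \<omega>) * a' \<omega>) \<partial>M) + (\<integral>\<omega>. y * (k (x, X \<omega>) * a \<omega>) \<partial>M)"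
      by (rule half; (intro integrable_mult_right one a a')?) auto
    also have "\<dots> = J x * y"
      unfolding J_def using one[of "\<lambda>_. x" X a] one[of "\<lambda>_. x" X' a'] a a'
      by (simp add: algebra_simps)
    finally show ?thesis .
  qed
  have iN: "integrable (?N \<Otimes>\<^sub>M ?N) (\<lambda>p. k (?Z (fst p), ?Z (snd p)) * ?Y (fst p) * ?Y (snd p))"
    by (rule N.integrable_pair_kernel[OF Y Y _ kb]) measurable
  have JY: "integrable ?N (\<lambda>p. J (?Z p) * ?Y p)"
    using PN.integrable_fst'[OF iN] unfolding fst_conv snd_conv inner .
  have ker_i: "integrable (M \<Otimes>\<^sub>M M) (\<lambda>p. k (f (fst p), g (snd p)) * b (fst p) * c (snd p))"
    if [measurable]: "f \<in> borel_measurable M" "g \<in> borel_measurable M"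
      and b: "integrable M b" and c: "integrable M c" for f g b c
    by (rule integrable_pair_kernel[OF b c _ kb]) measurable
  have J_i: "integrable M (\<lambda>\<omega>. J (f \<omega>) * b \<omega>)"
    and J_int: "(\<integral>\<omega>. J (f \<omega>) * b \<omega> \<partial>M) = (\<integral>p. k (f (fst p), X' (snd p)) * b (fst p) * a' (snd p)
        + k (f (fst p), X (snd p)) * b (fst p) * a (snd p) \<partial>(M \<Otimes>\<^sub>M M))"
    if f [measurable]: "f \<in> borel_measurable M" and b: "integrable M b" for f b
  proof -
    have i: "integrable (M \<Otimes>\<^sub>M M) (\<lambda>p. k (f (fst p), X' (snd p)) * b (fst p) * a' (snd p)
        + k (f (fst p), X (snd p)) * b (fst p) * a (snd p))"
      by (intro Bochner_Integration.integrable_add ker_i b a a') measurable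
    have eq: "(\<integral>\<omega>'. k (f \<omega>, X' \<omega>') * b \<omega> * a' \<omega>' + k (f \<omega>, X \<omega>') * b \<omega> * a \<omega>' \<partial>M) = J (f \<omega>) * b \<omega>" for \<omega>
    proof -
      have "(\<lambda>\<omega>'. k (f \<omega>, X' \<omega>') * b \<omega> * a' \<omega>' + k (f \<omega>, X \<omega>') * b \<omega> * a \<omega>')
        = (\<lambda>\<omega>'. (k (f \<omega>, X' \<omega>') * a' \<omega>' + k (f \<omega>, X \<omega>') * a \<omega>') * b \<omega>)"
        by (simp add: fun_eq_iff algebra_simps)
      then show ?thesis unfolding J_def by simp
    qed
    show "integrable M (\<lambda>\<omega>. J (f \<omega>) * b \<omega>)"
      using P.integrable_fst'[OF i] unfolding fst_conv snd_conv eq .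
    show "(\<integral>\<omega>. J (f \<omega>) * b \<omega> \<partial>M) = (\<integral>p. k (f (fst p), X' (snd p)) * b (fst p) * a' (snd p)
        + k (f (fst p), X (snd p)) * b (fst p) * a (snd p) \<partial>(M \<Otimes>\<^sub>M M))"
      using P.integral_fst'[OF i] unfolding fst_conv snd_conv eq .
  qed
  have "quad ?N k ?Z ?Y = (\<integral>p. J (?Z p) * ?Y p \<partial>?N)"
    unfolding quad_def using PN.integral_fst'[OF iN] unfolding fst_conv snd_conv inner by simp
  also have "\<dots> = (\<integral>\<omega>. J (X' \<omega>) * a' \<omega> \<partial>M) + (\<integral>\<omega>. J (X \<omega>) * a \<omega> \<partial>M)"
    by (rule half; (intro J_i a a')?) auto
  also have "\<dots> = (\<integral>p. k (X' (fst p), X' (snd p)) * a' (fst p) * a' (snd p)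
        + k (X' (fst p), X (snd p)) * a' (fst p) * a (snd p) \<partial>(M \<Otimes>\<^sub>M M))
      + (\<integral>p. k (X (fst p), X' (snd p)) * a (fst p) * a' (snd p)
        + k (X (fst p), X (snd p)) * a (fst p) * a (snd p) \<partial>(M \<Otimes>\<^sub>M M))"
    by (simp only: J_int[OF _ a] J_int[OF _ a'] assms)
  also have "\<dots> = (\<integral>p. k (X' (fst p), X' (snd p)) * a' (fst p) * a' (snd p)
        + k (X' (fst p), X (snd p)) * a' (fst p) * a (snd p)
        + k (X (fst p), X' (snd p)) * a (fst p) * a' (snd p)
        + k (X (fst p), X (snd p)) * a (fst p) * a (snd p) \<partial>(M \<Otimes>\<^sub>M M))"
    by (subst Bochner_Integration.integral_add[symmetric])
      (auto intro!: Bochner_Integration.integrable_add ker_i a a' simp: add.assoc)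
  finally show ?thesis .
qed

end

section \<open>The second-order integrand and difference quotients of the kernel\<close>

context smooth_functional
begin

lemma second_order_integrand:
  assumes "\<mu> \<in> P2"
  shows "(vector [a, b] :: real^2) \<bullet> (DD\<mu> M (F T) U x \<mu> y *v vector [c, d])
    = Dx 1 V x (\<mu>, y) * a * c + Dx 1 (Dy V) x (\<mu>, y) * a * d
      + Dx 2 V x (\<mu>, y) * b * c + Dx 2 (Dy V) x (\<mu>, y) * b * d"
  unfolding DD\<mu>_def inner_matrix_vector_2 using assms
  by (simp add: Dy_Dx_V_eq algebra_simps)

lemma diff_monotone_if_second_order:
  assumes so: "second_order_lasry_lions_monotone M (F T) U"
  shows diff_monotone
  unfolding diff_monotone_def
proof (intro ballI)
  fix \<xi> \<eta> assume \<xi>: "\<xi> \<in> L2T" and \<eta>: "\<eta> \<in> L2T"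
  have zero: "(\<lambda>_. 0) \<in> L2T" by (simp add: L2_def)
  have "0 \<le> (\<integral>(\<omega>, \<omega>'). (vector [\<eta> \<omega>, 0] :: real^2) \<bullet>
      (DD\<mu> M (F T) U (\<xi> \<omega>) (law M \<xi>) (\<xi> \<omega>') *v vector [\<eta> \<omega>', 0]) \<partial>(M \<Otimes>\<^sub>M M))"
    by (rule so[unfolded second_order_lasry_lions_monotone_def, rule_format, OF \<xi> \<eta> zero])
  also have "\<dots> = quad M (ker (law M \<xi>)) \<xi> \<eta>"
    unfolding quad_def ker_def second_order_integrand[OF law_in_P2[OF \<xi>]]
    by (simp add: case_prod_beta')
  finally show "0 \<le> quad M (ker (law M \<xi>)) \<xi> \<eta>" .
qed

lemma ker_shift_x:
  assumes "\<mu> \<in> P2"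
  shows "\<exists>t. 0 \<le> t \<and> t \<le> 1 \<and> ker \<mu> (x + h, y) - ker \<mu> (x, y) = h * Dx 2 V (x + t * h) (\<mu>, y)"
proof -
  have "((\<lambda>z. Dx 1 V z (\<mu>, y)) has_real_derivative Dx 2 V x (\<mu>, y)) (at x)" for x
    using V_deriv[OF assms, of 1 y x] by (simp add: numeral_2_eq_2)
  from DERIV_mvt_exists[OF this, of x h] show ?thesis unfolding ker_def by auto
qed

lemma ker_shift_y:
  assumes "\<mu> \<in> P2"
  shows "\<exists>t. 0 \<le> t \<and> t \<le> 1 \<and> ker \<mu> (x, y + h) - ker \<mu> (x, y) = h * Dx 1 (Dy V) x (\<mu>, y + t * h)"
proof -
  have "((\<lambda>w. Dx 1 V x (\<mu>, w)) has_real_derivative Dx 1 (Dy V) x (\<mu>, y)) (at y)" for y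
    by (rule Dy_Dx_V[OF assms]) simp
  from DERIV_mvt_exists[OF this, of y h] show ?thesis unfolding ker_def by auto
qed

text \<open>One mean value theorem per variable expresses the double difference exactly by the mixed
  derivative at a single intermediate point; no remainder is left that would have to survive
  division by \<open>h^2\<close>.\<close>

lemma ker_shift_xy:
  assumes \<mu>: "\<mu> \<in> P2"
  shows "\<exists>t u. 0 \<le> t \<and> t \<le> 1 \<and> 0 \<le> u \<and> u \<le> 1 \<and>
    ker \<mu> (x + h, y + h) - ker \<mu> (x + h, y) - ker \<mu> (x, y + h) + ker \<mu> (x, y)
      = h\<^sup>2 * Dx 2 (Dy V) (x + t * h) (\<mu>, y + u * h)"
proof -
  have D1: "((\<lambda>z. Dx 1 V z (\<mu>, y + h) - Dx 1 V z (\<mu>, y)) has_real_derivative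
      Dx 2 V x (\<mu>, y + h) - Dx 2 V x (\<mu>, y)) (at x)" for x
    using V_deriv[OF \<mu>, of 1 y x] V_deriv[OF \<mu>, of 1 "y + h" x]
    by (auto simp: numeral_2_eq_2 intro!: DERIV_diff)
  obtain t where t: "0 \<le> t" "t \<le> 1" "Dx 1 V (x + h) (\<mu>, y + h) - Dx 1 V (x + h) (\<mu>, y)
      - (Dx 1 V x (\<mu>, y + h) - Dx 1 V x (\<mu>, y)) = h * (Dx 2 V (x + t * h) (\<mu>, y + h) - Dx 2 V (x + t * h) (\<mu>, y))"
    by (rule DERIV_mvt_exists[OF D1])
  have D2: "((\<lambda>w. Dx 2 V (x + t * h) (\<mu>, w)) has_real_derivative Dx 2 (Dy V) (x + t * h) (\<mu>, y)) (at y)" for y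
    by (rule Dy_Dx_V[OF \<mu>]) simp
  obtain u where u: "0 \<le> u" "u \<le> 1" "Dx 2 V (x + t * h) (\<mu>, y + h) - Dx 2 V (x + t * h) (\<mu>, y)
      = h * Dx 2 (Dy V) (x + t * h) (\<mu>, y + u * h)"
    by (rule DERIV_mvt_exists[OF D2])
  show ?thesis
    using t u by (intro exI[of _ t] exI[of _ u]) (simp add: ker_def power2_eq_square algebra_simps)
qed

context
  fixes \<mu> \<nu> h w
  assumes \<mu>: "\<mu> \<in> P2" and \<nu>: "\<And>n::nat. \<nu> n \<in> P2"
    and W: "\<And>n. W2 (\<nu> n) \<mu> \<le> w n" "w \<longlonglongrightarrow> 0"
    and h: "\<And>n. h n \<noteq> 0" "h \<longlonglongrightarrow> (0::real)"
begin

text \<open>The measure moves with \<open>n\<close> too, since the perturbed variable has its own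
  law. Written as a derivative at an intermediate point, the quotient is bounded uniformly in
  \<open>n\<close>, as dominated convergence requires, and joint continuity handles both motions at
  once.\<close>

lemma ker_quotient_x:
  "\<bar>(ker (\<nu> n) (x + h n, y) - ker (\<nu> n) (x, y)) / h n\<bar> \<le> bound_const"
  "(\<lambda>n. (ker (\<nu> n) (x + h n, y) - ker (\<nu> n) (x, y)) / h n) \<longlonglongrightarrow> Dx 2 V x (\<mu>, y)"
proof -
  obtain t where t: "\<forall>n. 0 \<le> t n \<and> t n \<le> 1 \<and>
      ker (\<nu> n) (x + h n, y) - ker (\<nu> n) (x, y) = h n * Dx 2 V (x + t n * h n) (\<nu> n, y)"
    using choice[OF allI[OF ker_shift_x[OF \<nu>, where x = x and y = y and h = "h _"]]] by (rule exE)
  have eq: "(ker (\<nu> n) (x + h n, y) - ker (\<nu> n) (x, y)) / h n = Dx 2 V (x + t n * h n) (\<nu> n, y)" for n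
    using t h(1)[of n] by simp
  show "\<bar>(ker (\<nu> n) (x + h n, y) - ker (\<nu> n) (x, y)) / h n\<bar> \<le> bound_const"
    unfolding eq by (rule bounded(2)[OF \<nu>]) simp
  show "(\<lambda>n. (ker (\<nu> n) (x + h n, y) - ker (\<nu> n) (x, y)) / h n) \<longlonglongrightarrow> Dx 2 V x (\<mu>, y)"
    unfolding eq by (rule V_tendsto[OF _ \<mu> \<nu> tendsto_shift[OF h(2)] tendsto_const W]) (use t in auto)
qed

lemma ker_quotient_y:
  "\<bar>(ker (\<nu> n) (x, y + h n) - ker (\<nu> n) (x, y)) / h n\<bar> \<le> bound_const"
  "(\<lambda>n. (ker (\<nu> n) (x, y + h n) - ker (\<nu> n) (x, y)) / h n) \<longlonglongrightarrow> Dx 1 (Dy V) x (\<mu>, y)"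
proof -
  obtain t where t: "\<forall>n. 0 \<le> t n \<and> t n \<le> 1 \<and>
      ker (\<nu> n) (x, y + h n) - ker (\<nu> n) (x, y) = h n * Dx 1 (Dy V) x (\<nu> n, y + t n * h n)"
    using choice[OF allI[OF ker_shift_y[OF \<nu>, where x = x and y = y and h = "h _"]]] by (rule exE)
  have eq: "(ker (\<nu> n) (x, y + h n) - ker (\<nu> n) (x, y)) / h n = Dx 1 (Dy V) x (\<nu> n, y + t n * h n)" for n
    using t h(1)[of n] by simp
  show "\<bar>(ker (\<nu> n) (x, y + h n) - ker (\<nu> n) (x, y)) / h n\<bar> \<le> bound_const"
    unfolding eq by (rule bounded(3)[OF \<nu>]) simp
  show "(\<lambda>n. (ker (\<nu> n) (x, y + h n) - ker (\<nu> n) (x, y)) / h n) \<longlonglongrightarrow> Dx 1 (Dy V) x (\<mu>, y)"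
    unfolding eq by (rule DyV_tendsto[OF _ \<mu> \<nu> tendsto_const tendsto_shift[OF h(2)] W]) (use t in auto)
qed

lemma ker_quotient_xy:
  "\<bar>(ker (\<nu> n) (x + h n, y + h n) - ker (\<nu> n) (x + h n, y) - ker (\<nu> n) (x, y + h n) + ker (\<nu> n) (x, y)) / (h n)\<^sup>2\<bar>
    \<le> bound_const"
  "(\<lambda>n. (ker (\<nu> n) (x + h n, y + h n) - ker (\<nu> n) (x + h n, y) - ker (\<nu> n) (x, y + h n) + ker (\<nu> n) (x, y)) / (h n)\<^sup>2)
    \<longlonglongrightarrow> Dx 2 (Dy V) x (\<mu>, y)"
proof -
  let ?d = "\<lambda>n. ker (\<nu> n) (x + h n, y + h n) - ker (\<nu> n) (x + h n, y) - ker (\<nu> n) (x, y + h n) + ker (\<nu> n) (x, y)"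
  obtain t where "\<forall>n. \<exists>u. 0 \<le> t n \<and> t n \<le> 1 \<and> 0 \<le> u \<and> u \<le> 1 \<and>
      ?d n = (h n)\<^sup>2 * Dx 2 (Dy V) (x + t n * h n) (\<nu> n, y + u * h n)"
    using choice[OF allI[OF ker_shift_xy[OF \<nu>, where x = x and y = y and h = "h _"]]] by (rule exE)
  from choice[OF this] obtain u where tu: "\<forall>n. 0 \<le> t n \<and> t n \<le> 1 \<and> 0 \<le> u n \<and> u n \<le> 1 \<and>
      ?d n = (h n)\<^sup>2 * Dx 2 (Dy V) (x + t n * h n) (\<nu> n, y + u n * h n)"
    by (rule exE)
  have eq: "?d n / (h n)\<^sup>2 = Dx 2 (Dy V) (x + t n * h n) (\<nu> n, y + u n * h n)" for n
    using tu h(1)[of n] by simp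
  show "\<bar>?d n / (h n)\<^sup>2\<bar> \<le> bound_const"
    unfolding eq by (rule bounded(3)[OF \<nu>]) simp
  show "(\<lambda>n. ?d n / (h n)\<^sup>2) \<longlonglongrightarrow> Dx 2 (Dy V) x (\<mu>, y)"
    unfolding eq
    by (rule DyV_tendsto[OF _ \<mu> \<nu> tendsto_shift[OF h(2)] tendsto_shift[OF h(2)] W]) (use tu in auto)
qed

end

text \<open>The functional \<open>\<phi> \<mapsto> E[\<phi>(\<xi>) \<eta>\<^sub>1 + \<phi>'(\<xi>) \<eta>\<^sub>2]\<close> is the limit as \<open>h \<rightarrow> 0\<close> of
  \<open>\<phi> \<mapsto> E[\<phi>(\<xi>\<^sub>h) \<eta>\<^sub>h]\<close>, where an independent fair coin decides between
  \<open>(\<xi>\<^sub>h, \<eta>\<^sub>h) = (\<xi>, 2 (\<eta>\<^sub>1 - \<eta>\<^sub>2 / h))\<close> and \<open>(\<xi> + h, 2 \<eta>\<^sub>2 / h)\<close>.\<close>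

lemma second_order_if_diff_monotone:
  assumes dm: diff_monotone
  shows "second_order_lasry_lions_monotone M (F T) U"
  unfolding second_order_lasry_lions_monotone_def
proof (intro ballI)
  fix \<xi> \<eta>\<^sub>1 \<eta>\<^sub>2 assume \<xi>: "\<xi> \<in> L2T" and \<eta>\<^sub>1: "\<eta>\<^sub>1 \<in> L2T" and \<eta>\<^sub>2: "\<eta>\<^sub>2 \<in> L2T"
  note [measurable] = L2T_measurable[OF \<xi>] L2T_measurable[OF \<eta>\<^sub>1] L2T_measurable[OF \<eta>\<^sub>2]
  have i1: "integrable M \<eta>\<^sub>1" and i2: "integrable M \<eta>\<^sub>2"
    by (intro L2T_integrable \<eta>\<^sub>1 \<eta>\<^sub>2)+
  let ?N = "coin (1/2)"
  interpret N: prob_space ?N by (rule prob_space_coin)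
  define \<mu> where "\<mu> = law M \<xi>"
  have \<mu>: "\<mu> \<in> P2" unfolding \<mu>_def by (rule law_in_P2[OF \<xi>])
  define h where "h n = 1 / real (Suc n)" for n
  have h0: "h n \<noteq> 0" for n by (simp add: h_def)
  have h: "h \<longlonglongrightarrow> 0" unfolding h_def[abs_def] by (rule LIMSEQ_Suc[OF lim_1_over_n])
  define X where "X n p = (if snd p then \<xi> (fst p) + h n else \<xi> (fst p))" for n and p :: "'a \<times> bool"
  define Y where "Y n p = (if snd p then 2 * (\<eta>\<^sub>2 (fst p) / h n) else 2 * (\<eta>\<^sub>1 (fst p) - \<eta>\<^sub>2 (fst p) / h n))"
    for n and p :: "'a \<times> bool"
  have const: "(\<lambda>_. c) \<in> L2T" for c by (simp add: L2_def)
  have \<xi>h: "(\<lambda>\<omega>. \<xi> \<omega> + h n) \<in> L2T" for n by (rule L2T_add[OF \<xi> const])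
  have \<eta>2h: "(\<lambda>\<omega>. \<eta>\<^sub>2 \<omega> / h n) \<in> L2T" for n using L2T_scale[OF \<eta>\<^sub>2, of "1 / h n"] by simp
  have \<eta>12: "(\<lambda>\<omega>. \<eta>\<^sub>1 \<omega> - \<eta>\<^sub>2 \<omega> / h n) \<in> L2T" for n
    using L2T_add[OF \<eta>\<^sub>1 L2T_scale[OF \<eta>\<^sub>2, of "- 1 / h n"]] by simp
  have Xm: "X n \<in> borel_measurable ?N" for n
    by (rule measurable_coin) (auto simp: X_def)
  have X2: "integrable ?N (\<lambda>p. (X n p)\<^sup>2)" for n
    by (rule integrable_coin)
      (use L2T_integrable_square[OF \<xi>h] L2T_integrable_square[OF \<xi>] in \<open>auto simp: X_def\<close>)
  have Ym: "Y n \<in> borel_measurable ?N" for n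
    by (rule measurable_coin) (auto simp: Y_def)
  have Y2: "integrable ?N (\<lambda>p. (Y n p)\<^sup>2)" for n
    by (rule integrable_coin)
      (use L2T_integrable_square[OF L2T_scale[OF \<eta>2h, of 2]]
        L2T_integrable_square[OF L2T_scale[OF \<eta>12, of 2]] in \<open>auto simp: Y_def\<close>)
  define \<nu> where "\<nu> n = distr ?N borel (X n)" for n
  have \<nu>: "\<nu> n \<in> P2" for n unfolding \<nu>_def by (intro N.distr_in_P2 Xm X2)
  \<comment> \<open>On the coin space \<open>\<xi>\<close> of the first component still has law
    \<open>\<mu>\<close> and is coupled with \<open>X n\<close>; the two differ by
    \<open>h n\<close> with probability 1/2.\<close>
  have W: "W2 (\<nu> n) \<mu> \<le> sqrt ((h n)\<^sup>2)" for n
  proof -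
    have fm: "(\<lambda>p. \<xi> (fst p)) \<in> borel_measurable ?N" by measurable
    have "W2 (\<nu> n) \<mu> \<le> sqrt (\<integral>p. (X n p - \<xi> (fst p))\<^sup>2 \<partial>?N)"
      unfolding \<nu>_def \<mu>_def law_def distr_coin_fst[OF L2T_measurable[OF \<xi>], of "1/2", symmetric]
      by (rule N.W2_distr_le[OF Xm fm])
    also have "(\<integral>p. (X n p - \<xi> (fst p))\<^sup>2 \<partial>?N) = 1/2 * (h n)\<^sup>2"
      by (subst integral_coin) (auto simp: X_def prob_space)
    also have "sqrt (1/2 * (h n)\<^sup>2) \<le> sqrt ((h n)\<^sup>2)"
      by (intro real_sqrt_le_mono) simp
    finally show ?thesis .
  qed
  have W0: "(\<lambda>n. sqrt ((h n)\<^sup>2)) \<longlonglongrightarrow> 0"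
    using tendsto_rabs_zero[OF h] by simp
  let ?k = "\<lambda>n. ker (\<nu> n)"
  \<comment> \<open>Once the four outcomes are expanded, these are the coefficients of the products
    of \<open>\<eta>\<^sub>1\<close>, \<open>\<eta>\<^sub>2\<close> of the first copy with those of
    the second. The singular factors \<open>1 / h n\<close> combine into difference quotients of the
    kernel in the second, the first and both arguments, whose limits are the entries of the
    matrix.\<close>
  let ?k1 = "\<lambda>n p. ?k n (\<xi> (fst p), \<xi> (snd p))"
  let ?k2 = "\<lambda>n p. (?k n (\<xi> (fst p), \<xi> (snd p) + h n) - ?k n (\<xi> (fst p), \<xi> (snd p))) / h n"
  let ?k3 = "\<lambda>n p. (?k n (\<xi> (fst p) + h n, \<xi> (snd p)) - ?k n (\<xi> (fst p), \<xi> (snd p))) / h n"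
  let ?k4 = "\<lambda>n p. (?k n (\<xi> (fst p) + h n, \<xi> (snd p) + h n) - ?k n (\<xi> (fst p) + h n, \<xi> (snd p))
      - ?k n (\<xi> (fst p), \<xi> (snd p) + h n) + ?k n (\<xi> (fst p), \<xi> (snd p))) / (h n)\<^sup>2"
  let ?l1 = "\<lambda>p. Dx 1 V (\<xi> (fst p)) (\<mu>, \<xi> (snd p))"
  let ?l2 = "\<lambda>p. Dx 1 (Dy V) (\<xi> (fst p)) (\<mu>, \<xi> (snd p))"
  let ?l3 = "\<lambda>p. Dx 2 V (\<xi> (fst p)) (\<mu>, \<xi> (snd p))"
  let ?l4 = "\<lambda>p. Dx 2 (Dy V) (\<xi> (fst p)) (\<mu>, \<xi> (snd p))"
  have b1: "\<bar>?k n p\<bar> \<le> bound_const" for n p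
    unfolding ker_def by (rule bounded(2)[OF \<nu>]) simp
  have km [measurable]: "?k n \<in> borel_measurable (borel \<Otimes>\<^sub>M borel)" for n
    using ker_measurable[OF \<nu>] by (simp add: borel_prod)
  have km': "?k n \<in> borel_measurable borel" for n
    by (rule ker_measurable[OF \<nu>])
  note quot = ker_quotient_x[OF \<mu> \<nu> W W0 h0 h] ker_quotient_y[OF \<mu> \<nu> W W0 h0 h]
    ker_quotient_xy[OF \<mu> \<nu> W W0 h0 h]
  have l_m: "?l1 \<in> borel_measurable (M \<Otimes>\<^sub>M M)" "?l3 \<in> borel_measurable (M \<Otimes>\<^sub>M M)"
    "?l2 \<in> borel_measurable (M \<Otimes>\<^sub>M M)" "?l4 \<in> borel_measurable (M \<Otimes>\<^sub>M M)"
    by (rule V_measurable_comp[OF _ \<mu>] DyV_measurable_comp[OF _ \<mu>]; simp)+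
  have l_b: "\<bar>?l1 p\<bar> \<le> bound_const" "\<bar>?l2 p\<bar> \<le> bound_const"
    "\<bar>?l3 p\<bar> \<le> bound_const" "\<bar>?l4 p\<bar> \<le> bound_const" for p
    by (rule bounded(2,3)[OF \<mu>]; simp)+
  have k_m: "?k1 n \<in> borel_measurable (M \<Otimes>\<^sub>M M)" "?k2 n \<in> borel_measurable (M \<Otimes>\<^sub>M M)"
    "?k3 n \<in> borel_measurable (M \<Otimes>\<^sub>M M)" "?k4 n \<in> borel_measurable (M \<Otimes>\<^sub>M M)" for n
    by measurable
  have lim1: "(\<lambda>n. ?k1 n p) \<longlonglongrightarrow> ?l1 p" for p
    unfolding ker_def fst_conv snd_conv by (rule V_tendsto[OF _ \<mu> \<nu> tendsto_const tendsto_const W W0]) simp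
  have int: "integrable (M \<Otimes>\<^sub>M M) (\<lambda>p. ?k1 n p * \<eta>\<^sub>1 (fst p) * \<eta>\<^sub>1 (snd p))"
     "integrable (M \<Otimes>\<^sub>M M) (\<lambda>p. ?k2 n p * \<eta>\<^sub>1 (fst p) * \<eta>\<^sub>2 (snd p))"
     "integrable (M \<Otimes>\<^sub>M M) (\<lambda>p. ?k3 n p * \<eta>\<^sub>2 (fst p) * \<eta>\<^sub>1 (snd p))"
     "integrable (M \<Otimes>\<^sub>M M) (\<lambda>p. ?k4 n p * \<eta>\<^sub>2 (fst p) * \<eta>\<^sub>2 (snd p))" for n
    by (rule integrable_pair_kernel; (rule i1 i2 k_m b1 quot))+
  have intl: "integrable (M \<Otimes>\<^sub>M M) (\<lambda>p. ?l1 p * \<eta>\<^sub>1 (fst p) * \<eta>\<^sub>1 (snd p))"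
     "integrable (M \<Otimes>\<^sub>M M) (\<lambda>p. ?l2 p * \<eta>\<^sub>1 (fst p) * \<eta>\<^sub>2 (snd p))"
     "integrable (M \<Otimes>\<^sub>M M) (\<lambda>p. ?l3 p * \<eta>\<^sub>2 (fst p) * \<eta>\<^sub>1 (snd p))"
     "integrable (M \<Otimes>\<^sub>M M) (\<lambda>p. ?l4 p * \<eta>\<^sub>2 (fst p) * \<eta>\<^sub>2 (snd p))"
    by (rule integrable_pair_kernel; (rule i1 i2 l_m l_b))+
  have t: "(\<lambda>n. \<integral>p. k n p * Z (fst p) * Z' (snd p) \<partial>(M \<Otimes>\<^sub>M M))
      \<longlonglongrightarrow> (\<integral>p. l p * Z (fst p) * Z' (snd p) \<partial>(M \<Otimes>\<^sub>M M))"
    if "\<And>n. k n \<in> borel_measurable (M \<Otimes>\<^sub>M M)" "l \<in> borel_measurable (M \<Otimes>\<^sub>M M)"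
      "\<And>n p. \<bar>k n p\<bar> \<le> bound_const" "\<And>p. (\<lambda>n. k n p) \<longlonglongrightarrow> l p"
      "integrable M Z" "integrable M Z'" for k l Z Z'
    by (rule integral_pair_kernel_tendsto[where G = "\<lambda>\<omega>. \<bar>Z \<omega>\<bar>" and H = "\<lambda>\<omega>. \<bar>Z' \<omega>\<bar>", OF that(1,2)])
      (use that in auto)
  have lim: "(\<lambda>n. (\<integral>p. ?k1 n p * \<eta>\<^sub>1 (fst p) * \<eta>\<^sub>1 (snd p) \<partial>(M \<Otimes>\<^sub>M M))
      + (\<integral>p. ?k2 n p * \<eta>\<^sub>1 (fst p) * \<eta>\<^sub>2 (snd p) \<partial>(M \<Otimes>\<^sub>M M))
      + (\<integral>p. ?k3 n p * \<eta>\<^sub>2 (fst p) * \<eta>\<^sub>1 (snd p) \<partial>(M \<Otimes>\<^sub>M M))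
      + (\<integral>p. ?k4 n p * \<eta>\<^sub>2 (fst p) * \<eta>\<^sub>2 (snd p) \<partial>(M \<Otimes>\<^sub>M M)))
    \<longlonglongrightarrow> (\<integral>p. ?l1 p * \<eta>\<^sub>1 (fst p) * \<eta>\<^sub>1 (snd p) \<partial>(M \<Otimes>\<^sub>M M))
      + (\<integral>p. ?l2 p * \<eta>\<^sub>1 (fst p) * \<eta>\<^sub>2 (snd p) \<partial>(M \<Otimes>\<^sub>M M))
      + (\<integral>p. ?l3 p * \<eta>\<^sub>2 (fst p) * \<eta>\<^sub>1 (snd p) \<partial>(M \<Otimes>\<^sub>M M))
      + (\<integral>p. ?l4 p * \<eta>\<^sub>2 (fst p) * \<eta>\<^sub>2 (snd p) \<partial>(M \<Otimes>\<^sub>M M))"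
    by (intro tendsto_add; rule t; (rule k_m l_m b1 lim1 quot i1 i2))
  have pos: "0 \<le> (\<integral>p. ?k1 n p * \<eta>\<^sub>1 (fst p) * \<eta>\<^sub>1 (snd p) \<partial>(M \<Otimes>\<^sub>M M))
      + (\<integral>p. ?k2 n p * \<eta>\<^sub>1 (fst p) * \<eta>\<^sub>2 (snd p) \<partial>(M \<Otimes>\<^sub>M M))
      + (\<integral>p. ?k3 n p * \<eta>\<^sub>2 (fst p) * \<eta>\<^sub>1 (snd p) \<partial>(M \<Otimes>\<^sub>M M))
      + (\<integral>p. ?k4 n p * \<eta>\<^sub>2 (fst p) * \<eta>\<^sub>2 (snd p) \<partial>(M \<Otimes>\<^sub>M M))" for n
  proof -
    have "0 \<le> quad ?N (?k n) (X n) (Y n)"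
      unfolding \<nu>_def by (rule diff_monotone_prob_space[OF dm prob_space_coin Xm X2 Ym Y2])
    also have "\<dots> = (\<integral>p. ?k n (\<xi> (fst p) + h n, \<xi> (snd p) + h n) * (\<eta>\<^sub>2 (fst p) / h n) * (\<eta>\<^sub>2 (snd p) / h n)
        + ?k n (\<xi> (fst p) + h n, \<xi> (snd p)) * (\<eta>\<^sub>2 (fst p) / h n) * (\<eta>\<^sub>1 (snd p) - \<eta>\<^sub>2 (snd p) / h n)
        + ?k n (\<xi> (fst p), \<xi> (snd p) + h n) * (\<eta>\<^sub>1 (fst p) - \<eta>\<^sub>2 (fst p) / h n) * (\<eta>\<^sub>2 (snd p) / h n)
        + ?k n (\<xi> (fst p), \<xi> (snd p)) * (\<eta>\<^sub>1 (fst p) - \<eta>\<^sub>2 (fst p) / h n) * (\<eta>\<^sub>1 (snd p) - \<eta>\<^sub>2 (snd p) / h n)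
        \<partial>(M \<Otimes>\<^sub>M M))"
      unfolding X_def[abs_def] Y_def[abs_def]
      by (rule quad_coin_half[OF km' b1 _ _ L2T_integrable[OF \<eta>12] L2T_integrable[OF \<eta>2h]]) measurable
    also have "\<dots> = (\<integral>p. ?k1 n p * \<eta>\<^sub>1 (fst p) * \<eta>\<^sub>1 (snd p) + ?k2 n p * \<eta>\<^sub>1 (fst p) * \<eta>\<^sub>2 (snd p)
        + ?k3 n p * \<eta>\<^sub>2 (fst p) * \<eta>\<^sub>1 (snd p) + ?k4 n p * \<eta>\<^sub>2 (fst p) * \<eta>\<^sub>2 (snd p) \<partial>(M \<Otimes>\<^sub>M M))"
      using h0[of n] by (intro Bochner_Integration.integral_cong refl)
        (simp add: field_simps power2_eq_square)
    also have "\<dots> = (\<integral>p. ?k1 n p * \<eta>\<^sub>1 (fst p) * \<eta>\<^sub>1 (snd p) \<partial>(M \<Otimes>\<^sub>M M))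
      + (\<integral>p. ?k2 n p * \<eta>\<^sub>1 (fst p) * \<eta>\<^sub>2 (snd p) \<partial>(M \<Otimes>\<^sub>M M))
      + (\<integral>p. ?k3 n p * \<eta>\<^sub>2 (fst p) * \<eta>\<^sub>1 (snd p) \<partial>(M \<Otimes>\<^sub>M M))
      + (\<integral>p. ?k4 n p * \<eta>\<^sub>2 (fst p) * \<eta>\<^sub>2 (snd p) \<partial>(M \<Otimes>\<^sub>M M))"
      by (simp only: Bochner_Integration.integral_add Bochner_Integration.integrable_add int)
    finally show ?thesis .
  qed
  have "0 \<le> (\<integral>p. ?l1 p * \<eta>\<^sub>1 (fst p) * \<eta>\<^sub>1 (snd p) \<partial>(M \<Otimes>\<^sub>M M))
      + (\<integral>p. ?l2 p * \<eta>\<^sub>1 (fst p) * \<eta>\<^sub>2 (snd p) \<partial>(M \<Otimes>\<^sub>M M))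
      + (\<integral>p. ?l3 p * \<eta>\<^sub>2 (fst p) * \<eta>\<^sub>1 (snd p) \<partial>(M \<Otimes>\<^sub>M M))
      + (\<integral>p. ?l4 p * \<eta>\<^sub>2 (fst p) * \<eta>\<^sub>2 (snd p) \<partial>(M \<Otimes>\<^sub>M M))"
    using pos by (intro LIMSEQ_le_const[OF lim]) auto
  also have "\<dots> = (\<integral>p. ?l1 p * \<eta>\<^sub>1 (fst p) * \<eta>\<^sub>1 (snd p) + ?l2 p * \<eta>\<^sub>1 (fst p) * \<eta>\<^sub>2 (snd p)
      + ?l3 p * \<eta>\<^sub>2 (fst p) * \<eta>\<^sub>1 (snd p) + ?l4 p * \<eta>\<^sub>2 (fst p) * \<eta>\<^sub>2 (snd p) \<partial>(M \<Otimes>\<^sub>M M))"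
    by (simp only: Bochner_Integration.integral_add Bochner_Integration.integrable_add intl)
  also have "\<dots> = (\<integral>(\<omega>, \<omega>'). (vector [\<eta>\<^sub>1 \<omega>, \<eta>\<^sub>2 \<omega>] :: real^2) \<bullet>
      (DD\<mu> M (F T) U (\<xi> \<omega>) (law M \<xi>) (\<xi> \<omega>') *v vector [\<eta>\<^sub>1 \<omega>', \<eta>\<^sub>2 \<omega>']) \<partial>(M \<Otimes>\<^sub>M M))"
    unfolding \<mu>_def second_order_integrand[OF law_in_P2[OF \<xi>]] case_prod_beta' ..
  finally show "0 \<le> (\<integral>(\<omega>, \<omega>'). (vector [\<eta>\<^sub>1 \<omega>, \<eta>\<^sub>2 \<omega>] :: real^2) \<bullet>
      (DD\<mu> M (F T) U (\<xi> \<omega>) (law M \<xi>) (\<xi> \<omega>') *v vector [\<eta>\<^sub>1 \<omega>', \<eta>\<^sub>2 \<omega>']) \<partial>(M \<Otimes>\<^sub>M M))" .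
qed

end

section \<open>Quantile functions and mixtures\<close>

text \<open>The generalised inverse of the distribution function. The fixed value outside the open
  unit interval, where the infimum may run over an empty or unbounded set, keeps comparisons of two
  quantile functions valid at every point.\<close>

definition quantile :: "real measure \<Rightarrow> real \<Rightarrow> real" where
  "quantile \<mu> u = (if u \<in> {0<..<1} then Inf {x. u \<le> cdf \<mu> x} else 0)"

lemma quantile_le_iff:
  assumes "real_distribution \<mu>" "0 < u" "u < 1"
  shows "quantile \<mu> u \<le> x \<longleftrightarrow> u \<le> cdf \<mu> x"
proof -
  interpret cdf_distribution \<mu> unfolding cdf_distribution_def by fact
  show ?thesis using pseudoinverse[of u x] assms by (simp add: quantile_def)
qed

lemma quantile_measurable:
  assumes "real_distribution \<mu>" shows "quantile \<mu> \<in> borel_measurable borel"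
proof -
  interpret cdf_distribution \<mu> unfolding cdf_distribution_def by fact
  have "(\<lambda>u. if u \<in> {0<..<1} then Inf {x. u \<le> cdf \<mu> x} else 0) \<in> borel_measurable borel"
    using measurable_CI
    by (subst measurable_If_restrict_space_iff) (auto simp: greaterThanLessThan_def lessThan_def greaterThan_def Int_def)
  then show ?thesis by (simp add: quantile_def[abs_def])
qed

abbreviation unit_interval :: "real measure" where
  "unit_interval \<equiv> restrict_space lborel {0<..<1}"

lemma prob_space_unit_interval: "prob_space unit_interval"
  by (rule prob_spaceI) (simp add: emeasure_restrict_space space_restrict_space)

lemma measurable_unit_interval: "g \<in> borel_measurable borel \<Longrightarrow> g \<in> borel_measurable unit_interval"
  by (rule measurable_restrict_space1) simp

lemma distr_quantile:
  assumes "real_distribution \<mu>" shows "distr unit_interval borel (quantile \<mu>) = \<mu>"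
proof -
  interpret cdf_distribution \<mu> unfolding cdf_distribution_def by fact
  have "distr unit_interval borel (quantile \<mu>) = distr unit_interval borel (\<lambda>u. Inf {x. u \<le> cdf \<mu> x})"
    by (rule distr_cong) (auto simp: quantile_def space_restrict_space)
  then show ?thesis by (simp add: distr_I_eq_M)
qed

text \<open>The distribution lives on \<open>[-R, R]\<close> and dominates \<open>c\<close> times Lebesgue measure there.\<close>

definition regular :: "real \<Rightarrow> real \<Rightarrow> real measure \<Rightarrow> bool" where
  "regular R c \<mu> \<longleftrightarrow> (\<forall>x. x < - R \<longrightarrow> cdf \<mu> x = 0) \<and> (\<forall>x. R \<le> x \<longrightarrow> cdf \<mu> x = 1) \<and>
    (\<forall>x y. - R \<le> x \<longrightarrow> x \<le> y \<longrightarrow> y \<le> R \<longrightarrow> c * (y - x) \<le> cdf \<mu> y - cdf \<mu> x)"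

text \<open>At the \<open>u\<close>-quantile of \<open>\<mu>\<close> the distribution function of
  \<open>\<nu>\<close> falls short of \<open>u\<close> by at most \<open>d\<close>. Moving to the
  right by \<open>d / c\<close> gains at least mass \<open>d\<close>, unless the interval is left,
  and there the distribution function equals 1.\<close>

lemma quantile_le_quantile_add:
  assumes \<mu>: "real_distribution \<mu>" "regular R c \<mu>" and \<nu>: "real_distribution \<nu>" "regular R c \<nu>"
    and c: "0 < c" and d: "0 \<le> d" "\<And>x. \<bar>cdf \<mu> x - cdf \<nu> x\<bar> \<le> d" and u: "0 < u" "u < 1"
  shows "quantile \<nu> u \<le> quantile \<mu> u + d / c"
proof -
  let ?x = "quantile \<mu> u"
  have x: "u \<le> cdf \<mu> ?x" using quantile_le_iff[OF \<mu>(1) u] by blast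
  have xR: "?x \<le> R" using quantile_le_iff[OF \<mu>(1) u, of R] \<mu>(2) u by (auto simp: regular_def)
  have xR': "- R \<le> ?x"
  proof (rule ccontr)
    assume "\<not> - R \<le> ?x"
    then have "cdf \<mu> ?x = 0" using \<mu>(2) by (auto simp: regular_def)
    with x u show False by simp
  qed
  have "u \<le> cdf \<nu> (?x + d / c)"
  proof (cases "?x + d / c \<le> R")
    case True
    then have "c * ((?x + d / c) - ?x) \<le> cdf \<nu> (?x + d / c) - cdf \<nu> ?x"
      using \<nu>(2) xR' c d unfolding regular_def by (metis add_increasing2 divide_nonneg_pos order_refl)
    then have "cdf \<nu> ?x + d \<le> cdf \<nu> (?x + d / c)" using c by simp
    with x d(2)[of ?x] show ?thesis by linarith
  next
    case False
    then have "cdf \<nu> (?x + d / c) = 1" using \<nu>(2) by (auto simp: regular_def)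
    with u show ?thesis by simp
  qed
  then show ?thesis using quantile_le_iff[OF \<nu>(1) u] by blast
qed

lemma quantile_diff_le:
  assumes "real_distribution \<mu>" "regular R c \<mu>" "real_distribution \<nu>" "regular R c \<nu>"
    and "0 < c" "\<And>x. \<bar>cdf \<mu> x - cdf \<nu> x\<bar> \<le> d"
  shows "\<bar>quantile \<nu> u - quantile \<mu> u\<bar> \<le> d / c"
proof -
  have d: "0 \<le> d" using assms(6)[of 0] by linarith
  show ?thesis
  proof (cases "u \<in> {0<..<1}")
    case True
    have "\<bar>cdf \<nu> x - cdf \<mu> x\<bar> \<le> d" for x using assms(6)[of x] by (simp add: abs_minus_commute)
    with True assms d have "quantile \<mu> u \<le> quantile \<nu> u + d / c" "quantile \<nu> u \<le> quantile \<mu> u + d / c"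
      by (auto intro!: quantile_le_quantile_add)
    then show ?thesis by linarith
  next
    case False
    then show ?thesis using assms(5) d by (auto simp: quantile_def)
  qed
qed

section \<open>Mixtures of two laws\<close>

context prob_space
begin

lemma cdf_distr: "X \<in> borel_measurable M \<Longrightarrow> cdf (distr M borel X) x = measure M {\<omega> \<in> space M. X \<omega> \<le> x}"
  unfolding cdf_def by (subst measure_distr) (auto intro!: arg_cong[where f = "measure M"])

lemma cdf_distr_bounded:
  assumes "X \<in> borel_measurable M" "\<And>\<omega>. \<omega> \<in> space M \<Longrightarrow> - R \<le> X \<omega> \<and> X \<omega> \<le> R"
  shows "x < - R \<Longrightarrow> cdf (distr M borel X) x = 0" "R \<le> x \<Longrightarrow> cdf (distr M borel X) x = 1"
proof -
  assume "x < - R"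
  then have "{\<omega> \<in> space M. X \<omega> \<le> x} = {}" using assms(2) by fastforce
  then show "cdf (distr M borel X) x = 0" by (simp only: cdf_distr[OF assms(1)] measure_empty)
next
  assume "R \<le> x"
  then have "{\<omega> \<in> space M. X \<omega> \<le> x} = space M" using assms(2) by fastforce
  then show "cdf (distr M borel X) x = 1" by (simp add: cdf_distr[OF assms(1)] prob_space)
qed

text \<open>The convex combination of the two laws with weight \<open>s\<close> on that of
  \<open>X\<close>, realised by a toss so that it comes with a random variable of this law.\<close>

definition mixture :: "real \<Rightarrow> ('a \<Rightarrow> real) \<Rightarrow> ('a \<Rightarrow> real) \<Rightarrow> real measure" where
  "mixture s X Y = distr (coin s) borel (\<lambda>p. if snd p then X (fst p) else Y (fst p))"

context
  fixes s :: real and X Y :: "'a \<Rightarrow> real"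
  assumes s: "0 \<le> s" "s \<le> 1"
    and X [measurable]: "X \<in> borel_measurable M" and Y [measurable]: "Y \<in> borel_measurable M"
begin

lemma mixture_rv_measurable: "(\<lambda>p. if snd p then X (fst p) else Y (fst p)) \<in> borel_measurable (coin s)"
  by (rule measurable_coin) auto

lemma real_distribution_mixture: "real_distribution (mixture s X Y)"
  unfolding mixture_def by (rule prob_space.real_distribution_distr[OF prob_space_coin mixture_rv_measurable])

lemma
  fixes f :: "real \<Rightarrow> real"
  assumes f: "f \<in> borel_measurable borel" "integrable M (\<lambda>\<omega>. f (X \<omega>))" "integrable M (\<lambda>\<omega>. f (Y \<omega>))"
  shows integrable_mixture: "integrable (mixture s X Y) f"
    and integral_mixture: "(\<integral>x. f x \<partial>mixture s X Y) = s * (\<integral>\<omega>. f (X \<omega>) \<partial>M) + (1 - s) * (\<integral>\<omega>. f (Y \<omega>) \<partial>M)"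
proof -
  let ?Z = "\<lambda>p. if snd p then X (fst p) else Y (fst p)"
  have "integrable (coin s) (\<lambda>p. f (?Z p))"
    by (rule integrable_coin) (use s f in auto)
  then show "integrable (mixture s X Y) f"
    unfolding mixture_def by (simp add: integrable_distr_eq[OF mixture_rv_measurable f(1)])
  have "(\<integral>x. f x \<partial>mixture s X Y) = (\<integral>p. f (?Z p) \<partial>coin s)"
    unfolding mixture_def by (rule integral_distr[OF mixture_rv_measurable f(1)])
  also have "\<dots> = s * (\<integral>\<omega>. f (X \<omega>) \<partial>M) + (1 - s) * (\<integral>\<omega>. f (Y \<omega>) \<partial>M)"
    by (subst integral_coin) (use s f in auto)
  finally show "(\<integral>x. f x \<partial>mixture s X Y) = s * (\<integral>\<omega>. f (X \<omega>) \<partial>M) + (1 - s) * (\<integral>\<omega>. f (Y \<omega>) \<partial>M)" .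
qed

lemma cdf_mixture:
  "cdf (mixture s X Y) x = s * cdf (distr M borel X) x + (1 - s) * cdf (distr M borel Y) x"
proof -
  have *: "(\<integral>\<omega>. indicator {..x} (Z \<omega>) \<partial>M) = cdf (distr M borel Z) x"
    "integrable M (\<lambda>\<omega>. indicator {..x} (Z \<omega>) :: real)"
    if [measurable]: "Z \<in> borel_measurable M" for Z
  proof -
    have "(\<lambda>\<omega>. indicator {..x} (Z \<omega>)) = (indicator (Z -` {..x}) :: _ \<Rightarrow> real)"
      by (auto simp: indicator_def fun_eq_iff)
    moreover have "Z -` {..x} \<inter> space M \<in> sets M" by measurable
    ultimately show "(\<integral>\<omega>. indicator {..x} (Z \<omega>) \<partial>M) = cdf (distr M borel Z) x"
      unfolding cdf_def by (simp add: measure_distr)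
    show "integrable M (\<lambda>\<omega>. indicator {..x} (Z \<omega>) :: real)"
      by (rule integrable_const_bound[where B = 1]) auto
  qed
  interpret D: real_distribution "mixture s X Y" by (rule real_distribution_mixture)
  have "cdf (mixture s X Y) x = (\<integral>y. indicator {..x} y \<partial>mixture s X Y)"
    unfolding cdf_def by simp
  also have "\<dots> = s * cdf (distr M borel X) x + (1 - s) * cdf (distr M borel Y) x"
    by (subst integral_mixture) (auto simp: * X Y)
  finally show ?thesis .
qed

lemma mixture_in_P2:
  assumes "integrable M (\<lambda>\<omega>. (X \<omega>)\<^sup>2)" "integrable M (\<lambda>\<omega>. (Y \<omega>)\<^sup>2)"
  shows "mixture s X Y \<in> P2"
  unfolding P2_def using real_distribution_mixture integrable_mixture[of "\<lambda>x. x\<^sup>2"] assms by simp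

end

lemma mixture_0_1:
  assumes "X \<in> borel_measurable M" "Y \<in> borel_measurable M"
  shows "mixture 0 X Y = distr M borel Y" "mixture 1 X Y = distr M borel X"
  using assms by (auto intro!: cdf_unique real_distribution_mixture simp: cdf_mixture fun_eq_iff)

end

section \<open>From the differential form to Lasry-Lions monotonicity\<close>

context smooth_functional
begin

section \<open>Realising laws by one uniform variable\<close>

definition unif :: "'a \<Rightarrow> real" where
  "unif = (SOME Z. Z \<in> borel_measurable (F 0) \<and> distr M borel Z = distr unit_interval borel (\<lambda>x. x))"

lemma unif:
  "unif \<in> borel_measurable (F 0)" "distr M borel unif = distr unit_interval borel (\<lambda>x. x)"
proof -
  have "real_distribution (distr unit_interval borel (\<lambda>x. x))"
    by (intro prob_space.real_distribution_distr prob_space_unit_interval measurable_unit_interval) simp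
  from someI_ex[OF rich_F_0[OF this, unfolded Bex_def]]
  show "unif \<in> borel_measurable (F 0)" "distr M borel unif = distr unit_interval borel (\<lambda>x. x)"
    unfolding unif_def by auto
qed

lemma unif_measurable: "unif \<in> borel_measurable M"
  by (rule measurable_from_subalg[OF subalgebra_FT measurable_F0_FT[OF unif(1)]])

lemma distr_unif:
  assumes [measurable]: "g \<in> borel_measurable borel"
  shows "distr M borel (\<lambda>\<omega>. g (unif \<omega>)) = distr unit_interval borel g"
proof -
  have "distr M borel (\<lambda>\<omega>. g (unif \<omega>)) = distr (distr M borel unif) borel g"
    using unif_measurable by (subst distr_distr) (auto simp: comp_def)
  also have "\<dots> = distr unit_interval borel (\<lambda>x. g x)"
    unfolding unif(2) using measurable_unit_interval[of "\<lambda>x. x"]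
    by (subst distr_distr) (auto simp: comp_def)
  finally show ?thesis .
qed

text \<open>All laws of \<open>P2\<close> become functions of the same uniform variable. Any two of
  them are thereby coupled monotonically, and the pointwise difference is that of their quantile
  functions.\<close>

lemma quantile_unif:
  assumes "\<mu> \<in> P2"
  shows "(\<lambda>\<omega>. quantile \<mu> (unif \<omega>)) \<in> L2T" "law M (\<lambda>\<omega>. quantile \<mu> (unif \<omega>)) = \<mu>"
proof -
  have \<mu>: "real_distribution \<mu>" "integrable \<mu> (\<lambda>x. x\<^sup>2)" using assms by (auto simp: P2_def)
  note [measurable] = quantile_measurable[OF \<mu>(1)] unif_measurable
  show l: "law M (\<lambda>\<omega>. quantile \<mu> (unif \<omega>)) = \<mu>"
    unfolding law_def distr_unif[OF quantile_measurable[OF \<mu>(1)]] by (rule distr_quantile[OF \<mu>(1)])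
  have "integrable (distr M borel (\<lambda>\<omega>. quantile \<mu> (unif \<omega>))) (\<lambda>x. x\<^sup>2)"
    using l \<mu>(2) by (simp add: law_def)
  then have "integrable M (\<lambda>\<omega>. (quantile \<mu> (unif \<omega>))\<^sup>2)"
    by (subst (asm) integrable_distr_eq) auto
  moreover have "(\<lambda>\<omega>. quantile \<mu> (unif \<omega>)) \<in> borel_measurable (F T)"
    by (rule measurable_compose[OF measurable_F0_FT[OF unif(1)] quantile_measurable[OF \<mu>(1)]])
  ultimately show "(\<lambda>\<omega>. quantile \<mu> (unif \<omega>)) \<in> L2T" by (simp add: L2_def)
qed

text \<open>Under the monotone coupling the increment is at most \<open>d / c\<close> at every
  point, which makes the error of \<open>ll_gap_expansion\<close> cubic in \<open>d\<close>. The
  form itself is nonnegative at the intermediate point, because \<open>diff_monotone\<close> holds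
  at every element of \<open>L2T\<close>.\<close>

lemma ll_gap_lower_bound:
  assumes dm: diff_monotone and \<mu>: "\<mu> \<in> P2" "regular R c \<mu>" and \<nu>: "\<nu> \<in> P2" "regular R c \<nu>"
    and c: "0 < c" and d: "\<And>x. \<bar>cdf \<mu> x - cdf \<nu> x\<bar> \<le> d"
  shows "- (bound_const * (d / c) ^ 3) \<le> ll_gap \<nu> \<mu>"
proof -
  define \<xi> where "\<xi> \<omega> = quantile \<mu> (unif \<omega>)" for \<omega>
  define \<zeta> where "\<zeta> \<omega> = quantile \<nu> (unif \<omega>)" for \<omega>
  define \<eta> where "\<eta> \<omega> = \<zeta> \<omega> - \<xi> \<omega>" for \<omega>
  have \<xi>: "\<xi> \<in> L2T" "law M \<xi> = \<mu>" unfolding \<xi>_def[abs_def] using quantile_unif[OF \<mu>(1)] by auto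
  have \<zeta>: "\<zeta> \<in> L2T" "law M \<zeta> = \<nu>" unfolding \<zeta>_def[abs_def] using quantile_unif[OF \<nu>(1)] by auto
  have \<eta>: "\<eta> \<in> L2T"
    using L2T_add[OF \<zeta>(1) L2T_scale[OF \<xi>(1), of "-1"]] by (simp add: \<eta>_def[abs_def])
  let ?r = "d / c"
  have r: "\<bar>\<eta> \<omega>\<bar> \<le> ?r" for \<omega>
    unfolding \<eta>_def \<xi>_def \<zeta>_def
    using \<mu> \<nu> c d by (intro quantile_diff_le) (auto simp: P2_def)
  have r0: "0 \<le> ?r" using r[of undefined] by linarith
  have e1: "(\<integral>\<omega>. \<bar>\<eta> \<omega>\<bar> \<partial>M) \<le> ?r"
  proof -
    have "(\<integral>\<omega>. \<bar>\<eta> \<omega>\<bar> \<partial>M) \<le> (\<integral>\<omega>. ?r \<partial>M)" by (rule integral_mono') (use r r0 in auto)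
    then show ?thesis by (simp add: prob_space)
  qed
  have e2: "(\<integral>\<omega>. (\<eta> \<omega>)\<^sup>2 \<partial>M) \<le> ?r\<^sup>2"
  proof -
    have "(\<eta> \<omega>)\<^sup>2 \<le> ?r\<^sup>2" for \<omega> using power_mono[OF r[of \<omega>], of 2] by simp
    then have "(\<integral>\<omega>. (\<eta> \<omega>)\<^sup>2 \<partial>M) \<le> (\<integral>\<omega>. ?r\<^sup>2 \<partial>M)" by (intro integral_mono') auto
    then show ?thesis by (simp add: prob_space)
  qed
  have eq: "(\<lambda>\<omega>. \<xi> \<omega> + \<eta> \<omega>) = \<zeta>" by (simp add: \<eta>_def fun_eq_iff)
  obtain s where s: "\<bar>ll_gap (law M (\<lambda>\<omega>. \<xi> \<omega> + \<eta> \<omega>)) (law M \<xi>)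
        - quad M (ker (law M (\<lambda>\<omega>. \<xi> \<omega> + s * \<eta> \<omega>))) (\<lambda>\<omega>. \<xi> \<omega> + s * \<eta> \<omega>) \<eta>\<bar>
      \<le> bound_const * (\<integral>\<omega>. (\<eta> \<omega>)\<^sup>2 \<partial>M) * (\<integral>\<omega>. \<bar>\<eta> \<omega>\<bar> \<partial>M)"
    by (rule ll_gap_expansion[OF \<xi>(1) \<eta>])
  have "0 \<le> quad M (ker (law M (\<lambda>\<omega>. \<xi> \<omega> + s * \<eta> \<omega>))) (\<lambda>\<omega>. \<xi> \<omega> + s * \<eta> \<omega>) \<eta>"
    using dm[unfolded diff_monotone_def, rule_format, OF L2T_line[OF \<xi>(1) \<eta>] \<eta>] .
  moreover have "bound_const * (\<integral>\<omega>. (\<eta> \<omega>)\<^sup>2 \<partial>M) * (\<integral>\<omega>. \<bar>\<eta> \<omega>\<bar> \<partial>M) \<le> bound_const * ?r\<^sup>2 * ?r"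
    using e1 e2 r0 bound_const_nonneg by (intro mult_mono mult_nonneg_nonneg) auto
  moreover have "bound_const * ?r\<^sup>2 * ?r = bound_const * ?r ^ 3"
    by (simp add: power2_eq_square power3_eq_cube)
  ultimately show ?thesis using s unfolding eq \<xi>(2) \<zeta>(2) by linarith
qed

text \<open>Along the mixture path \<open>\<mu>\<^sub>s = s \<mu>\<^sub>1 + (1 - s) \<mu>\<^sub>0\<close> the gap is additive up to the factor \<open>1 / N\<close>,
  so \<open>N\<close> steps with an error \<open>O(N\<^sup>-\<^sup>3)\<close> each give a total error \<open>O(1 / N)\<close>.\<close>

lemma ll_gap_nonneg_regular:
  assumes dm: diff_monotone
    and X: "X \<in> L2T" "regular R c (law M X)" and Y: "Y \<in> L2T" "regular R c (law M Y)"
    and c: "0 < c"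
  shows "0 \<le> ll_gap (law M X) (law M Y)"
proof -
  let ?C = "bound_const / c ^ 3"
  have bnd: "- (?C / real N) \<le> ll_gap (law M X) (law M Y)" if N: "0 < N" for N :: nat
  proof -
    define m where "m k = mixture (real k / real N) X Y" for k
    note XM = L2T_measurable[OF X(1)] and YM = L2T_measurable[OF Y(1)]
    have s: "0 \<le> real k / real N" "real k / real N \<le> 1" if "k \<le> N" for k
      using that N by auto
    have P: "m k \<in> P2" if "k \<le> N" for k
      unfolding m_def by (intro mixture_in_P2 s that XM YM L2T_integrable_square X Y)
    have cdf_m: "cdf (m k) x = real k / real N * cdf (law M X) x + (1 - real k / real N) * cdf (law M Y) x"
      if "k \<le> N" for k x
      unfolding m_def law_def by (intro cdf_mixture s that XM YM)
    have reg: "regular R c (m k)" if k: "k \<le> N" for k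
      unfolding regular_def
    proof (intro conjI allI impI)
      show "cdf (m k) x = 0" if "x < - R" for x
        using that X(2) Y(2) by (simp add: cdf_m[OF k] regular_def)
      show "cdf (m k) x = 1" if "R \<le> x" for x
        using that X(2) Y(2) by (simp add: cdf_m[OF k] regular_def)
      fix x y assume xy: "- R \<le> x" "x \<le> y" "y \<le> R"
      let ?s = "real k / real N"
      have "c * (y - x) = ?s * (c * (y - x)) + (1 - ?s) * (c * (y - x))" by (simp add: algebra_simps)
      also have "\<dots> \<le> ?s * (cdf (law M X) y - cdf (law M X) x) + (1 - ?s) * (cdf (law M Y) y - cdf (law M Y) x)"
        using X(2) Y(2) xy s[OF k] unfolding regular_def by (intro add_mono mult_left_mono) auto
      also have "\<dots> = cdf (m k) y - cdf (m k) x"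
        unfolding cdf_m[OF k] by (simp add: algebra_simps)
      finally show "c * (y - x) \<le> cdf (m k) y - cdf (m k) x" .
    qed
    \<comment> \<open>Pairing with the signed measure \<open>law M X - law M Y\<close>, the constant
      direction of the mixture path.\<close>
    define D where "D f = (\<integral>x. f x \<partial>law M X) - (\<integral>x. f x \<partial>law M Y)" for f :: "real \<Rightarrow> real"
    have int_m: "integrable (m k) (\<lambda>x. U x \<alpha>)"
        "(\<integral>x. U x \<alpha> \<partial>m k) = (\<integral>x. U x \<alpha> \<partial>law M Y) + real k / real N * D (\<lambda>x. U x \<alpha>)"
      if k: "k \<le> N" and \<alpha>: "\<alpha> \<in> P2" for k \<alpha>
    proof -
      note Um = U_measurable[OF \<alpha>]
      have i: "integrable M (\<lambda>\<omega>. U (Z \<omega>) \<alpha>)" "(\<integral>\<omega>. U (Z \<omega>) \<alpha> \<partial>M) = (\<integral>x. U x \<alpha> \<partial>law M Z)"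
        if Z: "Z \<in> L2T" for Z
        using U_integrable[OF prob_space_axioms L2T_integrable[OF Z] \<alpha>]
          integral_distr[OF L2T_measurable[OF Z] Um] by (auto simp: law_def)
      show "integrable (m k) (\<lambda>x. U x \<alpha>)"
        unfolding m_def by (intro integrable_mixture s k XM YM Um i X Y)
      have "(\<integral>x. U x \<alpha> \<partial>m k) = real k / real N * (\<integral>\<omega>. U (X \<omega>) \<alpha> \<partial>M) + (1 - real k / real N) * (\<integral>\<omega>. U (Y \<omega>) \<alpha> \<partial>M)"
        unfolding m_def by (intro integral_mixture s k XM YM Um i X Y)
      then show "(\<integral>x. U x \<alpha> \<partial>m k) = (\<integral>x. U x \<alpha> \<partial>law M Y) + real k / real N * D (\<lambda>x. U x \<alpha>)"
        by (simp add: i(2)[OF X(1)] i(2)[OF Y(1)] D_def algebra_simps)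
    qed
    define a where "a k = D (\<lambda>x. U x (m k))" for k
    \<comment> \<open>The difference of \<open>m l\<close> and \<open>m k\<close> is
      \<open>(l - k) / N\<close> times this direction, so the gap is that factor times an increment
      of \<open>a\<close>. Neighbouring indices give terms that telescope, and the indices
      \<open>N\<close> and 0 give the full gap.\<close>
    have step: "ll_gap (m l) (m k) = (real l - real k) / real N * (a l - a k)" if "k \<le> N" "l \<le> N" for k l
      unfolding ll_gap_def using int_m[OF that(1) P[OF that(1)]] int_m[OF that(1) P[OF that(2)]]
        int_m[OF that(2) P[OF that(1)]] int_m[OF that(2) P[OF that(2)]] N
      by (simp add: a_def field_simps)
    have lb: "- (bound_const * (1 / real N / c) ^ 3) \<le> (a (Suc k) - a k) / real N" if k: "k < N" for k
    proof -
      have "- (bound_const * (1 / real N / c) ^ 3) \<le> ll_gap (m (Suc k)) (m k)"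
      proof (rule ll_gap_lower_bound[OF dm P reg P reg c])
        fix x
        have e: "cdf (m k) x - cdf (m (Suc k)) x = - (1 / real N) * (cdf (law M X) x - cdf (law M Y) x)"
          using k N by (simp add: cdf_m field_simps)
        have "\<bar>cdf (law M X) x - cdf (law M Y) x\<bar> \<le> 1"
        proof -
          interpret a: real_distribution "law M X" unfolding law_def using XM by simp
          interpret b: real_distribution "law M Y" unfolding law_def using YM by simp
          show ?thesis
            using a.cdf_nonneg[of x] b.cdf_nonneg[of x] a.cdf_bounded_prob[of x] b.cdf_bounded_prob[of x]
            by linarith
        qed
        then have "\<bar>- (1 / real N)\<bar> * \<bar>cdf (law M X) x - cdf (law M Y) x\<bar> \<le> \<bar>- (1 / real N)\<bar> * 1"
          by (intro mult_left_mono) auto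
        then show "\<bar>cdf (m k) x - cdf (m (Suc k)) x\<bar> \<le> 1 / real N"
          unfolding e abs_mult by simp
      qed (use k in auto)
      also have "\<dots> = (a (Suc k) - a k) / real N"
        using k by (subst step) auto
      finally show ?thesis .
    qed
    \<comment> \<open>The telescoped sum is only \<open>1 / N\<close> times the full gap. Thus
      \<open>N\<close> errors of order \<open>N^-3\<close> must be multiplied by another
      \<open>N\<close>, and \<open>1 / N\<close> remains.\<close>
    have "- (bound_const * (1 / real N / c) ^ 3) * real N = (\<Sum>k<N. - (bound_const * (1 / real N / c) ^ 3))"
      by simp
    also have "\<dots> \<le> (\<Sum>k<N. (a (Suc k) - a k) / real N)"
      by (intro sum_mono lb) simp
    also have "\<dots> = (a N - a 0) / real N"
      by (simp add: sum_divide_distrib[symmetric] sum_lessThan_telescope)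
    also have "\<dots> = ll_gap (m N) (m 0) / real N"
      using N by (simp add: step)
    also have "m N = law M X"
      using N mixture_0_1[OF XM YM] by (simp add: m_def law_def)
    also have "m 0 = law M Y"
      using mixture_0_1[OF XM YM] by (simp add: m_def law_def)
    finally have "- (bound_const * (1 / real N / c) ^ 3) * real N * real N \<le> ll_gap (law M X) (law M Y)"
      using N by (simp add: pos_le_divide_eq)
    moreover have "- (bound_const * (1 / real N / c) ^ 3) * real N * real N = - (?C / real N)"
      using N c by (simp add: field_simps power3_eq_cube)
    ultimately show ?thesis by simp
  qed
  have lim: "(\<lambda>n. - (?C / real (Suc n))) \<longlonglongrightarrow> - 0"
    by (intro tendsto_minus LIMSEQ_Suc lim_const_over_n)
  have "- 0 \<le> ll_gap (law M X) (law M Y)"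
    by (rule LIMSEQ_le_const2[OF lim], intro exI allI impI, rule bnd) simp
  then show ?thesis by simp
qed

text \<open>The integrand and the integrating measure move together. The estimate for replacing
  \<open>\<beta> n\<close> by \<open>\<beta>'\<close> is uniform over the measure argument of
  \<open>U\<close>, so it applies at \<open>\<alpha> n\<close>; dominated convergence under the
  fixed \<open>\<beta>'\<close> does the rest.\<close>

lemma U_integral_tendsto:
  assumes \<alpha>: "\<And>n. \<alpha> n \<in> P2" "\<alpha>' \<in> P2" "\<And>n. W2 (\<alpha> n) \<alpha>' \<le> w n" "w \<longlonglongrightarrow> 0"
    and \<beta>: "\<beta>' \<in> P2" "\<And>n \<mu>. \<mu> \<in> P2 \<Longrightarrow> \<bar>(\<integral>x. U x \<mu> \<partial>\<beta> n) - (\<integral>x. U x \<mu> \<partial>\<beta>')\<bar> \<le> v n" "v \<longlonglongrightarrow> 0"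
  shows "(\<lambda>n. \<integral>x. U x (\<alpha> n) \<partial>\<beta> n) \<longlonglongrightarrow> (\<integral>x. U x \<alpha>' \<partial>\<beta>')"
proof -
  interpret b: real_distribution \<beta>' using \<beta>(1) by (simp add: P2_def)
  have lim: "(\<lambda>n. U x (\<alpha> n)) \<longlonglongrightarrow> U x \<alpha>'" for x
    using continuous_P2_tendsto[OF U_continuous[of 0] \<alpha>(2,1) tendsto_const \<alpha>(3,4)] by simp
  \<comment> \<open>\<open>U\<close> need not be bounded, but its values at 0 along the sequence
    converge; with the Lipschitz bound in \<open>x\<close> this yields a majorant.\<close>
  obtain K where K: "\<And>n. \<bar>U 0 (\<alpha> n)\<bar> \<le> K"
    using convergent_imp_Bseq[OF convergentI[OF lim[of 0]]] by (auto simp: Bseq_def)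
  have x: "integrable \<beta>' (\<lambda>x. x)"
    by (rule b.integrable_of_square) (use \<beta>(1) in \<open>auto simp: P2_def\<close>)
  have f: "(\<lambda>n. \<integral>x. U x (\<alpha> n) \<partial>\<beta>') \<longlonglongrightarrow> (\<integral>x. U x \<alpha>' \<partial>\<beta>')"
  proof (rule integral_dominated_convergence)
    show "integrable \<beta>' (\<lambda>x. K + bound_const * \<bar>x\<bar>)" using x by simp
    show "(\<lambda>x. U x \<alpha>') \<in> borel_measurable \<beta>'" "\<And>n. (\<lambda>x. U x (\<alpha> n)) \<in> borel_measurable \<beta>'"
      using U_measurable[OF \<alpha>(2)] U_measurable[OF \<alpha>(1)] by simp_all
    show "AE x in \<beta>'. (\<lambda>n. U x (\<alpha> n)) \<longlonglongrightarrow> U x \<alpha>'" using lim by simp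
    show "AE x in \<beta>'. norm (U x (\<alpha> n)) \<le> K + bound_const * \<bar>x\<bar>" for n
    proof (rule AE_I2)
      fix x show "norm (U x (\<alpha> n)) \<le> K + bound_const * \<bar>x\<bar>"
        using U_lipschitz[OF \<alpha>(1), of x n 0] K[of n] by simp
    qed
  qed
  have "(\<lambda>n. (\<integral>x. U x (\<alpha> n) \<partial>\<beta> n) - (\<integral>x. U x (\<alpha> n) \<partial>\<beta>')) \<longlonglongrightarrow> 0"
    by (rule Lim_null_comparison[OF _ \<beta>(3)]) (use \<beta>(2)[OF \<alpha>(1)] in simp)
  from tendsto_add[OF this f] show ?thesis by simp
qed

text \<open>Uniformly distributed on the interval of radius \<open>n + 1\<close> around 0. Clamping
  to the unit interval makes the bound hold at every point, whereas \<open>unif\<close> is confined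
  to it only almost surely.\<close>

definition spread :: "nat \<Rightarrow> 'a \<Rightarrow> real" where
  "spread n \<omega> = real (Suc n) * (2 * max 0 (min 1 (unif \<omega>)) - 1)"

definition clamp_rv :: "nat \<Rightarrow> ('a \<Rightarrow> real) \<Rightarrow> 'a \<Rightarrow> real" where
  "clamp_rv n \<xi> \<omega> = max (- real (Suc n)) (min (real (Suc n)) (\<xi> \<omega>))"

text \<open>The weight makes \<open>weight n * (n + 1)\<^sup>2\<close> tend to 0, which controls the second moment of the spread mass.\<close>

definition weight :: "nat \<Rightarrow> real" where
  "weight n = 1 / real (Suc n) ^ 3"

text \<open>Clamping confines the law to a bounded interval; the small uniform part supplies the
  lower bound on the mass of subintervals that \<open>regular\<close> demands.\<close>

definition regularised :: "nat \<Rightarrow> ('a \<Rightarrow> real) \<Rightarrow> real measure" where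
  "regularised n \<xi> = mixture (weight n) (spread n) (clamp_rv n \<xi>)"

lemma weight: "0 < weight n" "weight n \<le> 1"
  unfolding weight_def by (auto simp: divide_le_eq_1 simp del: of_nat_Suc intro!: one_le_power)

lemma spread_measurable [measurable]: "spread n \<in> borel_measurable M"
  unfolding spread_def[abs_def] using unif_measurable by measurable

lemma spread_bounds: "\<bar>spread n \<omega>\<bar> \<le> real (Suc n)"
proof -
  have "\<bar>2 * max 0 (min 1 (unif \<omega>)) - 1\<bar> \<le> 1" by auto
  then have "real (Suc n) * \<bar>2 * max 0 (min 1 (unif \<omega>)) - 1\<bar> \<le> real (Suc n) * 1"
    by (intro mult_left_mono) auto
  then show ?thesis by (simp add: spread_def abs_mult del: of_nat_Suc)
qed

lemma clamp_rv_bounds: "\<bar>clamp_rv n \<xi> \<omega>\<bar> \<le> real (Suc n)"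
  unfolding clamp_rv_def by auto

lemma clamp_rv_measurable: "\<xi> \<in> L2T \<Longrightarrow> clamp_rv n \<xi> \<in> borel_measurable M"
  unfolding clamp_rv_def[abs_def] using L2T_measurable[of \<xi>] by simp

lemma regularised_in_P2:
  assumes "\<xi> \<in> L2T" shows "regularised n \<xi> \<in> P2"
  unfolding regularised_def
  by (rule mixture_in_P2[OF _ _ spread_measurable clamp_rv_measurable[OF assms]
        integrable_square_bounded[OF spread_measurable spread_bounds]
        integrable_square_bounded[OF clamp_rv_measurable[OF assms] clamp_rv_bounds]])
    (use weight[of n] in auto)

lemma cdf_spread:
  assumes x: "- real (Suc n) \<le> x" "x \<le> real (Suc n)"
  shows "cdf (distr M borel (spread n)) x = (x + real (Suc n)) / (2 * real (Suc n))"
proof -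
  let ?R = "real (Suc n)"
  let ?g = "\<lambda>u::real. ?R * (2 * max 0 (min 1 u) - 1)"
  define t where "t = (x + ?R) / (2 * ?R)"
  have R: "0 < ?R" by simp
  have t: "0 \<le> t" "t \<le> 1" using x R by (auto simp: t_def divide_le_eq_1 simp del: of_nat_Suc)
  have gt: "?g u \<le> x \<longleftrightarrow> u \<le> t" if "u \<in> {0<..<1}" for u
  proof -
    have "?g u \<le> x \<longleftrightarrow> u * (2 * ?R) \<le> x + ?R" using that by (simp add: algebra_simps del: of_nat_Suc)
    also have "\<dots> \<longleftrightarrow> u \<le> t" unfolding t_def using R by (simp add: pos_le_divide_eq del: of_nat_Suc)
    finally show ?thesis .
  qed
  interpret u: prob_space unit_interval by (rule prob_space_unit_interval)
  have g: "?g \<in> borel_measurable borel" by measurable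
  have "distr M borel (spread n) = distr unit_interval borel ?g"
    unfolding spread_def[abs_def] by (rule distr_unif[OF g])
  then have "cdf (distr M borel (spread n)) x = measure unit_interval {u \<in> space unit_interval. ?g u \<le> x}"
    using u.cdf_distr[OF measurable_unit_interval[OF g]] by simp
  also have "{u \<in> space unit_interval. ?g u \<le> x} = {u. 0 < u \<and> u < 1 \<and> u \<le> t}"
    using gt by (auto simp: space_restrict_space)
  also have "measure unit_interval \<dots> = measure lborel {u. 0 < u \<and> u < 1 \<and> u \<le> t}"
    by (rule measure_restrict_space) auto
  also have "\<dots> = t"
  proof (cases "t < 1")
    case True
    then have "{u. 0 < u \<and> u < 1 \<and> u \<le> t} = {0<..t}" by auto
    then show ?thesis using t by simp
  next
    case False
    then have "{u. 0 < u \<and> u < 1 \<and> u \<le> t} = {0<..<1}" "t = 1" using t by auto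
    then show ?thesis by simp
  qed
  finally show ?thesis unfolding t_def .
qed

text \<open>The constant is the density \<open>1 / (2 * (n + 1))\<close> of the uniform part times
  its weight. The clamped part adds a nondecreasing term to the distribution function.\<close>

lemma regular_regularised:
  assumes \<xi>: "\<xi> \<in> L2T"
  shows "regular (real (Suc n)) (weight n / (2 * real (Suc n))) (regularised n \<xi>)"
proof -
  let ?R = "real (Suc n)"
  have R: "0 < ?R" by simp
  note cm = clamp_rv_measurable[OF \<xi>]
  have w: "0 \<le> weight n" "weight n \<le> 1" using weight[of n] by auto
  interpret N: prob_space "coin (weight n)" by (rule prob_space_coin)
  have b: "- ?R \<le> (if snd p then spread n (fst p) else clamp_rv n \<xi> (fst p)) \<and>
      (if snd p then spread n (fst p) else clamp_rv n \<xi> (fst p)) \<le> ?R" for p :: "'a \<times> bool"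
    using spread_bounds[of n "fst p"] clamp_rv_bounds[of n \<xi> "fst p"] by auto
  note cdfb = N.cdf_distr_bounded[OF mixture_rv_measurable[OF w spread_measurable cm] b,
      folded mixture_def regularised_def]
  interpret c: real_distribution "distr M borel (clamp_rv n \<xi>)" using cm by simp
  show ?thesis
    unfolding regular_def
  proof (intro conjI allI impI)
    fix x y assume xy: "- ?R \<le> x" "x \<le> y" "y \<le> ?R"
    have "cdf (regularised n \<xi>) y - cdf (regularised n \<xi>) x
      = weight n * ((y + ?R) / (2 * ?R) - (x + ?R) / (2 * ?R))
        + (1 - weight n) * (cdf (distr M borel (clamp_rv n \<xi>)) y - cdf (distr M borel (clamp_rv n \<xi>)) x)"
      unfolding regularised_def cdf_mixture[OF w spread_measurable cm]
      using xy by (simp add: cdf_spread algebra_simps del: of_nat_Suc)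
    also have "\<dots> \<ge> weight n * ((y + ?R) / (2 * ?R) - (x + ?R) / (2 * ?R))"
      using c.cdf_nondecreasing[OF xy(2)] w by simp
    also have "weight n * ((y + ?R) / (2 * ?R) - (x + ?R) / (2 * ?R)) = weight n / (2 * ?R) * (y - x)"
      by (simp add: diff_divide_distrib[symmetric] del: of_nat_Suc)
    finally show "weight n / (2 * ?R) * (y - x) \<le> cdf (regularised n \<xi>) y - cdf (regularised n \<xi>) x" .
  qed (use cdfb in auto)
qed

text \<open>The expected squared distance between \<open>\<xi>\<close> and the regularised variable,
  both taken on the space with the toss.\<close>

definition defect :: "nat \<Rightarrow> ('a \<Rightarrow> real) \<Rightarrow> real" where
  "defect n \<xi> = weight n * (\<integral>\<omega>. (spread n \<omega> - \<xi> \<omega>)\<^sup>2 \<partial>M)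
    + (1 - weight n) * (\<integral>\<omega>. (clamp_rv n \<xi> \<omega> - \<xi> \<omega>)\<^sup>2 \<partial>M)"

text \<open>One coupling serves both estimates: it bounds \<open>W2\<close> directly, and through
  the Lipschitz constant of \<open>U\<close> in \<open>x\<close> it bounds the integrals uniformly
  in the measure argument.\<close>

lemma regularised_close:
  assumes \<xi>: "\<xi> \<in> L2T"
  shows "W2 (regularised n \<xi>) (law M \<xi>) \<le> sqrt (defect n \<xi>)"
    and "\<mu> \<in> P2 \<Longrightarrow> \<bar>(\<integral>x. U x \<mu> \<partial>regularised n \<xi>) - (\<integral>x. U x \<mu> \<partial>law M \<xi>)\<bar> \<le> bound_const * sqrt (defect n \<xi>)"
proof -
  let ?N = "coin (weight n)"
  let ?S = "\<lambda>p. if snd p then spread n (fst p) else clamp_rv n \<xi> (fst p)"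
  note cm = clamp_rv_measurable[OF \<xi>]
  have w: "0 \<le> weight n" "weight n \<le> 1" using weight[of n] by auto
  interpret N: prob_space ?N by (rule prob_space_coin)
  note [measurable] = L2T_measurable[OF \<xi>] cm
  have S [measurable]: "?S \<in> borel_measurable ?N" by (rule mixture_rv_measurable[OF w spread_measurable cm])
  have \<xi>f [measurable]: "(\<lambda>p. \<xi> (fst p)) \<in> borel_measurable ?N" by measurable
  have law: "law M \<xi> = distr ?N borel (\<lambda>p. \<xi> (fst p))"
    unfolding law_def by (rule distr_coin_fst[symmetric]) simp
  have sp: "(\<lambda>\<omega>. X \<omega> - \<xi> \<omega>) \<in> borel_measurable M" "integrable M (\<lambda>\<omega>. (X \<omega> - \<xi> \<omega>)\<^sup>2)"
    if [measurable]: "X \<in> borel_measurable M" and b: "\<And>\<omega>. \<bar>X \<omega>\<bar> \<le> C" for X C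
  proof -
    show "(\<lambda>\<omega>. X \<omega> - \<xi> \<omega>) \<in> borel_measurable M" by measurable
    show "integrable M (\<lambda>\<omega>. (X \<omega> - \<xi> \<omega>)\<^sup>2)"
    proof (rule Bochner_Integration.integrable_bound)
      show "integrable M (\<lambda>\<omega>. 2 * (X \<omega>)\<^sup>2 + 2 * (\<xi> \<omega>)\<^sup>2)"
        using integrable_square_bounded[OF _ b] L2T_integrable_square[OF \<xi>] by simp
      show "(\<lambda>\<omega>. (X \<omega> - \<xi> \<omega>)\<^sup>2) \<in> borel_measurable M" by measurable
      have "(x - y)\<^sup>2 \<le> 2 * x\<^sup>2 + 2 * y\<^sup>2" for x y :: real
        using zero_le_power2[of "x + y"] by (simp add: power2_eq_square algebra_simps)
      then show "AE \<omega> in M. norm ((X \<omega> - \<xi> \<omega>)\<^sup>2) \<le> norm (2 * (X \<omega>)\<^sup>2 + 2 * (\<xi> \<omega>)\<^sup>2)" by simp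
    qed
  qed
  have i: "integrable ?N (\<lambda>p. (?S p - \<xi> (fst p))\<^sup>2)"
    by (rule integrable_coin)
      (use w sp(2)[OF spread_measurable spread_bounds] sp(2)[OF cm clamp_rv_bounds] in auto)
  have d: "(\<integral>p. (?S p - \<xi> (fst p))\<^sup>2 \<partial>?N) = defect n \<xi>"
    by (subst integral_coin)
      (use w sp(2)[OF spread_measurable spread_bounds] sp(2)[OF cm clamp_rv_bounds] in \<open>auto simp: defect_def\<close>)
  show "W2 (regularised n \<xi>) (law M \<xi>) \<le> sqrt (defect n \<xi>)"
    unfolding regularised_def mixture_def law d[symmetric] by (rule N.W2_distr_le[OF S \<xi>f])
  assume \<mu>: "\<mu> \<in> P2"
  note Um = U_measurable[OF \<mu>]
  have iS: "integrable ?N (\<lambda>p. U (?S p) \<mu>)"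
  proof (rule U_integrable[OF prob_space_coin _ \<mu>])
    show "integrable ?N ?S"
      by (rule N.integrable_const_bound[where B = "real (Suc n)"])
        (use spread_bounds clamp_rv_bounds in \<open>auto simp del: of_nat_Suc\<close>)
  qed
  have i\<xi>: "integrable ?N (\<lambda>p. U (\<xi> (fst p)) \<mu>)"
  proof (rule U_integrable[OF prob_space_coin _ \<mu>])
    show "integrable ?N (\<lambda>p. \<xi> (fst p))"
      by (rule integrable_coin) (use w L2T_integrable[OF \<xi>] in auto)
  qed
  have "(\<integral>x. U x \<mu> \<partial>regularised n \<xi>) - (\<integral>x. U x \<mu> \<partial>law M \<xi>) = (\<integral>p. U (?S p) \<mu> - U (\<xi> (fst p)) \<mu> \<partial>?N)"
    unfolding regularised_def mixture_def law integral_distr[OF S Um] integral_distr[OF \<xi>f Um]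
    using iS i\<xi> by simp
  also have "\<bar>\<integral>p. U (?S p) \<mu> - U (\<xi> (fst p)) \<mu> \<partial>?N\<bar> \<le> (\<integral>p. bound_const * \<bar>?S p - \<xi> (fst p)\<bar> \<partial>?N)"
  proof (rule abs_integral_le)
    show "integrable ?N (\<lambda>p. bound_const * \<bar>?S p - \<xi> (fst p)\<bar>)"
      using N.integrable_of_square[OF _ i] by simp
  qed (use iS i\<xi> U_lipschitz[OF \<mu>] in auto)
  also have "\<dots> \<le> bound_const * sqrt (defect n \<xi>)"
    using mult_left_mono[OF N.expectation_abs_le_sqrt[OF _ i] bound_const_nonneg] by (simp add: d)
  finally show "\<bar>(\<integral>x. U x \<mu> \<partial>regularised n \<xi>) - (\<integral>x. U x \<mu> \<partial>law M \<xi>)\<bar> \<le> bound_const * sqrt (defect n \<xi>)" .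
qed

text \<open>Clamping is eventually exact at each point, with error at most \<open>|\<xi>|\<close>,
  so dominated convergence applies. The spread part has second moment of order
  \<open>(n + 1)^2\<close> against the weight \<open>(n + 1)^-3\<close>.\<close>

lemma defect_tendsto:
  assumes \<xi>: "\<xi> \<in> L2T" shows "(\<lambda>n. defect n \<xi>) \<longlonglongrightarrow> 0"
proof -
  note [measurable] = L2T_measurable[OF \<xi>] clamp_rv_measurable[OF \<xi>]
  let ?m = "\<integral>\<omega>. (\<xi> \<omega>)\<^sup>2 \<partial>M"
  have inv0: "(\<lambda>n. 1 / real (Suc n)) \<longlonglongrightarrow> 0" by (rule LIMSEQ_Suc[OF lim_1_over_n])
  have A: "(\<lambda>n. \<integral>\<omega>. (clamp_rv n \<xi> \<omega> - \<xi> \<omega>)\<^sup>2 \<partial>M) \<longlonglongrightarrow> (\<integral>\<omega>. 0 \<partial>M)"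
  proof (rule integral_dominated_convergence)
    show "integrable M (\<lambda>\<omega>. (\<xi> \<omega>)\<^sup>2)" by (rule L2T_integrable_square[OF \<xi>])
    have "\<bar>clamp_rv n \<xi> \<omega> - \<xi> \<omega>\<bar> \<le> \<bar>\<xi> \<omega>\<bar>" for n \<omega>
      unfolding clamp_rv_def by auto
    then have "(clamp_rv n \<xi> \<omega> - \<xi> \<omega>)\<^sup>2 \<le> (\<xi> \<omega>)\<^sup>2" for n \<omega>
      by (simp add: abs_le_square_iff)
    then show "AE \<omega> in M. norm ((clamp_rv n \<xi> \<omega> - \<xi> \<omega>)\<^sup>2) \<le> (\<xi> \<omega>)\<^sup>2" for n by simp
    have "(\<lambda>n. (clamp_rv n \<xi> \<omega> - \<xi> \<omega>)\<^sup>2) \<longlonglongrightarrow> 0" for \<omega>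
    proof (rule tendsto_eventually)
      obtain K :: nat where K: "\<bar>\<xi> \<omega>\<bar> \<le> real K" using real_arch_simple by blast
      have "clamp_rv n \<xi> \<omega> = \<xi> \<omega>" if "K \<le> n" for n
        using K that unfolding clamp_rv_def by simp
      then show "\<forall>\<^sub>F n in sequentially. (clamp_rv n \<xi> \<omega> - \<xi> \<omega>)\<^sup>2 = 0"
        by (auto simp: eventually_sequentially)
    qed
    then show "AE \<omega> in M. (\<lambda>n. (clamp_rv n \<xi> \<omega> - \<xi> \<omega>)\<^sup>2) \<longlonglongrightarrow> 0" by simp
  qed auto
  have up: "defect n \<xi> \<le> (1 / real (Suc n)) * (2 + 2 * ?m) + (\<integral>\<omega>. (clamp_rv n \<xi> \<omega> - \<xi> \<omega>)\<^sup>2 \<partial>M)" for n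
  proof -
    let ?R = "real (Suc n)"
    have R: "1 \<le> ?R" by simp
    have "(\<integral>\<omega>. (spread n \<omega> - \<xi> \<omega>)\<^sup>2 \<partial>M) \<le> (\<integral>\<omega>. 2 * ?R\<^sup>2 + 2 * (\<xi> \<omega>)\<^sup>2 \<partial>M)"
    proof (rule integral_mono')
      show "integrable M (\<lambda>\<omega>. 2 * ?R\<^sup>2 + 2 * (\<xi> \<omega>)\<^sup>2)" using L2T_integrable_square[OF \<xi>] by simp
      fix \<omega>
      have "(spread n \<omega>)\<^sup>2 \<le> ?R\<^sup>2" using power_mono[OF spread_bounds[of n \<omega>], of 2] by simp
      then show "(spread n \<omega> - \<xi> \<omega>)\<^sup>2 \<le> 2 * ?R\<^sup>2 + 2 * (\<xi> \<omega>)\<^sup>2"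
        using zero_le_power2[of "spread n \<omega> + \<xi> \<omega>"]
        unfolding power2_diff power2_sum by linarith
    qed auto
    also have "\<dots> = 2 * ?R\<^sup>2 + 2 * ?m"
      using L2T_integrable_square[OF \<xi>] by (simp add: prob_space del: of_nat_Suc)
    \<comment> \<open>Inflating the second moment of \<open>\<xi>\<close> by
      \<open>?R^2 >= 1\<close> gives both terms the same power, so that the weight leaves a common
      factor \<open>1 / ?R\<close>.\<close>
    also have "\<dots> \<le> 2 * ?R\<^sup>2 + 2 * ?m * ?R\<^sup>2"
    proof -
      have "?m * 1 \<le> ?m * ?R\<^sup>2"
        using one_le_power[OF R, of 2] by (intro mult_left_mono) auto
      then show ?thesis by simp
    qed
    finally have "weight n * (\<integral>\<omega>. (spread n \<omega> - \<xi> \<omega>)\<^sup>2 \<partial>M) \<le> weight n * (2 * ?R\<^sup>2 + 2 * ?m * ?R\<^sup>2)"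
      using weight[of n] by (intro mult_left_mono) auto
    also have "\<dots> = (1 / ?R) * (2 + 2 * ?m)"
      unfolding weight_def by (simp add: field_simps power2_eq_square power3_eq_cube del: of_nat_Suc)
    finally have "weight n * (\<integral>\<omega>. (spread n \<omega> - \<xi> \<omega>)\<^sup>2 \<partial>M) \<le> (1 / ?R) * (2 + 2 * ?m)" .
    moreover have "(1 - weight n) * (\<integral>\<omega>. (clamp_rv n \<xi> \<omega> - \<xi> \<omega>)\<^sup>2 \<partial>M) \<le> 1 * (\<integral>\<omega>. (clamp_rv n \<xi> \<omega> - \<xi> \<omega>)\<^sup>2 \<partial>M)"
      using weight[of n] by (intro mult_right_mono) auto
    ultimately show ?thesis unfolding defect_def by linarith
  qed
  have low: "0 \<le> defect n \<xi>" for n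
    using weight[of n] unfolding defect_def by simp
  show ?thesis
  proof (rule tendsto_sandwich[OF _ _ tendsto_const])
    show "(\<lambda>n. (1 / real (Suc n)) * (2 + 2 * ?m) + (\<integral>\<omega>. (clamp_rv n \<xi> \<omega> - \<xi> \<omega>)\<^sup>2 \<partial>M)) \<longlonglongrightarrow> 0"
      using tendsto_add[OF tendsto_mult[OF inv0 tendsto_const[of "2 + 2 * ?m"]] A] by simp
  qed (use up low in auto)
qed

text \<open>The density bound of the regularised laws degenerates as \<open>n\<close> grows. This is
  harmless, because the number of mixture steps tends to infinity first, for fixed \<open>n\<close>,
  and already yields an exact sign.\<close>

lemma ll_monotone_if_diff_monotone:
  assumes dm: diff_monotone
  shows "lasry_lions_monotone M (F T) U"
  unfolding lasry_lions_monotone_iff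
proof (intro ballI)
  fix \<xi> \<zeta> assume \<xi>: "\<xi> \<in> L2T" and \<zeta>: "\<zeta> \<in> L2T"
  have gap: "ll_gap \<mu> \<nu> = ((\<integral>x. U x \<mu> \<partial>\<mu>) - (\<integral>x. U x \<nu> \<partial>\<mu>)) - ((\<integral>x. U x \<mu> \<partial>\<nu>) - (\<integral>x. U x \<nu> \<partial>\<nu>))"
    if \<mu>: "\<mu> \<in> P2" and \<nu>: "\<nu> \<in> P2" for \<mu> \<nu>
  proof -
    have i: "integrable \<alpha> (\<lambda>x. U x \<beta>)" if "\<alpha> \<in> P2" "\<beta> \<in> P2" for \<alpha> \<beta>
    proof -
      interpret a: real_distribution \<alpha> using that by (simp add: P2_def)
      have "integrable \<alpha> (\<lambda>x. x)"
        by (rule a.integrable_of_square) (use that in \<open>auto simp: P2_def\<close>)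
      then show ?thesis by (rule U_integrable[OF a.prob_space_axioms _ that(2)])
    qed
    show ?thesis unfolding ll_gap_def using i \<mu> \<nu> by simp
  qed
  have lim: "(\<lambda>n. \<integral>x. U x (regularised n X) \<partial>regularised n Y) \<longlonglongrightarrow> (\<integral>x. U x (law M X) \<partial>law M Y)"
    if X: "X \<in> L2T" and Y: "Y \<in> L2T" for X Y
  proof (rule U_integral_tendsto)
    have z: "(\<lambda>n. sqrt (defect n Z)) \<longlonglongrightarrow> 0" if "Z \<in> L2T" for Z
      using tendsto_real_sqrt[OF defect_tendsto[OF that]] by simp
    show "(\<lambda>n. sqrt (defect n X)) \<longlonglongrightarrow> 0" by (rule z[OF X])
    show "(\<lambda>n. bound_const * sqrt (defect n Y)) \<longlonglongrightarrow> 0"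
      using tendsto_mult[OF tendsto_const[of bound_const] z[OF Y]] by simp
  qed (use X Y in \<open>auto intro: regularised_in_P2 law_in_P2 regularised_close\<close>)
  have "(\<lambda>n. ll_gap (regularised n \<xi>) (regularised n \<zeta>)) \<longlonglongrightarrow> ll_gap (law M \<xi>) (law M \<zeta>)"
    unfolding gap[OF regularised_in_P2[OF \<xi>] regularised_in_P2[OF \<zeta>]] gap[OF law_in_P2[OF \<xi>] law_in_P2[OF \<zeta>]]
    by (intro tendsto_diff lim \<xi> \<zeta>)
  moreover have "0 \<le> ll_gap (regularised n \<xi>) (regularised n \<zeta>)" for n
  proof -
    let ?c = "weight n / (2 * real (Suc n))"
    note q\<xi> = quantile_unif[OF regularised_in_P2[OF \<xi>, of n]]
    note q\<zeta> = quantile_unif[OF regularised_in_P2[OF \<zeta>, of n]]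
    have c: "0 < ?c" using weight[of n] by simp
    \<comment> \<open>The regularised laws live on a coin space; their quantile functions of
      \<open>unif\<close> bring them back to elements of \<open>L2T\<close>.\<close>
    have "0 \<le> ll_gap (law M (\<lambda>\<omega>. quantile (regularised n \<xi>) (unif \<omega>))) (law M (\<lambda>\<omega>. quantile (regularised n \<zeta>) (unif \<omega>)))"
      by (rule ll_gap_nonneg_regular[where R = "real (Suc n)", OF dm q\<xi>(1) _ q\<zeta>(1) _ c])
        (simp_all only: q\<xi>(2) q\<zeta>(2) regular_regularised[OF \<xi>] regular_regularised[OF \<zeta>])
    then show ?thesis unfolding q\<xi>(2) q\<zeta>(2) .
  qed
  ultimately show "0 \<le> ll_gap (law M \<xi>) (law M \<zeta>)" by (intro LIMSEQ_le_const) auto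
qed

end

theorem proposition2p3:
  fixes M :: "'a measure" and F :: "real \<Rightarrow> 'a measure"
    and B :: "real \<Rightarrow> 'a \<Rightarrow> real" and T :: real
    and U :: "real \<Rightarrow> real measure \<Rightarrow> real"
  assumes "rich_brownian_space M F B T"
    and "U \<in> C14b M (F T)"
  shows "lasry_lions_monotone M (F T) U \<longleftrightarrow> second_order_lasry_lions_monotone M (F T) U"
proof -
  interpret smooth_functional M F B T U
    using assms by (simp add: smooth_functional_def smooth_functional_axioms_def)
  show ?thesis
    using diff_monotone_if_ll_monotone second_order_if_diff_monotone
      diff_monotone_if_second_order ll_monotone_if_diff_monotone by blast
qed

end
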